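(* Let $\mu\ge 0$, let $m\ge 0$ and $0\le k\le 2m$ be integers, and let $\phi_\nu=\frac{2\nu\pi}{2m+1}$ for $0\le\nu\le 2m$. Then for every $f\in L^2(W_\mu;B^2)$ and $(x,y)\in B^2$, $$\operatorname{proj}_k^\mu f(x,y)=\frac{1}{2m+1}\sum_{\nu=0}^{2m}a_\mu\int_{-1}^1\mathcal R_{\phi_\nu}^\mu(f;t)\,D_k^{\mu+1/2}(\phi_\nu,t;x,y)\,dt .$$
   Context: $B^2$ is the closed unit disk in $\mathbb R^2$; $W_\mu(x,y)=(1-x^2-y^2)^{\mu-1/2}$ on $B^2$; $a_\mu=(\mu+1/2)/\pi=1/\int_{B^2}W_\mu$; $\langle P,Q\rangle_\mu=a_\mu\int_{B^2}PQW_\mu\,dx\,dy$. $\mathcal V_k^2(W_\mu)$ is the space of polynomials in two variables of degree $k$ (together with $0$) that are orthogonal under $\langle\cdot,\cdot\rangle_\mu$ to all polynomials of total degree $<k$, and $\operatorname{proj}_k^\mu$ is the orthogonal projection of $L^2(W_\mu;B^2)$ onto $\mathcal V_k^2(W_\mu)$ (identified with its polynomial representative). Attenuated Radon projection: $$\mathcal R_\theta^\mu(f;t)=\int_{-\sqrt{1-t^2}}^{\sqrt{1-t^2}}f(t\cos\theta-s\sin\theta,\,t\sin\theta+s\cos\theta)\,(1-s^2-t^2)^{\mu-1/2}\,ds,\qquad -1\le t\le 1$$ (defined for a.e. $t$ for $f\in L^2(W_\mu;B^2)$). $(a)_k=a(a+1)\cdots(a+k-1)$. $C_k^\lambda$ is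 the Gegenbauer polynomial of degree $k$, orthogonal for $(1-s^2)^{\lambda-1/2}$ on $[-1,1]$, with $C_k^\lambda(1)=(2\lambda)_k/k!$. $p_l^{(\alpha,\beta)}$ is the Jacobi polynomial of degree $l$ with positive leading coefficient, orthonormal for the weight $(1-t)^\alpha(1+t)^\beta$ normalized to have integral $1$ on $[-1,1]$. Orthonormal basis of $\mathcal V_k^2(W_\mu)$: in polar coordinates $x=r\cos\phi$, $y=r\sin\phi$, $$P_{l,\varepsilon}^k(x,y)=h_{l,k}\,p_l^{(\mu-1/2,\,k-2l)}(2r^2-1)\,r^{k-2l}S_{k-2l,\varepsilon}(\phi),$$ where $S_{j,0}(\phi)=\cos j\phi$, $S_{j,1}(\phi)=\sin j\phi$, $0\le 2l\le k$ if $\varepsilon=0$, $0\le 2l\le k-1$ if $\varepsilon=1$, and $$h_{l,k}^2=\frac1{d_{l,k}}\,\frac{\Gamma(k-2l+\mu+3/2)}{\Gamma(\mu+3/2)\Gamma(k-2l+1)},\quad h_{l,k}>0,\qquad d_{l,k}=\tfrac12\ (2l<k),\quad d_{l,k}=1\ (2l=k).$$ $$\lambda_{l,k}^\mu=\frac{l!\,(k-l)!\,(k-l+\mu+\frac12)}{(\mu+\frac12)_l\,(\mu+\frac32)_{k-l}\,(k+\mu+\frac12)},\qquad D_k^{\mu+1/2}(\xi;x,y)=\sum_{l,\varepsilon}\lambda_{l,k}^\mu\,P_{l,\varepsilon}^k(\cos\xi,\sin\xi)\,P_{l,\varepsilon}^k(x,y)$$ (sum over all admissible pairs $(l,\varepsilon)$),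 and $$D_k^{\mu+1/2}(\xi,t;x,y)=\frac{k+\mu+1/2}{\mu+1/2}\,C_k^{\mu+1/2}(t)\,D_k^{\mu+1/2}(\xi;x,y).$$ *)

theory Defs
  imports "HOL-Analysis.Analysis" "HOL-Computational_Algebra.Polynomial"
begin

abbreviation disk :: "(real \<times> real) set" where
  "disk \<equiv> cball 0 1"

(* For mu < 1/2 the weight is infinite on the unit circle, where powr returns 0;
   the circle is a null set. *)
definition disk_weight :: "real \<Rightarrow> real \<times> real \<Rightarrow> real" where
  "disk_weight \<mu> = (\<lambda>(x, y). (1 - x\<^sup>2 - y\<^sup>2) powr (\<mu> - 1/2))"

definition a_const :: "real \<Rightarrow> real" where
  "a_const \<mu> = (\<mu> + 1/2) / pi"

definition ip :: "real \<Rightarrow> (real \<times> real \<Rightarrow> real) \<Rightarrow> (real \<times> real \<Rightarrow> real) \<Rightarrow> real" where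
  "ip \<mu> P Q = a_const \<mu> * (LINT z:disk|lebesgue. P z * Q z * disk_weight \<mu> z)"

(* Functions rather than equivalence classes; values outside the disk are unconstrained. *)
definition L2_disk :: "real \<Rightarrow> (real \<times> real \<Rightarrow> real) set" where
  "L2_disk \<mu> = {f. set_borel_measurable lebesgue disk f \<and>
                   set_integrable lebesgue disk (\<lambda>z. (f z)\<^sup>2 * disk_weight \<mu> z)}"

(* Bivariate real polynomials, as functions on the plane, of total degree less than n.
   For n = 0 this is the zero polynomial only. *)
definition polys_below :: "nat \<Rightarrow> (real \<times> real \<Rightarrow> real) set" where
  "polys_below n =
     {P. \<exists>c :: nat \<Rightarrow> nat \<Rightarrow> real.
           P = (\<lambda>(x, y). \<Sum>(i, j)\<in>{(i, j). i + j < n}. c i j * x ^ i * y ^ j)}"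

definition orth_polys :: "nat \<Rightarrow> real \<Rightarrow> (real \<times> real \<Rightarrow> real) set" where
  "orth_polys k \<mu> = {P \<in> polys_below (Suc k) - polys_below k. \<forall>Q\<in>polys_below k. ip \<mu> P Q = 0} \<union> {\<lambda>_. 0}"

(* For f in L2_disk mu the THE is well defined: orth_polys k mu is finite-dimensional, and a
   polynomial function is determined by its values on the disk. *)
definition proj :: "nat \<Rightarrow> real \<Rightarrow> (real \<times> real \<Rightarrow> real) \<Rightarrow> real \<times> real \<Rightarrow> real" where
  "proj k \<mu> f = (THE P. P \<in> orth_polys k \<mu> \<and> (\<forall>Q\<in>orth_polys k \<mu>. ip \<mu> (\<lambda>z. f z - P z) Q = 0))"

definition Radon :: "real \<Rightarrow> real \<Rightarrow> (real \<times> real \<Rightarrow> real) \<Rightarrow> real \<Rightarrow> real" where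
  "Radon \<mu> \<theta> f t =
     (LINT s:{- sqrt (1 - t\<^sup>2)..sqrt (1 - t\<^sup>2)}|lebesgue.
        f (t * cos \<theta> - s * sin \<theta>, t * sin \<theta> + s * cos \<theta>) * (1 - s\<^sup>2 - t\<^sup>2) powr (\<mu> - 1/2))"

definition Gegenbauer :: "nat \<Rightarrow> real \<Rightarrow> real poly" where
  "Gegenbauer k \<kappa> = (THE p. degree p = k \<and>
     (\<forall>q. degree q < k \<longrightarrow>
        (LINT s:{-1..1}|lebesgue. poly p s * poly q s * (1 - s\<^sup>2) powr (\<kappa> - 1/2)) = 0) \<and>
     poly p 1 = pochhammer (2 * \<kappa>) k / fact k)"

definition jacobi_weight :: "real \<Rightarrow> real \<Rightarrow> real \<Rightarrow> real" where
  "jacobi_weight \<alpha> \<beta> t = (1 - t) powr \<alpha> * (1 + t) powr \<beta>"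

definition jacobi_ip :: "real \<Rightarrow> real \<Rightarrow> real poly \<Rightarrow> real poly \<Rightarrow> real" where
  "jacobi_ip \<alpha> \<beta> p q =
     (LINT t:{-1..1}|lebesgue. poly p t * poly q t * jacobi_weight \<alpha> \<beta> t) /
     (LINT t:{-1..1}|lebesgue. jacobi_weight \<alpha> \<beta> t)"

definition Jacobi :: "nat \<Rightarrow> real \<Rightarrow> real \<Rightarrow> real poly" where
  "Jacobi l \<alpha> \<beta> = (THE p. degree p = l \<and> lead_coeff p > 0 \<and>
     (\<forall>q. degree q < l \<longrightarrow> jacobi_ip \<alpha> \<beta> p q = 0) \<and> jacobi_ip \<alpha> \<beta> p p = 1)"

definition ang :: "nat \<Rightarrow> nat \<Rightarrow> real \<Rightarrow> real" where
  "ang j \<epsilon> \<phi> = (if \<epsilon> = 0 then cos (real j * \<phi>) else sin (real j * \<phi>))"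

definition d_coef :: "nat \<Rightarrow> nat \<Rightarrow> real" where
  "d_coef l k = (if 2 * l < k then 1/2 else 1)"

definition h_coef :: "real \<Rightarrow> nat \<Rightarrow> nat \<Rightarrow> real" where
  "h_coef \<mu> l k = sqrt (1 / d_coef l k *
     (Gamma (real (k - 2 * l) + \<mu> + 3/2) / (Gamma (\<mu> + 3/2) * Gamma (real (k - 2 * l) + 1))))"

(* Admissible pairs (l, epsilon); 2 * l + 1 <= k stands for 2 l <= k - 1,
   which would be wrong for k = 0 with truncated subtraction. *)
definition adm :: "nat \<Rightarrow> (nat \<times> nat) set" where
  "adm k = {(l, 0) |l. 2 * l \<le> k} \<union> {(l, 1) |l. 2 * l + 1 \<le> k}"

(* The angle chosen at the origin is irrelevant: there either the radial factor vanishes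
   or k = 2 l and the angular factor is cos 0. *)
definition basisP :: "real \<Rightarrow> nat \<Rightarrow> nat \<Rightarrow> nat \<Rightarrow> real \<times> real \<Rightarrow> real" where
  "basisP \<mu> k l \<epsilon> = (\<lambda>(x, y).
     let r = sqrt (x\<^sup>2 + y\<^sup>2); \<phi> = Arg (Complex x y) in
       h_coef \<mu> l k * poly (Jacobi l (\<mu> - 1/2) (real (k - 2 * l))) (2 * r\<^sup>2 - 1)
         * r ^ (k - 2 * l) * ang (k - 2 * l) \<epsilon> \<phi>)"

definition lam :: "real \<Rightarrow> nat \<Rightarrow> nat \<Rightarrow> real" where
  "lam \<mu> l k = (fact l * fact (k - l) * (real (k - l) + \<mu> + 1/2)) /
     (pochhammer (\<mu> + 1/2) l * pochhammer (\<mu> + 3/2) (k - l) * (real k + \<mu> + 1/2))"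

(* The index mu here corresponds to the superscript mu + 1/2 of the kernels D_k. *)
definition D_ang :: "real \<Rightarrow> nat \<Rightarrow> real \<Rightarrow> real \<times> real \<Rightarrow> real" where
  "D_ang \<mu> k \<xi> z = (\<Sum>(l, \<epsilon>)\<in>adm k. lam \<mu> l k * basisP \<mu> k l \<epsilon> (cos \<xi>, sin \<xi>) * basisP \<mu> k l \<epsilon> z)"

definition D_ker :: "real \<Rightarrow> nat \<Rightarrow> real \<Rightarrow> real \<Rightarrow> real \<times> real \<Rightarrow> real" where
  "D_ker \<mu> k \<xi> t z = (real k + \<mu> + 1/2) / (\<mu> + 1/2) * poly (Gegenbauer k (\<mu> + 1/2)) t * D_ang \<mu> k \<xi> z"

end

theory Submission
  imports Defs
begin

text \<open>
  Let \<open>V\<close> be the space of orthogonal polynomials of degree \<open>k\<close>. In rotated coordinates a polynomial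
  \<open>Q\<close> of degree at most \<open>n\<close> has Radon projection \<open>(1 - t\<^sup>2) powr \<mu> * p t\<close> with \<open>p\<close> a polynomial of
  degree at most \<open>n\<close> whose value at 1 is a fixed multiple of \<open>Q (cos \<theta>, sin \<theta>)\<close>. If \<open>Q\<close> lies in \<open>V\<close>,
  then \<open>p\<close> is orthogonal to lower degrees, hence a multiple of the Gegenbauer polynomial, and so
  pairing \<open>Q\<close> with the normalized ridge polynomial in direction \<open>\<theta>\<close> gives back \<open>Q (cos \<theta>, sin \<theta>)\<close>.
  Therefore the ridge polynomial equals \<open>\<Sum>b. P\<^sub>b (cos \<theta>, sin \<theta>) * P\<^sub>b\<close> for the orthonormal basis \<open>P\<^sub>b\<close> of
  \<open>V\<close>, and the integral against the kernel in one direction becomes a double sum over the basis.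
  Summing over the directions, the discrete orthogonality of the trigonometric system at \<open>2 m + 1\<close>
  equally spaced nodes leaves the diagonal, where the factor \<open>lam\<close> cancels \<open>P\<^sub>b\<^sup>2\<close> averaged over the
  circle; this last identity is the classical value at 1 of the orthonormal Jacobi polynomials.
\<close>

subsection \<open>Lebesgue measure under rotations\<close>

text \<open>Why one direction evaluates at a boundary point: as t tends to 1 the chord shrinks to
  (cos \<theta>, sin \<theta>), so the value at 1 of the polynomial part of the Radon projection
  sees \<open>Q\<close> only there, and a multiple of a fixed orthogonal polynomial is determined by
  its value at 1. For this reason all one-variable polynomials, which are introduced by
  characterizing properties, are reduced to one explicit family \<open>jac\<close> with value 1 at
  1: the Gegenbauer polynomial has parameters \<mu>, \<mu>, the radial parts have \<mu> - 1/2, k - 2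
  l. Averaging over directions makes the double sum diagonal but not the identity, because the mean
  square of a basis element over the circle depends on \<open>l\<close>; hence a correction factor
  inside the kernel. The function \<open>f\<close> enters only through integrals against
  polynomials, so that square integrability, Fubini and rotation invariance suffice and
  \<open>f\<close> is never approximated.\<close>

lemma lborel_shear_fst:
  "distr lborel borel (\<lambda>(x, y). (x + a * y, y)) = (lborel :: (real \<times> real) measure)"
proof (rule measure_eqI)
  fix A :: "(real \<times> real) set"
  assume "A \<in> sets (distr lborel borel (\<lambda>(x, y). (x + a * y, y)))"
  then have [measurable]: "A \<in> sets borel" by simp
  have [measurable]: "(\<lambda>(x, y). (x + a * y, y) :: real \<times> real) \<in> borel_measurable borel"
    by (simp add: borel_prod[symmetric] split_beta)
  \<comment> \<open>For fixed \<open>y\<close> the shear translates \<open>x\<close>, so Fubini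
    reduces the claim to translation invariance on the line.\<close>
  have slice: "(\<integral>\<^sup>+x. indicator A (x + a * y, y) \<partial>lborel) = (\<integral>\<^sup>+x. indicator A (x, y) \<partial>lborel)" for y :: real
  proof -
    have "(\<integral>\<^sup>+x. indicator A (x, y) \<partial>lborel)
        = (\<integral>\<^sup>+x. indicator A (x, y) \<partial>distr lborel borel ((+) (a * y)))"
      by (simp add: lborel_distr_plus)
    also have "\<dots> = (\<integral>\<^sup>+x. indicator A (a * y + x, y) \<partial>lborel)"
      by (subst nn_integral_distr) simp_all
    finally show ?thesis by (simp add: add.commute)
  qed
  have "emeasure (distr lborel borel (\<lambda>(x, y). (x + a * y, y))) A
      = (\<integral>\<^sup>+z. indicator A z \<partial>distr lborel borel (\<lambda>(x, y). (x + a * y, y)))"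
    by (subst nn_integral_indicator) simp_all
  also have "\<dots> = (\<integral>\<^sup>+z. indicator A (case z of (x, y) \<Rightarrow> (x + a * y, y)) \<partial>lborel)"
    by (subst nn_integral_distr) simp_all
  also have "\<dots> = (\<integral>\<^sup>+y. \<integral>\<^sup>+x. indicator A (x + a * y, y) \<partial>lborel \<partial>lborel)"
    using lborel_pair.nn_integral_snd[of "\<lambda>z. indicator A (case z of (x, y) \<Rightarrow> (x + a * y, y))"]
    by (simp add: lborel_prod)
  also have "\<dots> = (\<integral>\<^sup>+y. \<integral>\<^sup>+x. indicator A (x, y) \<partial>lborel \<partial>lborel)"
    by (simp add: slice)
  also have "\<dots> = (\<integral>\<^sup>+z. indicator A z \<partial>lborel)"
    using lborel_pair.nn_integral_snd[of "indicator A"] by (simp add: lborel_prod)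
  finally show "emeasure (distr lborel borel (\<lambda>(x, y). (x + a * y, y))) A = emeasure lborel A"
    by simp
qed simp

lemma lborel_prod_swap:
  "distr lborel borel prod.swap = (lborel :: (real \<times> real) measure)"
proof -
  have "(lborel :: (real \<times> real) measure) = distr lborel lborel (\<lambda>(x, y). (y, x))"
    using lborel_pair.distr_pair_swap[where 'a=real and 'b=real] unfolding lborel_prod .
  also have "\<dots> = distr lborel borel prod.swap"
    by (rule distr_cong) auto
  finally show ?thesis by simp
qed

lemma lborel_distr_comp:
  fixes f g :: "real \<times> real \<Rightarrow> real \<times> real"
  assumes "distr lborel borel f = lborel" "distr lborel borel g = lborel"
    and [measurable]: "f \<in> borel_measurable borel" "g \<in> borel_measurable borel"
  shows "distr lborel borel (\<lambda>z. f (g z)) = lborel"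
proof -
  have "distr lborel borel (\<lambda>z. f (g z)) = distr (distr lborel borel g) borel f"
    by (subst distr_distr) (simp_all add: comp_def)
  with assms show ?thesis by simp
qed

lemma lborel_shear_snd:
  "distr lborel borel (\<lambda>(x, y). (x, y + a * x)) = (lborel :: (real \<times> real) measure)"
proof -
  have m [measurable]: "(prod.swap :: real \<times> real \<Rightarrow> real \<times> real) \<in> borel_measurable borel"
      "(\<lambda>(x, y). (x + a * y, y) :: real \<times> real) \<in> borel_measurable borel"
    by (simp_all add: borel_prod[symmetric] prod.swap_def[abs_def] split_beta)
  have "distr lborel borel (\<lambda>z. prod.swap ((\<lambda>(x, y). (x + a * y, y)) (prod.swap z)))
      = (lborel :: (real \<times> real) measure)"
    using lborel_distr_comp[OF lborel_prod_swap lborel_distr_comp[OF lborel_shear_fst lborel_prod_swap]]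
      m by measurable
  moreover have "(\<lambda>z. prod.swap ((\<lambda>(x, y). (x + a * y, y)) (prod.swap z)))
      = (\<lambda>(x, y). (x, y + a * x) :: real \<times> real)"
    by auto
  ultimately show ?thesis by simp
qed

text \<open>The coordinates are those of \<open>Radon\<close>: \<open>t\<close> is the signed
  distance of a chord from the origin and \<open>s\<close> the position on it.\<close>

definition rot :: "real \<Rightarrow> real \<times> real \<Rightarrow> real \<times> real" where
  "rot \<theta> = (\<lambda>(t, s). (t * cos \<theta> - s * sin \<theta>, t * sin \<theta> + s * cos \<theta>))"

lemma rot_measurable [measurable]: "rot \<theta> \<in> borel_measurable borel"
  by (simp add: rot_def borel_prod[symmetric] split_beta)

lemma rot_rot: "rot a (rot b z) = rot (a + b) z"
  by (cases z) (simp add: rot_def cos_add sin_add algebra_simps)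

text \<open>A rotation with \<open>sin \<theta> \<noteq> 0\<close> is a product of three shears.\<close>

lemma lborel_rot: "distr lborel borel (rot \<theta>) = lborel"
proof -
  have gen: "distr lborel borel (rot \<theta>) = lborel" if s: "sin \<theta> \<noteq> 0" for \<theta>
  proof -
    \<comment> \<open>This is - tan (\<theta> / 2), the horizontal shear in the factorization of a
      rotation into horizontal, vertical and horizontal shears.\<close>
    define a where "a = (cos \<theta> - 1) / sin \<theta>"
    have as: "a * sin \<theta> = cos \<theta> - 1" using s by (simp add: a_def)
    have cc: "a * (cos \<theta> + 1) = - sin \<theta>"
    proof -
      have "(cos \<theta> - 1) * (cos \<theta> + 1) = - (sin \<theta> * sin \<theta>)"
        using sin_cos_squared_add[of \<theta>] by (simp add: power2_eq_square algebra_simps)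
      thus ?thesis using s by (simp add: a_def field_simps)
    qed
    have m [measurable]: "(\<lambda>(x, y). (x + a * y, y) :: real \<times> real) \<in> borel_measurable borel"
        "(\<lambda>(x, y). (x, y + sin \<theta> * x) :: real \<times> real) \<in> borel_measurable borel"
      by (simp_all add: borel_prod[symmetric] split_beta)
    let ?f = "\<lambda>(x, y). (x + a * y, y) :: real \<times> real"
    let ?g = "\<lambda>(x, y). (x, y + sin \<theta> * x) :: real \<times> real"
    have "distr lborel borel (\<lambda>z. ?f (?g (?f z))) = lborel"
      by (rule lborel_distr_comp[of ?f "\<lambda>z. ?g (?f z)"])
         (use lborel_distr_comp[of ?g ?f] lborel_shear_fst lborel_shear_snd m in measurable)
    moreover have "(\<lambda>z. ?f (?g (?f z))) = rot \<theta>"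
    proof (rule ext, clarsimp simp: rot_def)
      fix x y :: real
      have 1: "y + sin \<theta> * (x + a * y) = x * sin \<theta> + y * cos \<theta>"
      proof -
        have "y + sin \<theta> * (x + a * y) = x * sin \<theta> + y * (1 + a * sin \<theta>)" by (simp add: algebra_simps)
        thus ?thesis by (simp add: as)
      qed
      have "x + a * y + a * (x * sin \<theta> + y * cos \<theta>) = x * (1 + a * sin \<theta>) + y * (a * (cos \<theta> + 1))"
        by (simp add: algebra_simps)
      hence 2: "x + a * y + a * (x * sin \<theta> + y * cos \<theta>) = x * cos \<theta> - y * sin \<theta>" 
        by (simp add: as cc)
      show "x + a * y + a * (y + sin \<theta> * (x + a * y)) = x * cos \<theta> - y * sin \<theta> \<and>
          y + sin \<theta> * (x + a * y) = x * sin \<theta> + y * cos \<theta>"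
        unfolding 1 using 2 by simp
    qed
    ultimately show ?thesis by simp
  qed
  show ?thesis
  proof (cases "sin \<theta> = 0")
    case True
    \<comment> \<open>A quarter turn is split off, so that both factors have nonzero sine.\<close>
    have "sin (\<theta> - pi / 2) \<noteq> 0"
      using True sin_cos_squared_add[of \<theta>] by (auto simp: sin_diff)
    hence "distr lborel borel (\<lambda>z. rot (\<theta> - pi / 2) (rot (pi / 2) z)) = lborel"
      using lborel_distr_comp[OF gen gen, of "\<theta> - pi / 2" "pi / 2"] by simp
    thus ?thesis by (simp add: rot_rot)
  qed (rule gen)
qed

section \<open>Fubini for Lebesgue integrals in rotated coordinates\<close>

lemma lebesgue_cong_AE:
  fixes F g :: "'a::euclidean_space \<Rightarrow> real"
  assumes "AE z in lborel. F z = g z" "integrable lborel g"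
  shows "integrable lebesgue F" "integral\<^sup>L lebesgue F = integral\<^sup>L lborel g"
proof -
  have ae: "AE z in lebesgue. g z = F z"
    using AE_completion[OF assms(1)] by eventually_elim simp
  have g: "g \<in> borel_measurable lebesgue" "integrable lebesgue g"
    using assms(2) by (auto intro: measurable_completion simp: integrable_completion)
  have F: "F \<in> borel_measurable lebesgue"
    using borel_measurable_AE[OF g(1) ae] .
  show "integrable lebesgue F"
    using integrable_cong_AE_imp[OF g(2) F ae] .
  show "integral\<^sup>L lebesgue F = integral\<^sup>L lborel g"
    using integral_cong_AE[OF g(1) F ae] integral_completion[of g lborel] assms(2) by auto
qed

lemma lebesgue_integrable_borel_version:
  fixes F :: "'a::euclidean_space \<Rightarrow> real"
  assumes "integrable lebesgue F"
  obtains g where "integrable lborel g" "AE z in lborel. F z = g z"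
    "integral\<^sup>L lborel g = integral\<^sup>L lebesgue F"
proof -
  obtain g where g: "g \<in> borel_measurable lborel" "AE z in lborel. F z = g z"
    using completion_ex_borel_measurable_real[of F lborel] assms by auto
  have "AE z in lebesgue. F z = g z" using AE_completion[OF g(2)] .
  hence "integrable lebesgue g"
    by (intro integrable_cong_AE_imp[OF assms]) (use g in \<open>auto intro: measurable_completion\<close>)
  hence i: "integrable lborel g" using g by (simp add: integrable_completion)
  with lebesgue_cong_AE[OF g(2) i] g that show ?thesis by auto
qed

text \<open>Lebesgue measure on the plane completes the product measure, so a Lebesgue measurable
  \<open>F\<close> need not have measurable slices. It is replaced by a Borel function equal to it
  almost everywhere; the exceptional set stays null under rotation, and almost all of its slices are
  null.\<close>

lemma rotated_Fubini:
  fixes F :: "real \<times> real \<Rightarrow> real"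
  assumes "integrable lebesgue F"
  shows "integrable lebesgue (\<lambda>t. LINT s|lebesgue. F (rot \<theta> (t, s)))"
    and "(LINT t|lebesgue. (LINT s|lebesgue. F (rot \<theta> (t, s)))) = integral\<^sup>L lebesgue F"
    and "integrable lebesgue (\<lambda>z. F (rot \<theta> z))"
    and "(LINT z|lebesgue. F (rot \<theta> z)) = integral\<^sup>L lebesgue F"
proof -
  obtain g where g: "integrable lborel g" "AE z in lborel. F z = g z"
    "integral\<^sup>L lborel g = integral\<^sup>L lebesgue F"
    using lebesgue_integrable_borel_version[OF assms] .
  have [measurable]: "g \<in> borel_measurable borel" using g(1) by auto
  have ae: "AE z in lborel. F (rot \<theta> z) = g (rot \<theta> z)"
    using AE_distrD[of "rot \<theta>" lborel borel "\<lambda>z. F z = g z"] g(2) unfolding lborel_rot by simp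
  have gi: "integrable lborel (\<lambda>z. g (rot \<theta> z))"
    using g(1) by (subst (asm) lborel_rot[of \<theta>, symmetric], subst (asm) integrable_distr_eq) auto
  have gv: "(LINT z|lborel. g (rot \<theta> z)) = integral\<^sup>L lebesgue F"
    by (subst g(3)[symmetric], subst (2) lborel_rot[of \<theta>, symmetric], subst integral_distr) auto
  show "integrable lebesgue (\<lambda>z. F (rot \<theta> z))" "(LINT z|lebesgue. F (rot \<theta> z)) = integral\<^sup>L lebesgue F"
    using lebesgue_cong_AE[OF ae gi] gv by auto
  have gi': "integrable (lborel \<Otimes>\<^sub>M lborel) (\<lambda>z. g (rot \<theta> z))" using gi by (simp add: lborel_prod)
  have ae': "AE t in lborel. AE s in lborel. F (rot \<theta> (t, s)) = g (rot \<theta> (t, s))"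
    by (rule lborel_pair.AE_pair) (use ae in \<open>unfold lborel_prod\<close>)
  have "AE t in lborel. (LINT s|lebesgue. F (rot \<theta> (t, s))) = (LINT s|lborel. g (rot \<theta> (t, s)))"
    using ae' lborel_pair.AE_integrable_fst'[OF gi']
    by eventually_elim (rule lebesgue_cong_AE)
  from lebesgue_cong_AE[OF this lborel_pair.integrable_fst'[OF gi']]
  show "integrable lebesgue (\<lambda>t. LINT s|lebesgue. F (rot \<theta> (t, s)))"
    "(LINT t|lebesgue. (LINT s|lebesgue. F (rot \<theta> (t, s)))) = integral\<^sup>L lebesgue F"
    using lborel_pair.integral_fst'[OF gi'] gv by (auto simp: lborel_prod)
qed

lemma norm_rot [simp]: "norm (rot \<theta> z) = norm z"
proof -
  obtain t s where z: "z = (t, s)" by force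
  have "(t * cos \<theta> - s * sin \<theta>)\<^sup>2 + (t * sin \<theta> + s * cos \<theta>)\<^sup>2
      = (t\<^sup>2 + s\<^sup>2) * ((sin \<theta>)\<^sup>2 + (cos \<theta>)\<^sup>2)"
    by algebra
  thus ?thesis by (simp add: z rot_def norm_Pair)
qed

lemma disk_iff: "z \<in> disk \<longleftrightarrow> (fst z)\<^sup>2 + (snd z)\<^sup>2 \<le> 1"
  by (cases z) (simp add: norm_Pair)

lemma rot_disk [simp]: "rot \<theta> z \<in> disk \<longleftrightarrow> z \<in> disk"
  by simp

lemma disk_weight_rot [simp]: "disk_weight \<mu> (rot \<theta> z) = disk_weight \<mu> z"
proof -
  have "disk_weight \<mu> w = (1 - (norm w)\<^sup>2) powr (\<mu> - 1/2)" for w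
    by (cases w) (simp add: disk_weight_def norm_Pair algebra_simps)
  thus ?thesis by simp
qed

section \<open>Duality of Radon projections and ridge functions\<close>

definition dotdir :: "real \<Rightarrow> real \<times> real \<Rightarrow> real" where
  "dotdir \<theta> z = fst z * cos \<theta> + snd z * sin \<theta>"

lemma dotdir_rot [simp]: "dotdir \<theta> (rot \<theta> (t, s)) = t"
proof -
  have "dotdir \<theta> (rot \<theta> (t, s)) = t * ((sin \<theta>)\<^sup>2 + (cos \<theta>)\<^sup>2)"
    unfolding dotdir_def rot_def by (simp only: prod.case fst_conv snd_conv) algebra
  thus ?thesis by simp
qed

text \<open>Fubini over the chords perpendicular to the direction \<theta>, on which the ridge
  factor is constant. The inner integrals agree for every \<open>t\<close>, including chords on
  which the integral of \<open>f\<close> diverges and takes the default value 0.\<close>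

lemma Radon_pairing:
  assumes "set_integrable lebesgue disk (\<lambda>z. f z * g (dotdir \<theta> z) * disk_weight \<mu> z)"
  shows "(LINT t:{-1..1}|lebesgue. Radon \<mu> \<theta> f t * g t)
       = (LINT z:disk|lebesgue. f z * g (dotdir \<theta> z) * disk_weight \<mu> z)"
proof -
  define F where "F = (\<lambda>z. indicator disk z *\<^sub>R (f z * g (dotdir \<theta> z) * disk_weight \<mu> z))"
  have F: "integrable lebesgue F" using assms by (simp add: F_def set_integrable_def)
  have "(LINT s|lebesgue. F (rot \<theta> (t, s))) = indicator {-1..1} t *\<^sub>R (Radon \<mu> \<theta> f t * g t)" for t
  proof -
    have ind: "indicator disk (t, s) = indicator {-1..1} t * (indicator {- sqrt (1 - t\<^sup>2)..sqrt (1 - t\<^sup>2)} s :: real)" for s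
    proof -
      have "t\<^sup>2 + s\<^sup>2 \<le> 1 \<longleftrightarrow> \<bar>t\<bar> \<le> 1 \<and> \<bar>s\<bar> \<le> sqrt (1 - t\<^sup>2)"
      proof
        assume *: "t\<^sup>2 + s\<^sup>2 \<le> 1"
        have "t\<^sup>2 \<le> 1" using * zero_le_power2[of s] by linarith
        moreover have "s\<^sup>2 \<le> 1 - t\<^sup>2" using * by simp
        ultimately show "\<bar>t\<bar> \<le> 1 \<and> \<bar>s\<bar> \<le> sqrt (1 - t\<^sup>2)"
          using real_sqrt_le_mono[of "s\<^sup>2" "1 - t\<^sup>2"] by (simp add: abs_square_le_1)
      next
        assume *: "\<bar>t\<bar> \<le> 1 \<and> \<bar>s\<bar> \<le> sqrt (1 - t\<^sup>2)"
        hence "t\<^sup>2 \<le> 1" by (simp add: abs_square_le_1)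
        moreover have "\<bar>s\<bar>\<^sup>2 \<le> (sqrt (1 - t\<^sup>2))\<^sup>2" using * by (intro power_mono) auto
        ultimately show "t\<^sup>2 + s\<^sup>2 \<le> 1" by simp
      qed
      thus ?thesis unfolding indicator_def disk_iff by (auto simp: abs_le_iff)
    qed
    have "(LINT s|lebesgue. F (rot \<theta> (t, s)))
        = (LINT s|lebesgue. (indicator {-1..1} t * g t) * (indicator {- sqrt (1 - t\<^sup>2)..sqrt (1 - t\<^sup>2)} s *\<^sub>R
            (f (t * cos \<theta> - s * sin \<theta>, t * sin \<theta> + s * cos \<theta>) * (1 - s\<^sup>2 - t\<^sup>2) powr (\<mu> - 1/2))))"
    proof (rule Bochner_Integration.integral_cong[OF refl])
      fix s
      have i: "indicator disk (rot \<theta> (t, s)) = (indicator disk (t, s) :: real)"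
        unfolding indicator_def by (simp only: rot_disk)
      have w: "disk_weight \<mu> (t, s) = (1 - s\<^sup>2 - t\<^sup>2) powr (\<mu> - 1/2)"
        by (simp add: disk_weight_def algebra_simps)
      show "F (rot \<theta> (t, s)) = (indicator {-1..1} t * g t) * (indicator {- sqrt (1 - t\<^sup>2)..sqrt (1 - t\<^sup>2)} s *\<^sub>R
            (f (t * cos \<theta> - s * sin \<theta>, t * sin \<theta> + s * cos \<theta>) * (1 - s\<^sup>2 - t\<^sup>2) powr (\<mu> - 1/2)))"
        unfolding F_def i ind disk_weight_rot dotdir_rot w by (simp add: rot_def)
    qed
    also have "\<dots> = indicator {-1..1} t *\<^sub>R (Radon \<mu> \<theta> f t * g t)"
      by (simp add: Radon_def set_lebesgue_integral_def)
    finally show ?thesis .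
  qed
  with rotated_Fubini(2)[OF F, of \<theta>] show ?thesis
    by (simp add: set_lebesgue_integral_def F_def)
qed

lemma set_lebesgue_lborel:
  fixes F :: "'a::euclidean_space \<Rightarrow> real"
  assumes [measurable]: "F \<in> borel_measurable borel" "S \<in> sets borel"
  shows "set_integrable lebesgue S F \<longleftrightarrow> set_integrable lborel S F"
    and "(LINT z:S|lebesgue. F z) = (LINT z:S|lborel. F z)"
  unfolding set_integrable_def set_lebesgue_integral_def
  by (subst integrable_completion, auto) (subst integral_completion, auto)

lemma open_AE_empty:
  fixes U :: "'a::euclidean_space set"
  assumes "open U" "AE z in lebesgue. z \<notin> U"
  shows "U = {}"
proof -
  have "U \<in> null_sets lebesgue"
    using assms by (subst AE_iff_null_sets) auto
  thus ?thesis using open_not_negligible[OF assms(1)] by (auto simp: negligible_iff_null_sets)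
qed

subsection \<open>Radial integrals over the disk\<close>

definition nrm2 :: "real \<times> real \<Rightarrow> real" where
  "nrm2 z = (fst z)\<^sup>2 + (snd z)\<^sup>2"

lemma nrm2_norm: "nrm2 z = (norm z)\<^sup>2"
  by (cases z) (simp add: nrm2_def norm_Pair)

lemma nrm2_nonneg [simp]: "0 \<le> nrm2 z"
  by (simp add: nrm2_def)

lemma nrm2_le_1_iff: "nrm2 z \<le> 1 \<longleftrightarrow> z \<in> disk"
  unfolding nrm2_def disk_iff ..

lemma continuous_on_nrm2 [continuous_intros]: "continuous_on S nrm2"
  unfolding nrm2_def by (intro continuous_intros)

lemma nrm2_measurable [measurable]: "nrm2 \<in> borel_measurable borel"
  by (intro borel_measurable_continuous_onI continuous_on_nrm2)

lemma disk_weight_nrm2: "disk_weight \<mu> z = (1 - nrm2 z) powr (\<mu> - 1/2)"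
  by (cases z) (simp add: disk_weight_def nrm2_def algebra_simps)

lemma disk_weight_measurable [measurable]: "disk_weight \<mu> \<in> borel_measurable borel"
  unfolding disk_weight_nrm2[abs_def] by measurable

lemma disk_weight_nonneg [simp]: "0 \<le> disk_weight \<mu> z"
  by (simp add: disk_weight_nrm2)

lemma disk_measurable [measurable]: "disk \<in> sets borel"
  by simp

text \<open>A disk of radius \<open>sqrt x\<close> has area \<open>pi * x\<close>, so the squared
  radius is uniform on [0, 1] with total mass pi. Finite measures on the line are determined by the
  half-lines, and radial integrals follow without a change to polar coordinates.\<close>

lemma distr_disk_nrm2:
  "distr (density lborel (\<lambda>z. ennreal (indicator disk z))) borel nrm2
     = density lborel (\<lambda>u. ennreal (pi * indicator {0..1} u))"
proof -
  let ?M = "distr (density lborel (\<lambda>z. ennreal (indicator disk z))) borel nrm2"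
  let ?N = "density lborel (\<lambda>u::real. ennreal (pi * indicator {0..1} u))"
  have cb: "emeasure lborel (cball 0 r :: (real \<times> real) set) = ennreal (pi * r\<^sup>2)" if "r \<ge> 0" for r
    using emeasure_cball[of r "0 :: real \<times> real"] that by (simp add: unit_ball_vol_2 power2_eq_square)
  have M: "emeasure ?M {x<..} = emeasure lborel (disk \<inter> {z. x < nrm2 z})" for x
  proof -
    have "emeasure ?M {x<..} = (\<integral>\<^sup>+z. ennreal (indicator disk z) * indicator {z. x < nrm2 z} z \<partial>lborel)"
      by (subst emeasure_distr, measurable, subst emeasure_density) (auto simp: vimage_def)
    also have "\<dots> = (\<integral>\<^sup>+z. indicator (disk \<inter> {z. x < nrm2 z}) z \<partial>lborel)"
      by (intro nn_integral_cong) (simp split: split_indicator)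
    finally show ?thesis by simp
  qed
  have N: "emeasure ?N {x<..} = ennreal pi * emeasure lborel ({0..1} \<inter> {x<..})" for x
  proof -
    have "emeasure ?N {x<..} = (\<integral>\<^sup>+u. ennreal pi * indicator ({0..1} \<inter> {x<..}) u \<partial>lborel)"
      by (subst emeasure_density, measurable) (auto intro!: nn_integral_cong split: split_indicator)
    thus ?thesis by (simp add: nn_integral_cmult)
  qed
  have eq: "emeasure ?M {x<..} = emeasure ?N {x<..}" for x
  proof -
    consider "x < 0" | "0 \<le> x" "x \<le> 1" | "x > 1" by linarith
    thus ?thesis
    proof cases
      case 1
      have "disk \<inter> {z. x < nrm2 z} = disk" using 1 less_le_trans[OF 1 nrm2_nonneg] by auto
      moreover have "{0..1} \<inter> {x<..} = {0..1}" using 1 by auto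
      ultimately show ?thesis unfolding M N using cb[of 1] by simp
    next
      case 2
      have "disk \<inter> {z. x < nrm2 z} = disk - cball 0 (sqrt x)"
      proof -
        have "nrm2 z \<le> x \<longleftrightarrow> z \<in> cball 0 (sqrt x)" for z
          using real_sqrt_le_iff[of "(norm z)\<^sup>2" x] by (simp add: nrm2_norm)
        hence "x < nrm2 z \<longleftrightarrow> z \<notin> cball 0 (sqrt x)" for z
          by (metis not_le)
        thus ?thesis by blast
      qed
      have "cball (0 :: real \<times> real) (sqrt x) \<subseteq> disk"
        using 2 by (intro subset_cball) simp
      from this have "emeasure ?M {x<..} = ennreal pi - ennreal (pi * x)"
      proof -
        have "emeasure lborel (disk - cball 0 (sqrt x)) = emeasure lborel disk - emeasure lborel (cball (0 :: real \<times> real) (sqrt x))"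
          using cb[of "sqrt x"] 2 \<open>cball 0 (sqrt x) \<subseteq> disk\<close> by (intro emeasure_Diff) auto
        thus ?thesis
          unfolding M \<open>disk \<inter> {z. x < nrm2 z} = disk - cball 0 (sqrt x)\<close>
          using cb[of 1] cb[of "sqrt x"] 2 by simp
      qed
      also have "\<dots> = ennreal (pi * (1 - x))"
        using 2 by (subst ennreal_minus) (auto simp: algebra_simps)
      also have "{0..1} \<inter> {x<..} = {x<..1}" using 2 by auto
      hence "ennreal (pi * (1 - x)) = emeasure ?N {x<..}"
        unfolding N using 2 by (simp add: ennreal_mult)
      finally show ?thesis .
    next
      case 3
      have "disk \<inter> {z. x < nrm2 z} = {}" using 3 nrm2_le_1_iff by force
      moreover have "{0..1} \<inter> {x<..} = {}" using 3 by auto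
      ultimately show ?thesis unfolding M N by simp
    qed
  qed
  have fin: "emeasure ?M {x<..} < \<infinity>" for x
  proof -
    have "emeasure lborel (disk \<inter> {z. x < nrm2 z}) \<le> emeasure lborel disk"
      by (intro emeasure_mono) auto
    also have "\<dots> < \<infinity>" using cb[of 1] by simp
    finally show ?thesis unfolding M .
  qed
  show ?thesis by (rule measure_eqI_lessThan[OF _ _ fin eq]) simp_all
qed

lemma radial_integral:
  fixes F :: "real \<Rightarrow> real"
  assumes [measurable]: "F \<in> borel_measurable borel"
  shows "set_integrable lborel disk (\<lambda>z. F (nrm2 z)) \<longleftrightarrow> set_integrable lborel {0..1} F"
    and "(LINT z:disk|lborel. F (nrm2 z)) = pi * (LINT u:{0..1}|lborel. F u)"
proof -
  let ?M = "density lborel (\<lambda>z. ennreal (indicator disk z))"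
  let ?N = "density lborel (\<lambda>u::real. ennreal (pi * indicator {0..1} u))"
  have d: "distr ?M borel nrm2 = ?N" by (rule distr_disk_nrm2)
  have "set_integrable lborel disk (\<lambda>z. F (nrm2 z)) \<longleftrightarrow> integrable ?M (\<lambda>z. F (nrm2 z))"
    unfolding set_integrable_def by (subst integrable_density) auto
  also have "\<dots> \<longleftrightarrow> integrable (distr ?M borel nrm2) F"
    by (subst integrable_distr_eq) auto
  also have "\<dots> \<longleftrightarrow> integrable lborel (\<lambda>u. (pi * indicator {0..1} u) *\<^sub>R F u)"
    unfolding d by (subst integrable_density) auto
  also have "\<dots> \<longleftrightarrow> set_integrable lborel {0..1} F"
    unfolding set_integrable_def by (simp add: mult.assoc)
  finally show "set_integrable lborel disk (\<lambda>z. F (nrm2 z)) \<longleftrightarrow> set_integrable lborel {0..1} F" .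
  have "(LINT z:disk|lborel. F (nrm2 z)) = integral\<^sup>L ?M (\<lambda>z. F (nrm2 z))"
    unfolding set_lebesgue_integral_def by (subst integral_density) auto
  also have "\<dots> = integral\<^sup>L (distr ?M borel nrm2) F"
    by (subst integral_distr) auto
  also have "\<dots> = integral\<^sup>L lborel (\<lambda>u. (pi * indicator {0..1} u) *\<^sub>R F u)"
    unfolding d by (subst integral_density) auto
  also have "\<dots> = pi * (LINT u:{0..1}|lborel. F u)"
    unfolding set_lebesgue_integral_def by (simp add: mult.assoc)
  finally show "(LINT z:disk|lborel. F (nrm2 z)) = pi * (LINT u:{0..1}|lborel. F u)" .
qed

lemma weight_integrable_01:
  assumes "\<alpha> > (-1::real)"
  shows "set_integrable lborel {0..1} (\<lambda>u. (1 - u) powr \<alpha>)"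
proof -
  \<comment> \<open>Beta integrand with first parameter 1; the factor \<open>u powr 0\<close>
    differs from 1 only at 0.\<close>
  have "set_integrable lborel {0..1} (\<lambda>u::real. u powr (1 - 1) * (1 - u) powr ((\<alpha> + 1) - 1))"
    using assms integrable_Beta[of 1 "\<alpha> + 1"] by auto
  thus ?thesis
    by (rule set_integrable_cong_AE[THEN iffD1, rotated -1]) (auto intro!: AE_I'[of "{0}"])
qed

lemma disk_weight_integrable:
  assumes "\<mu> \<ge> 0" "continuous_on UNIV g"
  shows "set_integrable lebesgue disk (\<lambda>z. g z * disk_weight \<mu> z)"
proof -
  have [measurable]: "g \<in> borel_measurable borel"
    using assms(2) by (rule borel_measurable_continuous_onI)
  have "bounded (g ` disk)"
    using assms(2) by (intro compact_imp_bounded compact_continuous_image) (auto intro: continuous_on_subset)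
  then obtain B where B: "\<And>z. z \<in> disk \<Longrightarrow> \<bar>g z\<bar> \<le> B" 
    unfolding bounded_iff image_iff real_norm_def by blast
  have "set_integrable lborel disk (\<lambda>z. (1 - nrm2 z) powr (\<mu> - 1/2))"
    using assms(1) by (subst radial_integral) (auto intro!: weight_integrable_01)
  hence W: "set_integrable lborel disk (\<lambda>z. B * disk_weight \<mu> z)"
    by (simp add: disk_weight_nrm2)
  have "set_integrable lborel disk (\<lambda>z. g z * disk_weight \<mu> z)"
  proof (rule set_integrable_bound[OF W])
    show "AE z in lborel. z \<in> disk \<longrightarrow> norm (g z * disk_weight \<mu> z) \<le> norm (B * disk_weight \<mu> z)"
    proof (intro AE_I2 impI)
      fix z assume "z \<in> disk"
      hence "\<bar>g z\<bar> \<le> \<bar>B\<bar>" using B by fastforce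
      thus "norm (g z * disk_weight \<mu> z) \<le> norm (B * disk_weight \<mu> z)"
        by (simp add: abs_mult mult_right_mono)
    qed
  qed (auto simp: set_borel_measurable_def)
  thus ?thesis by (subst set_lebesgue_lborel) auto
qed

lemma L2_disk_integrable:
  assumes "\<mu> \<ge> 0" "f \<in> L2_disk \<mu>" "continuous_on UNIV g"
  shows "set_integrable lebesgue disk (\<lambda>z. f z * g z * disk_weight \<mu> z)"
proof -
  have f: "set_borel_measurable lebesgue disk f"
    "set_integrable lebesgue disk (\<lambda>z. (f z)\<^sup>2 * disk_weight \<mu> z)"
    using assms(2) by (auto simp: L2_disk_def)
  have gm: "g \<in> borel_measurable lebesgue" "disk_weight \<mu> \<in> borel_measurable lebesgue"
    using borel_measurable_continuous_onI[OF assms(3)] by (auto intro!: measurable_completion)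
  have "set_integrable lebesgue disk (\<lambda>z. (g z)\<^sup>2 * disk_weight \<mu> z)"
    by (intro disk_weight_integrable assms continuous_intros)
  hence i: "set_integrable lebesgue disk (\<lambda>z. (f z)\<^sup>2 * disk_weight \<mu> z + (g z)\<^sup>2 * disk_weight \<mu> z)"
    by (intro set_integral_add f)
  show ?thesis
  proof (rule set_integrable_bound[OF i])
    \<comment> \<open>Measurability of \<open>f\<close> is known on the disk only, so the indicator
      stays attached to it.\<close>
    have "(\<lambda>z. (indicator disk z *\<^sub>R f z) * (g z * disk_weight \<mu> z)) \<in> borel_measurable lebesgue"
      using f(1) gm unfolding set_borel_measurable_def by (intro borel_measurable_times) 
    thus "set_borel_measurable lebesgue disk (\<lambda>z. f z * g z * disk_weight \<mu> z)"
      by (simp add: set_borel_measurable_def mult_ac)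
    show "AE z in lebesgue. z \<in> disk \<longrightarrow> norm (f z * g z * disk_weight \<mu> z)
        \<le> norm ((f z)\<^sup>2 * disk_weight \<mu> z + (g z)\<^sup>2 * disk_weight \<mu> z)"
    proof (intro AE_I2 impI)
      fix z
      have "\<bar>f z * g z\<bar> \<le> (f z)\<^sup>2 + (g z)\<^sup>2"
        using sum_squares_bound[of "f z" "g z"] sum_squares_bound[of "f z" "- g z"]
          zero_le_power2[of "f z"] zero_le_power2[of "g z"] unfolding abs_le_iff power2_minus by linarith
      hence "\<bar>f z * g z\<bar> * disk_weight \<mu> z \<le> ((f z)\<^sup>2 + (g z)\<^sup>2) * disk_weight \<mu> z"
        by (intro mult_right_mono) auto
      thus "norm (f z * g z * disk_weight \<mu> z)
        \<le> norm ((f z)\<^sup>2 * disk_weight \<mu> z + (g z)\<^sup>2 * disk_weight \<mu> z)"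
        by (simp add: abs_mult distrib_right)
    qed
  qed
qed

text \<open>A continuous function is nonzero on an open set, and the weight is positive in the open
  disk, so that set is null, hence empty. On the circle the weight takes the default value of
  \<open>0 powr a\<close> and gives no information.\<close>

lemma disk_square_integral_0:
  assumes "\<mu> \<ge> 0" and g: "continuous_on UNIV g"
    and 0: "(LINT z:disk|lebesgue. g z * g z * disk_weight \<mu> z) = 0" and "z \<in> ball 0 1"
  shows "g z = 0"
proof -
  let ?h = "\<lambda>z. indicator disk z *\<^sub>R (g z * g z * disk_weight \<mu> z)"
  have "integrable lebesgue ?h"
    using disk_weight_integrable[of \<mu> "\<lambda>z. g z * g z"] assms
    unfolding set_integrable_def by (auto intro: continuous_intros)
  hence ae: "AE z in lebesgue. ?h z = 0"
    using 0 by (subst integral_nonneg_eq_0_iff_AE[symmetric])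
               (auto simp: set_lebesgue_integral_def)
  define U where "U = {z \<in> ball 0 1. g z \<noteq> 0}"
  have "U = ball 0 1 \<inter> g -` (- {0})" by (auto simp: U_def)
  hence "open U" using g by (auto intro!: open_Int open_vimage)
  moreover have "AE z in lebesgue. z \<notin> U" using ae
  proof eventually_elim
    case (elim z)
    show ?case
    proof
      assume z: "z \<in> U"
      hence "nrm2 z < 1" by (auto simp: U_def nrm2_norm power_less_one_iff)
      hence "disk_weight \<mu> z > 0" by (simp add: disk_weight_nrm2)
      with z elim show False by (auto simp: U_def indicator_def)
    qed
  qed
  ultimately have "U = {}" by (rule open_AE_empty)
  with assms show ?thesis unfolding U_def by blast
qed

subsection \<open>Alternating binomial sums\<close>

text \<open>An alternating binomial sum is an iterated difference f i - f (i + 1) evaluated at 0;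
  Pascal's rule peels off one difference.\<close>

lemma alternating_binomial_Suc:
  fixes f :: "nat \<Rightarrow> real"
  shows "(\<Sum>i\<le>Suc l. (-1) ^ i * real (Suc l choose i) * f i)
       = (\<Sum>i\<le>l. (-1) ^ i * real (l choose i) * (f i - f (Suc i)))"
proof -
  have "(\<Sum>i\<le>Suc l. (-1) ^ i * real (Suc l choose i) * f i)
      = f 0 + (\<Sum>i\<le>l. (-1) ^ Suc i * real (Suc l choose Suc i) * f (Suc i))"
    by (subst sum.atMost_Suc_shift) simp
  also have "\<dots> = f 0 + (\<Sum>i\<le>l. (-1) ^ Suc i * real (l choose Suc i) * f (Suc i))
      - (\<Sum>i\<le>l. (-1) ^ i * real (l choose i) * f (Suc i))"
    by (simp add: algebra_simps sum.distrib sum_subtractf sum_negf)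
  also have "f 0 + (\<Sum>i\<le>l. (-1) ^ Suc i * real (l choose Suc i) * f (Suc i))
      = (\<Sum>i\<le>Suc l. (-1) ^ i * real (l choose i) * f i)"
    by (subst sum.atMost_Suc_shift) simp
  also have "\<dots> = (\<Sum>i\<le>l. (-1) ^ i * real (l choose i) * f i)"
    by simp
  finally show ?thesis by (simp add: algebra_simps sum_subtractf)
qed

text \<open>In \<open>i\<close> the Pochhammer symbol is a polynomial of degree \<open>e\<close>,
  and each difference lowers the degree by one, so more than \<open>e\<close> differences annihilate
  it. The base point \<open>a\<close> is arbitrary because a difference shifts it by 1.\<close>

lemma alternating_binomial_pochhammer:
  fixes a :: real
  assumes "e < l"
  shows "(\<Sum>i\<le>l. (-1) ^ i * real (l choose i) * pochhammer (a + real i) e) = 0"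
  using assms
proof (induction l arbitrary: a e)
  case (Suc l)
  show ?case
  proof (cases e)
    case 0
    thus ?thesis by (subst alternating_binomial_Suc) simp
  next
    case (Suc d)
    have "pochhammer (a + real i) e - pochhammer (a + real (Suc i)) e
        = - real e * pochhammer ((a + 1) + real i) d" for i
    proof -
      have "pochhammer (a + real i) e = (a + real i) * pochhammer (a + real i + 1) d"
        by (simp add: Suc pochhammer_rec)
      moreover have "pochhammer (a + real (Suc i)) e = (a + real i + 1 + real d) * pochhammer (a + real i + 1) d"
        by (simp add: Suc pochhammer_rec' algebra_simps)
      ultimately show ?thesis by (simp add: Suc algebra_simps)
    qed
    hence "(\<Sum>i\<le>Suc l. (-1) ^ i * real (Suc l choose i) * pochhammer (a + real i) e)
        = - real e * (\<Sum>i\<le>l. (-1) ^ i * real (l choose i) * pochhammer ((a + 1) + real i) d)"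
      unfolding alternating_binomial_Suc sum_distrib_left by (intro sum.cong refl) (simp only: mult_ac)
    thus ?thesis using Suc.IH[of d "a + 1"] Suc.prems Suc by simp
  qed
qed simp

text \<open>The right side is the Beta value B(c, l + 1), and expanding (1 - x)^l in its integral
  gives the sum; the induction obtains it from differences alone.\<close>

lemma alternating_binomial_inverse:
  fixes c :: real
  assumes "c > 0"
  shows "(\<Sum>i\<le>l. (-1) ^ i * real (l choose i) * (1 / (c + real i))) = fact l / pochhammer c (Suc l)"
  using assms
proof (induction l arbitrary: c)
  case (Suc l)
  have "(\<Sum>i\<le>Suc l. (-1) ^ i * real (Suc l choose i) * (1 / (c + real i)))
      = (\<Sum>i\<le>l. (-1) ^ i * real (l choose i) * (1 / (c + real i)))
       - (\<Sum>i\<le>l. (-1) ^ i * real (l choose i) * (1 / ((c + 1) + real i)))"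
    unfolding alternating_binomial_Suc by (simp add: right_diff_distrib sum_subtractf add_ac)
  also have "\<dots> = fact l / pochhammer c (Suc l) - fact l / pochhammer (c + 1) (Suc l)"
    using Suc by simp
  also have "\<dots> = fact (Suc l) / pochhammer c (Suc (Suc l))"
  proof -
    have p: "pochhammer (c + 1) l > 0" using Suc.prems by (intro pochhammer_pos) auto
    have "pochhammer c (Suc l) = c * pochhammer (c + 1) l"
      "pochhammer (c + 1) (Suc l) = (c + 1 + real l) * pochhammer (c + 1) l"
      "pochhammer c (Suc (Suc l)) = c * ((c + 1 + real l) * pochhammer (c + 1) l)"
      by (simp_all only: pochhammer_rec[of c] pochhammer_rec'[of "c + 1"])
    moreover have "fact l / (c * P) - fact l / ((c + 1 + real l) * P) = fact (Suc l) / (c * ((c + 1 + real l) * P))"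
      if "P > 0" for P :: real
    proof -
      have "c + 1 + real l \<noteq> 0" using Suc.prems by linarith
      hence "fact l / (c * P) = (c + 1 + real l) * fact l / (c * ((c + 1 + real l) * P))"
        "fact l / ((c + 1 + real l) * P) = c * fact l / (c * ((c + 1 + real l) * P))"
        using that Suc.prems by (simp_all add: divide_simps)
      thus ?thesis by (simp add: diff_divide_distrib[symmetric] algebra_simps)
    qed
    ultimately show ?thesis using p by simp
  qed
  finally show ?case .
qed (simp add: pochhammer_Suc)

subsection \<open>Integration against the Jacobi weight\<close>

text \<open>\<open>jacobi_ip\<close> without its normalization and with the product already formed,
  so that it is a linear functional on polynomials.\<close>

definition jint :: "real \<Rightarrow> real \<Rightarrow> real poly \<Rightarrow> real" where
  "jint \<alpha> \<beta> p = (LINT t:{-1..1}|lebesgue. poly p t * jacobi_weight \<alpha> \<beta> t)"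

lemma jacobi_weight_nonneg [simp]: "jacobi_weight \<alpha> \<beta> t \<ge> 0"
  by (simp add: jacobi_weight_def)

lemma jacobi_weight_measurable [measurable]: "jacobi_weight \<alpha> \<beta> \<in> borel_measurable borel"
  unfolding jacobi_weight_def[abs_def] by measurable

text \<open>The endpoints are excluded because of the junk value \<open>0 powr 0 = 0\<close>.\<close>

lemma interval_affine:
  fixes F G :: "real \<Rightarrow> real"
  assumes [measurable]: "F \<in> borel_measurable borel" "G \<in> borel_measurable borel"
    and eq: "\<And>u. 0 < u \<Longrightarrow> u < 1 \<Longrightarrow> F (2 * u - 1) = c * G u"
  shows "set_integrable lborel {0..1} G \<Longrightarrow> set_integrable lborel {-1..1} F"
    and "(LINT t:{-1..1}|lborel. F t) = 2 * c * (LINT u:{0..1}|lborel. G u)"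
proof -
  have ind: "indicator {-1..1} (-1 + 2 * u) = (indicator {0..1} u :: real)" for u :: real
    by (auto simp: indicator_def)
  have ae: "AE u in lborel. indicator {-1..1} (-1 + 2 * u) *\<^sub>R F (-1 + 2 * u) = c * (indicator {0..1} u *\<^sub>R G u)"
  proof (rule AE_I'[of "{0, 1}"])
    show "{u \<in> space lborel. indicator {-1..1} (-1 + 2 * u) *\<^sub>R F (-1 + 2 * u) \<noteq> c * (indicator {0..1} u *\<^sub>R G u)} \<subseteq> {0, 1}"
    proof (rule subsetI, rule ccontr)
      fix u
      assume u: "u \<in> {u \<in> space lborel. indicator {-1..1} (-1 + 2 * u) *\<^sub>R F (-1 + 2 * u) \<noteq> c * (indicator {0..1} u *\<^sub>R G u)}"
        and "u \<notin> {0, 1}"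
      hence "0 < u \<and> u < 1 \<or> u \<notin> {0..1}" by auto
      with u eq[of u] show False by (auto simp: ind indicator_def)
    qed
    show "{0, 1::real} \<in> null_sets lborel" by (intro countable_imp_null_set_lborel) auto
  qed
  show "set_integrable lborel {-1..1} F" if "set_integrable lborel {0..1} G"
  proof -
    have "integrable lborel (\<lambda>u. c * (indicator {0..1} u *\<^sub>R G u))"
      using that by (simp add: set_integrable_def)
    hence "integrable lborel (\<lambda>u. indicator {-1..1} (-1 + 2 * u) *\<^sub>R F (-1 + 2 * u))"
    proof (rule integrable_cong_AE_imp)
      show "AE u in lborel. c * (indicator {0..1} u *\<^sub>R G u) = indicator {-1..1} (-1 + 2 * u) *\<^sub>R F (-1 + 2 * u)"
        using ae by eventually_elim simp
    qed measurable
    thus ?thesis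
      using lborel_integrable_real_affine_iff[of 2 "\<lambda>t. indicator {-1..1} t *\<^sub>R F t" "-1"]
      by (simp add: set_integrable_def)
  qed
  have "(LINT t:{-1..1}|lborel. F t) = 2 * (LINT u|lborel. indicator {-1..1} (-1 + 2 * u) *\<^sub>R F (-1 + 2 * u))"
    using lborel_integral_real_affine[of 2 "\<lambda>t. indicator {-1..1} t *\<^sub>R F t" "-1"]
    by (simp add: set_lebesgue_integral_def)
  also have "(LINT u|lborel. indicator {-1..1} (-1 + 2 * u) *\<^sub>R F (-1 + 2 * u))
      = (LINT u|lborel. c * (indicator {0..1} u *\<^sub>R G u))"
    by (rule integral_cong_AE) (use ae in auto)
  finally show "(LINT t:{-1..1}|lborel. F t) = 2 * c * (LINT u:{0..1}|lborel. G u)"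
    by (simp add: set_lebesgue_integral_def)
qed

text \<open>With t = 2 u - 1 these polynomials are u and 1 - u, so products of their powers have
  Beta integrals; at t = 2 r^2 - 1 \<open>half_up\<close> is r^2.\<close>

definition half_up :: "real poly" where "half_up = [:1/2, 1/2:]"
definition half_down :: "real poly" where "half_down = [:1/2, -1/2:]"

lemma poly_half [simp]: "poly half_up t = (1 + t) / 2" "poly half_down t = (1 - t) / 2"
  by (simp_all add: half_up_def half_down_def)

lemma jint_moment:
  assumes "\<alpha> > -1" "\<beta> > -1"
  shows "set_integrable lebesgue {-1..1} (\<lambda>t. poly (half_down ^ i * half_up ^ n) t * jacobi_weight \<alpha> \<beta> t)" (is ?I)
    and "jint \<alpha> \<beta> (half_down ^ i * half_up ^ n)
       = 2 powr (\<alpha> + \<beta> + 1) * Beta (\<alpha> + 1 + real i) (\<beta> + 1 + real n)" (is ?V)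
proof -
  let ?G = "\<lambda>u. u powr ((\<beta> + 1 + real n) - 1) * (1 - u) powr ((\<alpha> + 1 + real i) - 1)"
  let ?F = "\<lambda>t. poly (half_down ^ i * half_up ^ n) t * jacobi_weight \<alpha> \<beta> t"
  have eq: "?F (2 * u - 1) = 2 powr (\<alpha> + \<beta>) * ?G u" if "0 < u" "u < 1" for u
  proof -
    have half: "(1 - (2 * u - 1)) / 2 = 1 - u" "(1 + (2 * u - 1)) / 2 = u"
      and "1 - (2 * u - 1) = 2 * (1 - u)" "1 + (2 * u - 1) = 2 * u" by simp_all
    hence "?F (2 * u - 1) = ((1 - (2 * u - 1)) / 2) ^ i * ((1 + (2 * u - 1)) / 2) ^ n * ((2 * (1 - u)) powr \<alpha> * (2 * u) powr \<beta>)"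
      by (simp only: jacobi_weight_def poly_mult poly_power poly_half)
    also have "\<dots> = (1 - u) ^ i * u ^ n * ((2 * (1 - u)) powr \<alpha> * (2 * u) powr \<beta>)"
      by (simp only: half)
    also have "\<dots> = (1 - u) powr real i * u powr real n * (2 powr \<alpha> * (1 - u) powr \<alpha> * (2 powr \<beta> * u powr \<beta>))"
      using that powr_mult[of 2 "1 - u" \<alpha>] powr_mult[of 2 u \<beta>] by (simp only: powr_realpow)
    also have "\<dots> = 2 powr (\<alpha> + \<beta>) * ?G u"
      by (simp add: powr_add mult_ac)
    finally show ?thesis .
  qed
  have G: "set_integrable lborel {0..1} ?G"
    using integrable_Beta[of "\<beta> + 1 + real n" "\<alpha> + 1 + real i"] assms
    by auto
  have m: "?F \<in> borel_measurable borel" "?G \<in> borel_measurable borel"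
    by (auto intro!: borel_measurable_continuous_onI borel_measurable_times continuous_intros)
  show ?I using interval_affine(1)[OF m eq G] by (subst set_lebesgue_lborel) (use m in auto)
  have "(LINT u:{0..1}|lborel. ?G u) = Beta (\<beta> + 1 + real n) (\<alpha> + 1 + real i)"
    using has_integral_Beta_real[of "\<beta> + 1 + real n" "\<alpha> + 1 + real i"] assms
      set_borel_integral_eq_integral(2)[OF G] by (auto simp: integral_unique)
  thus ?V unfolding jint_def using interval_affine(2)[OF m eq]
    by (subst set_lebesgue_lborel) (use m in \<open>auto simp: powr_add Beta_commute\<close>)
qed


lemma jint_integrable:
  assumes "\<alpha> > -1" "\<beta> > -1"
  shows "set_integrable lebesgue {-1..1} (\<lambda>t. poly p t * jacobi_weight \<alpha> \<beta> t)"
proof -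
  have "set_integrable lebesgue {-1..1} (\<lambda>t. poly 1 t * jacobi_weight \<alpha> \<beta> t)"
    using jint_moment(1)[OF assms, of 0 0] by simp
  hence W: "set_integrable lborel {-1..1} (jacobi_weight \<alpha> \<beta>)"
    by (subst (asm) set_lebesgue_lborel) auto
  have m [measurable]: "(\<lambda>t. poly p t) \<in> borel_measurable borel"
    by (intro borel_measurable_continuous_onI continuous_intros)
  have "bounded (poly p ` {-1..1})"
    by (intro compact_imp_bounded compact_continuous_image continuous_intros) auto
  then obtain B where B: "\<And>t. t \<in> {-1..1} \<Longrightarrow> \<bar>poly p t\<bar> \<le> B"
    unfolding bounded_iff image_iff real_norm_def by blast
  have "set_integrable lborel {-1..1} (\<lambda>t. poly p t * jacobi_weight \<alpha> \<beta> t)"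
  proof (rule set_integrable_bound[of _ _ "\<lambda>t. B * jacobi_weight \<alpha> \<beta> t"])
    show "AE t in lborel. t \<in> {-1..1} \<longrightarrow> norm (poly p t * jacobi_weight \<alpha> \<beta> t) \<le> norm (B * jacobi_weight \<alpha> \<beta> t)"
    proof (intro AE_I2 impI)
      fix t :: real assume "t \<in> {-1..1}"
      hence "\<bar>poly p t\<bar> \<le> \<bar>B\<bar>" using B by fastforce
      thus "norm (poly p t * jacobi_weight \<alpha> \<beta> t) \<le> norm (B * jacobi_weight \<alpha> \<beta> t)"
        by (simp add: abs_mult mult_right_mono)
    qed
  qed (use W in \<open>auto simp: set_borel_measurable_def\<close>)
  thus ?thesis by (subst set_lebesgue_lborel) auto
qed

lemma jint_add:
  assumes "\<alpha> > -1" "\<beta> > -1"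
  shows "jint \<alpha> \<beta> (p + q) = jint \<alpha> \<beta> p + jint \<alpha> \<beta> q"
  unfolding jint_def by (simp add: distrib_right set_integral_add(2) jint_integrable assms)

lemma jint_smult: "jint \<alpha> \<beta> (smult a p) = a * jint \<alpha> \<beta> p"
  unfolding jint_def by (simp add: mult.assoc)

lemma jint_0 [simp]: "jint \<alpha> \<beta> 0 = 0"
  by (simp add: jint_def)

lemma jint_sum:
  assumes "\<alpha> > -1" "\<beta> > -1" "finite I"
  shows "jint \<alpha> \<beta> (\<Sum>i\<in>I. p i) = (\<Sum>i\<in>I. jint \<alpha> \<beta> (p i))"
  using assms(3) by induction (simp_all add: jint_add assms)

lemma jint_diff:
  assumes "\<alpha> > -1" "\<beta> > -1"
  shows "jint \<alpha> \<beta> (p - q) = jint \<alpha> \<beta> p - jint \<alpha> \<beta> q"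
  using jint_add[OF assms, of "p - q" q] by simp

lemma jint_square_eq_0:
  assumes "\<alpha> > -1" "\<beta> > -1" "jint \<alpha> \<beta> (p * p) = 0"
  shows "p = 0"
proof -
  let ?h = "\<lambda>t. indicator {-1..1} t *\<^sub>R (poly (p * p) t * jacobi_weight \<alpha> \<beta> t)"
  have "integrable lebesgue ?h"
    using jint_integrable[OF assms(1,2), of "p * p"] unfolding set_integrable_def .
  hence ae: "AE t in lebesgue. ?h t = 0"
    using assms(3) by (subst integral_nonneg_eq_0_iff_AE[symmetric])
      (auto simp: jint_def set_lebesgue_integral_def)
  define U where "U = {-1<..<1} \<inter> poly p -` (- {0})"
  have "open U" unfolding U_def by (intro open_Int open_vimage) (auto intro: continuous_intros)
  moreover have "AE t in lebesgue. t \<notin> U" using ae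
    by eventually_elim (auto simp: U_def jacobi_weight_def)
  ultimately have "U = {}" by (rule open_AE_empty)
  hence "{-1<..<1} \<subseteq> {t. poly p t = 0}" by (auto simp: U_def)
  hence "infinite {t. poly p t = 0}"
    using infinite_super infinite_Ioo[of "-1" "1::real"] by (metis minus_less_iff neg_less_0_iff_less less_trans zero_less_one)
  thus ?thesis using poly_roots_finite[of p] by blast
qed

text \<open>The condition \<open>n > 0\<close> reflects that the zero polynomial has degree 0; hence
  the separate treatment of degree 0 wherever a leading term is removed.\<close>

lemma degree_diff_less_of_coeff:
  fixes p q :: "'a::ab_group_add poly"
  assumes "degree p \<le> n" "degree q \<le> n" "coeff p n = coeff q n" "n > 0"
  shows "degree (p - q) < n"
proof -
  have "degree (p - q) \<le> n - 1"
  proof (rule degree_le, intro allI impI)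
    fix i assume "n - 1 < i"
    hence "i = n \<or> i > n" using assms(4) by linarith
    thus "coeff (p - q) i = 0" using assms by (auto simp: coeff_eq_0)
  qed
  thus ?thesis using assms(4) by linarith
qed

lemma degree_half_power [simp]: "degree (half_up ^ n) = n" "degree (half_down ^ n) = n"
  by (simp_all add: half_up_def half_down_def degree_power_eq)

lemma coeff_half_power [simp]:
  "coeff (half_up ^ n) n = (1/2) ^ n" "coeff (half_down ^ n) n = (-1/2) ^ n"
proof -
  have "lead_coeff (half_up ^ n) = (1/2) ^ n" "lead_coeff (half_down ^ n) = (-1/2) ^ n"
    unfolding lead_coeff_power by (simp_all add: half_up_def half_down_def)
  thus "coeff (half_up ^ n) n = (1/2) ^ n" "coeff (half_down ^ n) n = (-1/2) ^ n" by simp_all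
qed

text \<open>The powers of \<open>half_up\<close> contain one polynomial of each degree. The
  induction removes the leading term of \<open>q\<close>, the factor \<open>2 ^ degree q\<close>
  undoing the leading coefficient of \<open>half_up ^ degree q\<close>.\<close>

lemma jint_orth_half_up:
  assumes ab: "\<alpha> > -1" "\<beta> > -1"
    and orth: "\<And>n. n < l \<Longrightarrow> jint \<alpha> \<beta> (p * half_up ^ n) = 0"
    and "degree q < l"
  shows "jint \<alpha> \<beta> (p * q) = 0"
  using assms(4)
proof (induction "degree q" arbitrary: q rule: less_induct)
  case less
  define r where "r = smult (coeff q (degree q) * 2 ^ degree q) (half_up ^ degree q)"
  have r: "jint \<alpha> \<beta> (p * r) = 0"
    unfolding r_def using orth[OF less.prems] by (simp add: jint_smult)
  have "jint \<alpha> \<beta> (p * (q - r)) = 0"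
  proof (cases "degree q = 0")
    case True
    then obtain a where "q = [:a:]" by (auto elim: degree_eq_zeroE)
    hence "q - r = 0" by (simp add: r_def)
    thus ?thesis by simp
  next
    case False
    have "degree (q - r) < degree q"
      using False by (intro degree_diff_less_of_coeff)
        (auto simp: r_def degree_smult_le power_mult_distrib[symmetric])
    thus ?thesis using less by auto
  qed
  with r show ?case by (simp add: jint_diff[OF ab] right_diff_distrib)
qed

subsection \<open>Jacobi polynomials\<close>

text \<open>The hypergeometric polynomial 2F1(-l, l + \<alpha> + \<beta> + 1; \<alpha> + 1; (1 -
  t)/2), that is, the Jacobi polynomial scaled to the value 1 at t = 1.\<close>

definition jac :: "nat \<Rightarrow> real \<Rightarrow> real \<Rightarrow> real poly" where
  "jac l \<alpha> \<beta> = (\<Sum>i\<le>l. smult ((-1) ^ i * real (l choose i) * pochhammer (real l + \<alpha> + \<beta> + 1) i / pochhammer (\<alpha> + 1) i)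
      (half_down ^ i))"

lemma degree_jac_le: "degree (jac l \<alpha> \<beta>) \<le> l"
  unfolding jac_def by (intro degree_sum_le) (auto intro: order.trans[OF degree_smult_le])

lemma coeff_jac: "coeff (jac l \<alpha> \<beta>) l = pochhammer (real l + \<alpha> + \<beta> + 1) l / (pochhammer (\<alpha> + 1) l * 2 ^ l)"
proof -
  have "coeff (jac l \<alpha> \<beta>) l = (\<Sum>i\<le>l. if i = l then (-1) ^ i * real (l choose i) * pochhammer (real l + \<alpha> + \<beta> + 1) i / pochhammer (\<alpha> + 1) i * (-1/2) ^ l else 0)"
    unfolding jac_def coeff_sum coeff_smult by (intro sum.cong refl) (auto simp: coeff_eq_0)
  also have "\<dots> = pochhammer (real l + \<alpha> + \<beta> + 1) l / (pochhammer (\<alpha> + 1) l * 2 ^ l)"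
  proof -
    have "(-1) ^ l * (-1/2) ^ l = (1 / 2 ^ l :: real)"
      by (subst power_mult_distrib[symmetric]) (simp add: power_one_over)
    hence "(-1) ^ l * x / y * (-1/2) ^ l = x / (y * 2 ^ l)" for x y :: real
      by (metis (no_types, lifting) mult.assoc mult.commute mult.right_neutral times_divide_eq_right times_divide_times_eq)
    thus ?thesis by simp
  qed
  finally show ?thesis .
qed

lemma poly_jac_1 [simp]: "poly (jac l \<alpha> \<beta>) 1 = 1"
proof -
  have "poly (jac l \<alpha> \<beta>) 1 = (\<Sum>i\<le>l. if i = 0 then 1 else 0)"
    unfolding jac_def poly_sum by (intro sum.cong) (auto simp: power_0_left)
  thus ?thesis by simp
qed

context
  fixes \<alpha> \<beta> :: real
  assumes ab: "\<alpha> > -1" "\<beta> > -1" "\<alpha> + \<beta> > -1"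
begin

lemma coeff_jac_pos: "coeff (jac l \<alpha> \<beta>) l > 0"
  unfolding coeff_jac using ab by (intro divide_pos_pos mult_pos_pos pochhammer_pos) auto

lemma degree_jac: "degree (jac l \<alpha> \<beta>) = l"
  using degree_jac_le[of l] coeff_jac_pos[of l] le_degree[of "jac l \<alpha> \<beta>" l] by (intro antisym) auto

text \<open>Testing against powers of \<open>half_up\<close> makes the factor Gamma (\<alpha> + 1 +
  i) of the Beta moments cancel the Pochhammer denominators of \<open>jac\<close>, so one
  alternating sum of a Gamma quotient remains. For n < l the quotient is a polynomial in
  \<open>i\<close> of degree l - n - 1; for n = l it is 1 / (l + \<alpha> + \<beta> + 1 +
  i).\<close>

lemma jint_jac_half_up:
  "jint \<alpha> \<beta> (jac l \<alpha> \<beta> * half_up ^ n) = 2 powr (\<alpha> + \<beta> + 1) * Gamma (\<alpha> + 1) * Gamma (\<beta> + 1 + real n)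
     / Gamma (real l + \<alpha> + \<beta> + 1) *
     (\<Sum>i\<le>l. (-1) ^ i * real (l choose i) *
       (Gamma (real l + \<alpha> + \<beta> + 1 + real i) / Gamma (\<alpha> + \<beta> + 2 + real n + real i)))"
proof -
  have "jint \<alpha> \<beta> (jac l \<alpha> \<beta> * half_up ^ n)
      = (\<Sum>i\<le>l. (-1) ^ i * real (l choose i) * pochhammer (real l + \<alpha> + \<beta> + 1) i / pochhammer (\<alpha> + 1) i
          * (2 powr (\<alpha> + \<beta> + 1) * Beta (\<alpha> + 1 + real i) (\<beta> + 1 + real n)))"
    unfolding jac_def sum_distrib_right
    by (subst jint_sum) (simp_all add: ab jint_smult jint_moment(2))
  also have "\<dots> = (\<Sum>i\<le>l. 2 powr (\<alpha> + \<beta> + 1) * Gamma (\<alpha> + 1) * Gamma (\<beta> + 1 + real n) / Gamma (real l + \<alpha> + \<beta> + 1) *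
     ((-1) ^ i * real (l choose i) *
       (Gamma (real l + \<alpha> + \<beta> + 1 + real i) / Gamma (\<alpha> + \<beta> + 2 + real n + real i))))"
  proof (intro sum.cong refl)
    fix i
    have nz: "Gamma (\<alpha> + 1) \<noteq> 0" "Gamma (real l + \<alpha> + \<beta> + 1) \<noteq> 0" "Gamma (\<alpha> + 1 + real i) \<noteq> 0"
      using ab by (simp_all add: Gamma_real_pos order.strict_implies_not_eq[symmetric])
    have p: "pochhammer (real l + \<alpha> + \<beta> + 1) i = Gamma (real l + \<alpha> + \<beta> + 1 + real i) / Gamma (real l + \<alpha> + \<beta> + 1)"
      "pochhammer (\<alpha> + 1) i = Gamma (\<alpha> + 1 + real i) / Gamma (\<alpha> + 1)"
      using ab by (auto intro!: pochhammer_Gamma dest: nonpos_Ints_nonpos)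
    have b: "Beta (\<alpha> + 1 + real i) (\<beta> + 1 + real n)
        = Gamma (\<alpha> + 1 + real i) * Gamma (\<beta> + 1 + real n) / Gamma (\<alpha> + \<beta> + 2 + real n + real i)"
      by (simp add: Beta_def algebra_simps)
    show "(-1) ^ i * real (l choose i) * pochhammer (real l + \<alpha> + \<beta> + 1) i / pochhammer (\<alpha> + 1) i
          * (2 powr (\<alpha> + \<beta> + 1) * Beta (\<alpha> + 1 + real i) (\<beta> + 1 + real n)) =
        2 powr (\<alpha> + \<beta> + 1) * Gamma (\<alpha> + 1) * Gamma (\<beta> + 1 + real n) / Gamma (real l + \<alpha> + \<beta> + 1) *
     ((-1) ^ i * real (l choose i) *
       (Gamma (real l + \<alpha> + \<beta> + 1 + real i) / Gamma (\<alpha> + \<beta> + 2 + real n + real i)))"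
      unfolding p b using nz by simp
  qed
  finally show ?thesis by (simp only: sum_distrib_left)
qed

lemma jac_orth:
  assumes "degree q < l"
  shows "jint \<alpha> \<beta> (jac l \<alpha> \<beta> * q) = 0"
proof (rule jint_orth_half_up[OF ab(1,2) _ assms])
  fix n assume n: "n < l"
  define e where "e = l - Suc n"
  have "Gamma (real l + \<alpha> + \<beta> + 1 + real i) / Gamma (\<alpha> + \<beta> + 2 + real n + real i)
      = pochhammer ((\<alpha> + \<beta> + 2 + real n) + real i) e" for i
  proof -
    have "\<alpha> + \<beta> + 2 + real n + real i \<notin> \<int>\<^sub>\<le>\<^sub>0"
      using ab by (auto dest: nonpos_Ints_nonpos)
    moreover have "\<alpha> + \<beta> + 2 + real n + real i + real e = real l + \<alpha> + \<beta> + 1 + real i"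
      using n by (simp add: e_def of_nat_diff)
    ultimately show ?thesis using pochhammer_Gamma[of "\<alpha> + \<beta> + 2 + real n + real i" e] by metis
  qed
  thus "jint \<alpha> \<beta> (jac l \<alpha> \<beta> * half_up ^ n) = 0"
    unfolding jint_jac_half_up using n by (simp add: alternating_binomial_pochhammer e_def)
qed

text \<open>By orthogonality one factor may be replaced by its leading term \<open>a\<close> times
  \<open>half_up ^ l\<close>, which leaves the moment with n = l.\<close>

lemma jint_jac_square:
  "jint \<alpha> \<beta> (jac l \<alpha> \<beta> * jac l \<alpha> \<beta>) = 2 powr (\<alpha> + \<beta> + 1) * Gamma (\<alpha> + 1) * Gamma (\<beta> + 1 + real l) * fact l
     / (Gamma (real l + \<alpha> + \<beta> + 1) * pochhammer (\<alpha> + 1) l * (2 * real l + \<alpha> + \<beta> + 1))"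
proof -
  define c where "c = real l + \<alpha> + \<beta> + 1"
  define a where "a = pochhammer c l / pochhammer (\<alpha> + 1) l"
  define r where "r = jac l \<alpha> \<beta> - smult a (half_up ^ l)"
  have c: "c > 0" using ab by (auto simp: c_def)
  have "jint \<alpha> \<beta> (jac l \<alpha> \<beta> * r) = 0"
  proof (cases "l = 0")
    case True
    hence "r = 0" by (simp add: r_def a_def jac_def)
    thus ?thesis by simp
  next
    case False
    have "degree r < l" unfolding r_def
      using False by (intro degree_diff_less_of_coeff degree_jac_le)
        (auto simp: a_def c_def coeff_jac degree_smult_le power_divide)
    thus ?thesis by (rule jac_orth)
  qed
  hence "jint \<alpha> \<beta> (jac l \<alpha> \<beta> * jac l \<alpha> \<beta>) = a * jint \<alpha> \<beta> (jac l \<alpha> \<beta> * half_up ^ l)"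
    using jint_add[OF ab(1,2), of "jac l \<alpha> \<beta> * r" "jac l \<alpha> \<beta> * smult a (half_up ^ l)"]
    by (simp add: r_def jint_smult algebra_simps)
  also have "(\<Sum>i\<le>l. (-1) ^ i * real (l choose i) *
       (Gamma (real l + \<alpha> + \<beta> + 1 + real i) / Gamma (\<alpha> + \<beta> + 2 + real l + real i)))
      = (\<Sum>i\<le>l. (-1) ^ i * real (l choose i) * (1 / (c + real i)))"
  proof (intro sum.cong refl arg_cong2[where f = "(*)"])
    fix i
    have ci: "c + real i > 0" using c by simp
    hence "c + real i \<notin> \<int>\<^sub>\<le>\<^sub>0" by (auto dest: nonpos_Ints_nonpos)
    hence g: "Gamma (c + real i + 1) = (c + real i) * Gamma (c + real i)" by (rule Gamma_plus1)
    have nz: "Gamma (c + real i) \<noteq> 0" "c + real i \<noteq> 0"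
      using ci Gamma_real_pos[OF ci] by linarith+
    have e: "\<alpha> + \<beta> + 2 + real l + real i = c + real i + 1" "real l + \<alpha> + \<beta> + 1 + real i = c + real i"
      by (simp_all add: c_def)
    show "Gamma (real l + \<alpha> + \<beta> + 1 + real i) / Gamma (\<alpha> + \<beta> + 2 + real l + real i) = 1 / (c + real i)"
      unfolding e g using nz by simp
  qed
  hence "jint \<alpha> \<beta> (jac l \<alpha> \<beta> * half_up ^ l) = 2 powr (\<alpha> + \<beta> + 1) * Gamma (\<alpha> + 1) * Gamma (\<beta> + 1 + real l) / Gamma c
      * (fact l / pochhammer c (Suc l))"
    unfolding jint_jac_half_up alternating_binomial_inverse[OF c] by (simp add: c_def)
  also have "pochhammer c (Suc l) = pochhammer c l * (2 * real l + \<alpha> + \<beta> + 1)"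
    by (simp add: pochhammer_Suc c_def)
  finally show ?thesis using pochhammer_pos[OF c, of l] by (simp add: a_def c_def mult_ac)
qed

text \<open>\<open>p\<close> may have smaller degree, in which case the factor is 0; this form fits
  Radon polynomials, whose leading coefficient is not known. The difference from the multiple of
  \<open>jac\<close> has lower degree and is orthogonal to all such polynomials, hence to
  itself.\<close>

lemma orth_poly_unique:
  assumes "degree p \<le> l" and orth: "\<And>q. degree q < l \<Longrightarrow> jint \<alpha> \<beta> (p * q) = 0"
  shows "p = smult (coeff p l / coeff (jac l \<alpha> \<beta>) l) (jac l \<alpha> \<beta>)"
proof -
  define r where "r = p - smult (coeff p l / coeff (jac l \<alpha> \<beta>) l) (jac l \<alpha> \<beta>)"
  have nz: "coeff (jac l \<alpha> \<beta>) l \<noteq> 0" using coeff_jac_pos[of l] by simp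
  have "r = 0"
  proof (cases "l = 0")
    case True
    obtain x where "p = [:x:]" using True assms(1) by (auto elim: degree_eq_zeroE)
    moreover obtain y where "jac l \<alpha> \<beta> = [:y:]" using True degree_jac[of l] by (auto elim: degree_eq_zeroE)
    ultimately show ?thesis using True nz unfolding r_def by simp
  next
    case False
    have d: "degree r < l" unfolding r_def
      using False nz assms(1) degree_jac_le[of l \<alpha> \<beta>]
      by (intro degree_diff_less_of_coeff) (auto intro: order.trans[OF degree_smult_le])
    have "jint \<alpha> \<beta> (r * r) = jint \<alpha> \<beta> (p * r) - jint \<alpha> \<beta> (smult (coeff p l / coeff (jac l \<alpha> \<beta>) l) (jac l \<alpha> \<beta> * r))"
      by (subst jint_diff[OF ab(1,2), symmetric]) (simp add: left_diff_distrib r_def)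
    also have "\<dots> = 0" using orth[OF d] jac_orth[OF d] by (simp add: jint_smult)
    finally show ?thesis by (rule jint_square_eq_0[OF ab(1,2)])
  qed
  thus ?thesis by (simp add: r_def)
qed

lemma Jacobi_eq_jac:
  "Jacobi l \<alpha> \<beta> = smult (sqrt (jint \<alpha> \<beta> 1 / jint \<alpha> \<beta> (jac l \<alpha> \<beta> * jac l \<alpha> \<beta>))) (jac l \<alpha> \<beta>)"
proof -
  have ip: "jacobi_ip \<alpha> \<beta> p q = jint \<alpha> \<beta> (p * q) / jint \<alpha> \<beta> 1" for p q
    by (simp add: jacobi_ip_def jint_def)
  have pos: "jint \<alpha> \<beta> (p * p) > 0" if "p \<noteq> 0" for p
  proof -
    have "jint \<alpha> \<beta> (p * p) \<ge> 0"
      unfolding jint_def set_lebesgue_integral_def by (intro integral_nonneg_AE AE_I2) auto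
    thus ?thesis using jint_square_eq_0[OF ab(1,2), of p] that by fastforce
  qed
  have N0: "jint \<alpha> \<beta> 1 > 0" using pos[of 1] by simp
  have "jac l \<alpha> \<beta> \<noteq> 0" using coeff_jac_pos[of l] by auto
  hence Nl: "jint \<alpha> \<beta> (jac l \<alpha> \<beta> * jac l \<alpha> \<beta>) > 0" by (rule pos)
  define s where "s = sqrt (jint \<alpha> \<beta> 1 / jint \<alpha> \<beta> (jac l \<alpha> \<beta> * jac l \<alpha> \<beta>))"
  have s: "s > 0" "s * s = jint \<alpha> \<beta> 1 / jint \<alpha> \<beta> (jac l \<alpha> \<beta> * jac l \<alpha> \<beta>)"
    using N0 Nl by (auto simp: s_def)
  show ?thesis unfolding Jacobi_def s_def[symmetric]
  proof (rule the_equality, intro conjI allI impI)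
    show "degree (smult s (jac l \<alpha> \<beta>)) = l" using s degree_jac by simp
    show "lead_coeff (smult s (jac l \<alpha> \<beta>)) > 0" using s coeff_jac_pos by (simp add: degree_jac)
    show "jacobi_ip \<alpha> \<beta> (smult s (jac l \<alpha> \<beta>)) q = 0" if "degree q < l" for q
      using jac_orth[OF that] by (simp add: ip jint_smult)
    show "jacobi_ip \<alpha> \<beta> (smult s (jac l \<alpha> \<beta>)) (smult s (jac l \<alpha> \<beta>)) = 1"
      using N0 Nl s(2) by (simp add: ip jint_smult mult.assoc[symmetric])
  next
    fix p assume p: "degree p = l \<and> lead_coeff p > 0 \<and>
       (\<forall>q. degree q < l \<longrightarrow> jacobi_ip \<alpha> \<beta> p q = 0) \<and> jacobi_ip \<alpha> \<beta> p p = 1"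
    define a where "a = coeff p l / coeff (jac l \<alpha> \<beta>) l"
    have pa: "p = smult a (jac l \<alpha> \<beta>)"
      unfolding a_def using p N0 by (intro orth_poly_unique) (auto simp: ip)
    have "a > 0" unfolding a_def using p coeff_jac_pos[of l] by auto
    moreover have "a * a * jint \<alpha> \<beta> (jac l \<alpha> \<beta> * jac l \<alpha> \<beta>) = jint \<alpha> \<beta> 1"
      using p N0 by (simp add: ip pa jint_smult)
    hence "a * a = s * s" using Nl by (simp add: s(2) field_simps)
    ultimately have "a = s" using s(1) by (simp add: power2_eq_square[symmetric])
    thus "p = smult s (jac l \<alpha> \<beta>)" using pa by simp
  qed
qed

end

text \<open>The weight of index \<mu> + 1/2 is the Jacobi weight with both parameters \<mu>; the
  prescribed value at 1 fixes the factor, because \<open>jac\<close> is 1 there.\<close>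

lemma Gegenbauer_eq_jac:
  assumes "\<mu> \<ge> 0"
  shows "Gegenbauer k (\<mu> + 1/2) = smult (pochhammer (2 * \<mu> + 1) k / fact k) (jac k \<mu> \<mu>)"
proof -
  have ab: "\<mu> > -1" "\<mu> > -1" "\<mu> + \<mu> > -1" using assms by auto
  have J: "(LINT s:{-1..1}|lebesgue. poly p s * poly q s * (1 - s\<^sup>2) powr (\<mu> + 1/2 - 1/2)) = jint \<mu> \<mu> (p * q)" for p q
    unfolding jint_def
  proof (intro set_lebesgue_integral_cong ballI impI allI)
    fix s :: real assume s: "s \<in> {-1..1}"
    have "(1 - s\<^sup>2) powr \<mu> = jacobi_weight \<mu> \<mu> s"
      using s by (simp add: jacobi_weight_def powr_mult[symmetric] power2_eq_square algebra_simps)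
    thus "poly p s * poly q s * (1 - s\<^sup>2) powr (\<mu> + 1/2 - 1/2) = poly (p * q) s * jacobi_weight \<mu> \<mu> s" by simp
  qed simp
  define c where "c = pochhammer (2 * \<mu> + 1) k / fact k"
  have c: "c > 0" using assms unfolding c_def by (intro divide_pos_pos pochhammer_pos) auto
  have e: "pochhammer (2 * (\<mu> + 1/2)) k / fact k = c" by (simp add: c_def algebra_simps)
  show ?thesis unfolding Gegenbauer_def J e c_def[symmetric]
  proof (rule the_equality, intro conjI allI impI)
    show "degree (smult c (jac k \<mu> \<mu>)) = k" using c degree_jac[OF ab] by simp
    show "jint \<mu> \<mu> (smult c (jac k \<mu> \<mu>) * q) = 0" if "degree q < k" for q
      using jac_orth[OF ab that] by (simp add: jint_smult)
    show "poly (smult c (jac k \<mu> \<mu>)) 1 = c" by simp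
  next
    fix p assume p: "degree p = k \<and> (\<forall>q. degree q < k \<longrightarrow> jint \<mu> \<mu> (p * q) = 0) \<and> poly p 1 = c"
    hence "p = smult (coeff p k / coeff (jac k \<mu> \<mu>) k) (jac k \<mu> \<mu>)" (is "_ = smult ?a _")
      by (intro orth_poly_unique[OF ab]) auto
    moreover from this p have "?a = c" by (metis mult.right_neutral poly_jac_1 poly_smult)
    ultimately show "p = smult c (jac k \<mu> \<mu>)" by simp
  qed
qed

subsection \<open>Bivariate polynomials\<close>

lemma finite_triangle [simp]: "finite {(i :: nat, j). i + j < n}"
  by (rule finite_subset[of _ "{..n} \<times> {..n}"]) auto

lemma polys_belowI:
  "(\<lambda>z. \<Sum>(i, j)\<in>{(i, j). i + j < n}. c i j * fst z ^ i * snd z ^ j) \<in> polys_below n"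
  unfolding polys_below_def by (auto simp: split_beta intro!: exI[of _ c])

lemma polys_belowE:
  assumes "P \<in> polys_below n"
  obtains c where "P = (\<lambda>z. \<Sum>(i, j)\<in>{(i, j). i + j < n}. c i j * fst z ^ i * snd z ^ j)"
proof -
  obtain c where "P = (\<lambda>(x, y). \<Sum>(i, j)\<in>{(i, j). i + j < n}. c i j * x ^ i * y ^ j)"
    using assms unfolding polys_below_def by blast
  thus ?thesis by (intro that[of c]) (simp add: split_beta fun_eq_iff)
qed

lemma polys_below_0 [simp]: "(\<lambda>_. 0) \<in> polys_below n"
  using polys_belowI[where n = n and c = "\<lambda>_ _. 0"] by (simp add: split_beta)

lemma polys_below_add:
  assumes "P \<in> polys_below n" "Q \<in> polys_below n"
  shows "(\<lambda>z. P z + Q z) \<in> polys_below n"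
proof -
  obtain c where c: "P = (\<lambda>z. \<Sum>(i, j)\<in>{(i, j). i + j < n}. c i j * fst z ^ i * snd z ^ j)"
    using assms(1) by (rule polys_belowE)
  obtain d where d: "Q = (\<lambda>z. \<Sum>(i, j)\<in>{(i, j). i + j < n}. d i j * fst z ^ i * snd z ^ j)"
    using assms(2) by (rule polys_belowE)
  have "(\<lambda>z. P z + Q z) = (\<lambda>z. \<Sum>(i, j)\<in>{(i, j). i + j < n}. (c i j + d i j) * fst z ^ i * snd z ^ j)"
    unfolding c d by (simp add: split_beta sum.distrib[symmetric] algebra_simps)
  thus ?thesis using polys_belowI[where n = n and c = "\<lambda>i j. c i j + d i j"] by simp
qed

lemma polys_below_cmult:
  assumes "P \<in> polys_below n"
  shows "(\<lambda>z. a * P z) \<in> polys_below n"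
proof -
  obtain c where c: "P = (\<lambda>z. \<Sum>(i, j)\<in>{(i, j). i + j < n}. c i j * fst z ^ i * snd z ^ j)"
    using assms(1) by (rule polys_belowE)
  have "(\<lambda>z. a * P z) = (\<lambda>z. \<Sum>(i, j)\<in>{(i, j). i + j < n}. (a * c i j) * fst z ^ i * snd z ^ j)"
    unfolding c by (simp add: split_beta sum_distrib_left mult.assoc)
  thus ?thesis using polys_belowI[where n = n and c = "\<lambda>i j. a * c i j"] by simp
qed

lemma polys_below_sum:
  assumes "\<And>i. i \<in> I \<Longrightarrow> P i \<in> polys_below n"
  shows "(\<lambda>z. \<Sum>i\<in>I. P i z) \<in> polys_below n"
proof (cases "finite I")
  case True
  thus ?thesis using assms by induction (auto intro: polys_below_add)
qed simp

lemma polys_below_diff: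
  assumes "P \<in> polys_below n" "Q \<in> polys_below n"
  shows "(\<lambda>z. P z - Q z) \<in> polys_below n"
  using polys_below_add[OF assms(1) polys_below_cmult[OF assms(2), of "-1"]] by simp

lemma polys_below_monomial:
  assumes "a + b < n"
  shows "(\<lambda>z. c * fst z ^ a * snd z ^ b) \<in> polys_below n"
proof -
  have "(\<lambda>z. \<Sum>(i, j)\<in>{(i, j). i + j < n}. (if i = a \<and> j = b then c else 0) * fst z ^ i * snd z ^ j)
      = (\<lambda>z. \<Sum>ij\<in>{(i, j). i + j < n}. if ij = (a, b) then c * fst z ^ a * snd z ^ b else (0 :: real))"
    by (intro ext sum.cong) (auto split: if_splits)
  also have "\<dots> = (\<lambda>z. c * fst z ^ a * snd z ^ b)"
    using assms by (subst sum.delta) auto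
  finally show ?thesis using polys_belowI[where n = n and c = "\<lambda>i j. if i = a \<and> j = b then c else 0"] by simp
qed

lemma polys_below_induct [consumes 1, case_names zero add monomial, induct set: polys_below]:
  assumes "P \<in> polys_below n"
    and "T (\<lambda>_. 0)"
    and "\<And>P Q. P \<in> polys_below n \<Longrightarrow> Q \<in> polys_below n \<Longrightarrow> T P \<Longrightarrow> T Q \<Longrightarrow> T (\<lambda>z. P z + Q z)"
    and "\<And>c i j. i + j < n \<Longrightarrow> T (\<lambda>z. c * fst z ^ i * snd z ^ j)"
  shows "T P"
proof -
  obtain c where c: "P = (\<lambda>z. \<Sum>(i, j)\<in>{(i, j). i + j < n}. c i j * fst z ^ i * snd z ^ j)"
    using assms(1) by (rule polys_belowE)
  have "T (\<lambda>z. \<Sum>(i, j)\<in>I. c i j * fst z ^ i * snd z ^ j)" if "I \<subseteq> {(i, j). i + j < n}" for I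
  proof -
    have "finite I" using that finite_triangle finite_subset by blast
    thus ?thesis using that
    proof induction
      case (insert ij I)
      obtain i j where ij: "ij = (i, j)" by force
      have "(\<lambda>z. \<Sum>(i, j)\<in>I. c i j * fst z ^ i * snd z ^ j) \<in> polys_below n"
        using insert.prems by (intro polys_below_sum) (auto intro: polys_below_monomial)
      with insert ij show ?case by (auto intro!: assms(3,4) polys_below_monomial)
    qed (use assms(2) in simp)
  qed
  thus ?thesis unfolding c by blast
qed

lemma polys_below_mono:
  assumes "P \<in> polys_below n" "n \<le> m"
  shows "P \<in> polys_below m"
  using assms by induction (auto intro: polys_below_add polys_below_monomial)

lemma polys_below_mult:
  assumes "P \<in> polys_below (Suc m)" "Q \<in> polys_below (Suc n)"
  shows "(\<lambda>z. P z * Q z) \<in> polys_below (Suc (m + n))"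
  using assms(1)
proof induction
  case (add P P')
  thus ?case by (auto simp: distrib_right intro: polys_below_add)
next
  case (monomial c i j)
  note ij = this
  show ?case using assms(2)
  proof induction
    case (add Q Q')
    thus ?case by (auto simp: distrib_left intro: polys_below_add)
  next
    case (monomial d a b)
    have "(\<lambda>z. c * fst z ^ i * snd z ^ j * (d * fst z ^ a * snd z ^ b))
        = (\<lambda>z. (c * d) * fst z ^ (i + a) * snd z ^ (j + b))"
      by (simp add: power_add mult_ac)
    thus ?case using ij monomial by (auto intro!: polys_below_monomial)
  qed simp
qed simp

lemma polys_below_power:
  assumes "P \<in> polys_below (Suc m)"
  shows "(\<lambda>z. P z ^ n) \<in> polys_below (Suc (m * n))"
proof (induction n)
  case 0
  show ?case using polys_below_monomial[of 0 0 1 1] by simp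
next
  case (Suc n)
  from polys_below_mult[OF assms Suc] show ?case by simp
qed

lemma polys_below_continuous:
  assumes "P \<in> polys_below n"
  shows "continuous_on S P"
  using assms by induction (auto intro!: continuous_intros)

lemma polys_below_linear: "(\<lambda>z. a * fst z + b * snd z) \<in> polys_below (Suc 1)"
  using polys_below_add[OF polys_below_monomial[of 1 0 2 a] polys_below_monomial[of 0 1 2 b]] by (simp add: numeral_2_eq_2)

lemma polys_below_rot:
  assumes "P \<in> polys_below n"
  shows "(\<lambda>z. P (rot \<theta> z)) \<in> polys_below n"
  using assms
proof induction
  case (monomial c i j)
  have "(\<lambda>z. (cos \<theta> * fst z + (- sin \<theta>) * snd z) ^ i * (sin \<theta> * fst z + cos \<theta> * snd z) ^ j)
      \<in> polys_below (Suc (1 * i + 1 * j))"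
    by (intro polys_below_mult polys_below_power polys_below_linear)
  hence "(\<lambda>z. (cos \<theta> * fst z + (- sin \<theta>) * snd z) ^ i * (sin \<theta> * fst z + cos \<theta> * snd z) ^ j)
      \<in> polys_below n"
    by (rule polys_below_mono) (use monomial in simp)
  from polys_below_cmult[OF this, of c] show ?case
    by (simp add: rot_def split_beta algebra_simps)
qed (auto intro: polys_below_add)

lemma polys_below_dotdir:
  assumes "degree g \<le> n"
  shows "(\<lambda>z. poly g (dotdir \<theta> z)) \<in> polys_below (Suc n)"
proof -
  have l: "dotdir \<theta> \<in> polys_below (Suc 1)"
    using polys_below_linear[of "cos \<theta>" "sin \<theta>"] by (simp add: dotdir_def[abs_def] mult.commute)
  have "(\<lambda>z. \<Sum>i\<le>degree g. coeff g i * dotdir \<theta> z ^ i) \<in> polys_below (Suc n)"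
  proof (intro polys_below_sum polys_below_cmult)
    fix i assume "i \<in> {..degree g}"
    thus "(\<lambda>z. dotdir \<theta> z ^ i) \<in> polys_below (Suc n)"
      using polys_below_mono[OF polys_below_power[OF l, of i]] assms by simp
  qed
  thus ?thesis by (simp add: poly_altdef)
qed

text \<open>On each line through the origin the polynomial is a one-variable polynomial with
  infinitely many zeros.\<close>

lemma polys_below_zero_ball:
  assumes "P \<in> polys_below n" and 0: "\<And>z. z \<in> ball 0 1 \<Longrightarrow> P z = 0"
  shows "P = (\<lambda>_. 0)"
proof
  fix z
  have "\<exists>p. \<forall>s. P (s *\<^sub>R z) = poly p s"
    using assms(1)
  proof induction
    case (add P Q)
    then obtain p q where "\<forall>s. P (s *\<^sub>R z) = poly p s" "\<forall>s. Q (s *\<^sub>R z) = poly q s" by auto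
    thus ?case by (intro exI[of _ "p + q"]) simp
  next
    case (monomial c i j)
    show ?case
      by (intro exI[of _ "monom (c * fst z ^ i * snd z ^ j) (i + j)"])
         (simp add: poly_monom power_mult_distrib power_add mult_ac)
  qed (auto intro: exI[of _ 0])
  then obtain p where p: "\<And>s. P (s *\<^sub>R z) = poly p s" by auto
  \<comment> \<open>For 0 < s < e the point s z lies in the unit ball; the summand 1 keeps
    \<open>e\<close> positive also for z = 0.\<close>
  define e where "e = 1 / (1 + norm z)"
  have e: "e > 0" by (simp add: e_def add_pos_nonneg)
  have "poly p s = 0" if "s \<in> {0<..<e}" for s
  proof -
    have "s * (1 + norm z) < e * (1 + norm z)"
      using that by (intro mult_strict_right_mono) (auto simp: add_pos_nonneg)
    also have "e * (1 + norm z) = 1" using add_pos_nonneg[OF zero_less_one norm_ge_zero[of z]] by (simp add: e_def)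
    finally have "s * norm z < 1" using that by (simp add: algebra_simps)
    hence "s *\<^sub>R z \<in> ball 0 1" using that by simp
    with 0 p show ?thesis by metis
  qed
  hence "{0<..<e} \<subseteq> {s. poly p s = 0}" by auto
  hence "infinite {s. poly p s = 0}" using infinite_super infinite_Ioo[OF e] by blast
  hence "p = 0" using poly_roots_finite[of p] by blast
  thus "P z = 0" using p[of 1] by simp
qed

section \<open>Homogeneous harmonic polynomials and the polar spanning set\<close>

definition cpt :: "real \<times> real \<Rightarrow> complex" where
  "cpt z = Complex (fst z) (snd z)"

text \<open>The homogeneous harmonic polynomials of degree \<open>j\<close>: in polar coordinates,
  r^j times a combination of cos (j \<phi>) and sin (j \<phi>). The complex coefficient covers both
  at once, and a rotation only multiplies it by a number of modulus 1.\<close>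

definition har :: "complex \<Rightarrow> nat \<Rightarrow> real \<times> real \<Rightarrow> real" where
  "har c j z = Re (c * cpt z ^ j)"

lemma cpt_mult_cnj: "cpt z * cnj (cpt z) = of_real (nrm2 z)"
  by (simp add: cpt_def nrm2_def complex_mult_cnj)

lemma cpt_rot: "cpt (rot \<theta> z) = cis \<theta> * cpt z"
  by (simp add: cpt_def rot_def split_beta complex_eq_iff algebra_simps)

lemma har_rot: "har c j (rot \<theta> z) = har (c * cis (real j * \<theta>)) j z"
  by (simp only: har_def cpt_rot power_mult_distrib Complex.DeMoivre mult.assoc)

lemma har_0 [simp]: "har c 0 z = Re c"
  by (simp add: har_def)

text \<open>Im w = Re (- i w), so the imaginary part that appears in the product (x + i y) w is
  again a \<open>har\<close>.\<close>

lemma har_Suc: "har c (Suc j) z = fst z * har c j z + (-1) * (snd z * har (- (\<i> * c)) j z)"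
  by (simp add: har_def cpt_def algebra_simps)

text \<open>Product-to-sum formula: Re u Re v = (Re (u v) + Re (u cnj v)) / 2. In the second term
  the common powers of z and its conjugate combine to the radial factor.\<close>

lemma har_mult:
  assumes "j' \<le> j"
  shows "har a j z * har b j' z = 1/2 * har (a * b) (j + j') z + 1/2 * (nrm2 z ^ j' * har (a * cnj b) (j - j') z)"
proof -
  have "Re u * Re v = 1/2 * Re (u * v) + 1/2 * Re (u * cnj v)" for u v
    by (simp add: field_simps)
  moreover have "(a * cpt z ^ j) * (b * cpt z ^ j') = (a * b) * cpt z ^ (j + j')"
    by (simp add: power_add)
  moreover have "Re ((a * cpt z ^ j) * cnj (b * cpt z ^ j')) = nrm2 z ^ j' * Re ((a * cnj b) * cpt z ^ (j - j'))"
  proof -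
    have "(a * cpt z ^ j) * cnj (b * cpt z ^ j') = (a * cnj b) * (cpt z * cnj (cpt z)) ^ j' * cpt z ^ (j - j')"
      using assms power_add[of "cpt z" j' "j - j'"] by (simp add: power_mult_distrib mult_ac)
    also have "\<dots> = of_real (nrm2 z ^ j') * ((a * cnj b) * cpt z ^ (j - j'))"
      by (simp add: cpt_mult_cnj mult_ac)
    finally show ?thesis by (metis Re_complex_of_real scaleR_complex.simps(1) scaleR_conv_of_real)
  qed
  ultimately show ?thesis unfolding har_def by metis
qed

lemma har_polys_below: "har c j \<in> polys_below (Suc j)"
proof (induction j arbitrary: c)
  case 0
  show ?case using polys_below_monomial[of 0 0 1 "Re c"] by (simp add: har_def[abs_def])
next
  case (Suc j)
  have x: "(\<lambda>z. fst z) \<in> polys_below (Suc 1)" "(\<lambda>z. snd z) \<in> polys_below (Suc 1)"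
    using polys_below_linear[of 1 0] polys_below_linear[of 0 1] by simp_all
  have "(\<lambda>z. fst z * har c j z + (-1) * (snd z * har (- (\<i> * c)) j z)) \<in> polys_below (Suc (1 + j))"
    by (intro polys_below_add polys_below_cmult polys_below_mult x Suc)
  thus ?case by (simp add: har_Suc[abs_def])
qed

lemma nrm2_polys_below: "nrm2 \<in> polys_below (Suc 2)"
  using polys_below_add[OF polys_below_monomial[of 2 0 3 1] polys_below_monomial[of 0 2 3 1]]
  by (simp add: nrm2_def[abs_def] numeral_3_eq_3 numeral_2_eq_2)

lemma nrm2_power_har_polys_below:
  assumes "2 * i + j < n"
  shows "(\<lambda>z. nrm2 z ^ i * har c j z) \<in> polys_below n"
  using polys_below_mono[OF polys_below_mult[OF polys_below_power[OF nrm2_polys_below, of i] har_polys_below[of c j]]] assms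
  by simp

lemma radial_har_polys_below:
  assumes "2 * degree p + j < n"
  shows "(\<lambda>z. poly p (nrm2 z) * har c j z) \<in> polys_below n"
proof -
  have "(\<lambda>z. \<Sum>i\<le>degree p. coeff p i * (nrm2 z ^ i * har c j z)) \<in> polys_below n"
    using assms by (intro polys_below_sum polys_below_cmult nrm2_power_har_polys_below) auto
  thus ?thesis by (simp add: poly_altdef sum_distrib_right mult.assoc)
qed

text \<open>In polar coordinates: the span of \<open>r ^ (2 * i + j) * cos (j * \<phi>)\<close> and \<open>r ^ (2 * i + j) * sin (j * \<phi>)\<close>.\<close>

inductive_set polar :: "nat \<Rightarrow> (real \<times> real \<Rightarrow> real) set" for n where
  gen: "2 * i + j < n \<Longrightarrow> (\<lambda>z. nrm2 z ^ i * har c j z) \<in> polar n"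
| add: "P \<in> polar n \<Longrightarrow> Q \<in> polar n \<Longrightarrow> (\<lambda>z. P z + Q z) \<in> polar n"

lemma polar_mult_linear:
  assumes "P \<in> polar n"
  shows "(\<lambda>z. har d 1 z * P z) \<in> polar (Suc n)"
  using assms
proof induction
  case (gen i j c)
  have half: "1/2 * har b j z = har (b / 2) j z" for b j z by (simp add: har_def)
  show ?case
  \<comment> \<open>The product formula needs 1 \<le> \<open>j\<close>; for \<open>j = 0\<close> the
    harmonic is a constant and is absorbed into \<open>d\<close>.\<close>
  proof (cases "j = 0")
    case True
    have "(\<lambda>z. har d 1 z * (nrm2 z ^ i * har c j z)) = (\<lambda>z. nrm2 z ^ i * har (Re c * d) 1 z)"
      using True by (simp add: har_def algebra_simps fun_eq_iff)
    moreover have "(\<lambda>z. nrm2 z ^ i * har (Re c * d) 1 z) \<in> polar (Suc n)"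
      using gen True by (intro polar.gen) simp
    ultimately show ?thesis by simp
  next
    case False
    have "har d 1 z * (nrm2 z ^ i * har c j z)
        = nrm2 z ^ i * har (c * d / 2) (j + 1) z + nrm2 z ^ (i + 1) * har (c * cnj d / 2) (j - 1) z" for z
    proof -
      have "har c j z * har d 1 z = har (c * d / 2) (j + 1) z + nrm2 z * har (c * cnj d / 2) (j - 1) z"
        using har_mult[of 1 j c z d] False unfolding half[symmetric] by simp
      hence "nrm2 z ^ i * (har c j z * har d 1 z)
          = nrm2 z ^ i * har (c * d / 2) (j + 1) z + nrm2 z ^ (i + 1) * har (c * cnj d / 2) (j - 1) z"
        by (simp add: distrib_left mult_ac)
      thus ?thesis by (simp only: mult_ac)
    qed
    moreover have "(\<lambda>z. nrm2 z ^ i * har (c * d / 2) (j + 1) z + nrm2 z ^ (i + 1) * har (c * cnj d / 2) (j - 1) z) \<in> polar (Suc n)"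
      using gen False by (intro polar.add polar.gen) auto
    ultimately show ?thesis by simp
  qed
next
  case (add P Q)
  thus ?case by (simp add: distrib_left polar.add)
qed

text \<open>Monomials arise from constants by multiplication with the linear forms x and y, each
  raising the degree bound by one. The bound is \<open>Suc n\<close> because \<open>polar 0\<close>
  is empty whereas \<open>polys_below 0\<close> contains 0.\<close>

lemma polys_below_polar:
  assumes "P \<in> polys_below (Suc n)"
  shows "P \<in> polar (Suc n)"
proof -
  have x: "har 1 1 z = fst z" "har (- \<i>) 1 z = snd z" for z by (simp_all add: har_def cpt_def)
  have mono: "(\<lambda>z. a * fst z ^ i * snd z ^ j) \<in> polar n" if "i + j < n" for a i j n
    using that
  proof (induction i arbitrary: n)
    case 0
    thus ?case
    proof (induction j arbitrary: n)
      case 0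
      thus ?case using polar.gen[of 0 0 n "of_real a"] by simp
    next
      case (Suc j)
      then obtain n' where n': "n = Suc n'" by (cases n) auto
      have "(\<lambda>z. har (- \<i>) 1 z * (a * fst z ^ 0 * snd z ^ j)) \<in> polar n"
        unfolding n' using Suc n' by (intro polar_mult_linear) auto
      thus ?case unfolding x by (simp add: mult_ac)
    qed
  next
    case (Suc i)
    then obtain n' where n': "n = Suc n'" by (cases n) auto
    have "(\<lambda>z. har 1 1 z * (a * fst z ^ i * snd z ^ j)) \<in> polar n"
      unfolding n' using Suc n' by (intro polar_mult_linear) auto
    thus ?case unfolding x by (simp add: mult_ac)
  qed
  from assms show ?thesis
  proof induction
    case zero
    show ?case using mono[of 0 0 "Suc n" 0] by simp
  qed (auto intro: polar.add mono)
qed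

subsection \<open>The orthonormal basis\<close>

definition disk_int :: "real \<Rightarrow> (real \<times> real \<Rightarrow> real) \<Rightarrow> real" where
  "disk_int \<mu> F = (LINT z:disk|lebesgue. F z * disk_weight \<mu> z)"

lemma ip_disk_int: "ip \<mu> P Q = a_const \<mu> * disk_int \<mu> (\<lambda>z. P z * Q z)"
  by (simp add: ip_def disk_int_def)

lemma disk_int_cmult: "disk_int \<mu> (\<lambda>z. a * F z) = a * disk_int \<mu> F"
  by (simp add: disk_int_def mult.assoc)

lemma disk_int_0 [simp]: "disk_int \<mu> (\<lambda>_. 0) = 0"
  by (simp add: disk_int_def)

lemma continuous_on_har [continuous_intros]: "continuous_on S (har c j)"
  by (rule polys_below_continuous[OF har_polys_below])

context
  fixes \<mu> :: real
  assumes mu: "\<mu> \<ge> 0"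
begin

lemma disk_int_add:
  assumes "continuous_on UNIV F" "continuous_on UNIV G"
  shows "disk_int \<mu> (\<lambda>z. F z + G z) = disk_int \<mu> F + disk_int \<mu> G"
  unfolding disk_int_def using assms by (simp add: distrib_right set_integral_add(2) disk_weight_integrable mu)

lemma disk_int_rot:
  assumes "continuous_on UNIV F"
  shows "disk_int \<mu> (\<lambda>z. F (rot \<theta> z)) = disk_int \<mu> F"
proof -
  have "integrable lebesgue (\<lambda>z. indicator disk z *\<^sub>R (F z * disk_weight \<mu> z))"
    using disk_weight_integrable[OF mu assms] by (simp add: set_integrable_def)
  from rotated_Fubini(4)[OF this, of \<theta>]
  have "(LINT z|lebesgue. indicator disk (rot \<theta> z) *\<^sub>R (F (rot \<theta> z) * disk_weight \<mu> (rot \<theta> z))) = disk_int \<mu> F"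
    by (simp add: disk_int_def set_lebesgue_integral_def)
  moreover have "indicator disk (rot \<theta> z) = (indicator disk z :: real)" for z
    unfolding indicator_def by (simp only: rot_disk)
  ultimately show ?thesis by (simp add: disk_int_def set_lebesgue_integral_def)
qed

text \<open>Rotation by pi / n changes the sign of the harmonic and keeps everything radial, so the
  integral equals its negative.\<close>

lemma disk_int_har:
  assumes "n > 0"
  shows "disk_int \<mu> (\<lambda>z. poly p (nrm2 z) * har c n z) = 0"
proof -
  have "disk_int \<mu> (\<lambda>z. poly p (nrm2 z) * har c n z)
      = disk_int \<mu> (\<lambda>z. poly p (nrm2 (rot (pi / n) z)) * har c n (rot (pi / n) z))"
    by (rule disk_int_rot[symmetric]) (intro continuous_intros)
  also have "\<dots> = disk_int \<mu> (\<lambda>z. (-1) * (poly p (nrm2 z) * har c n z))"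
  proof -
    have "har c n (rot (pi / n) z) = - har c n z" for z
      using assms by (simp add: har_rot) (simp add: har_def)
    thus ?thesis by (simp add: nrm2_norm)
  qed
  also have "\<dots> = - disk_int \<mu> (\<lambda>z. poly p (nrm2 z) * har c n z)"
    by (subst disk_int_cmult) simp
  finally show ?thesis by simp
qed

text \<open>Substitute u = r^2 and t = 2 u - 1. The exponent of 2 collects the two weight factors
  and dt = 2 du; the power r^(2 j) becomes the weight (1 + t)^j.\<close>

lemma disk_int_radial:
  "disk_int \<mu> (\<lambda>z. poly p (2 * nrm2 z - 1) * nrm2 z ^ j)
     = pi / 2 powr (\<mu> + 1/2 + real j) * jint (\<mu> - 1/2) (real j) p"
proof -
  let ?G = "\<lambda>u. poly p (2 * u - 1) * u ^ j * (1 - u) powr (\<mu> - 1/2)"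
  let ?F = "\<lambda>t. poly p t * jacobi_weight (\<mu> - 1/2) (real j) t"
  have p [measurable]: "poly p \<in> borel_measurable borel"
    by (intro borel_measurable_continuous_onI continuous_intros)
  have m: "?F \<in> borel_measurable borel" "?G \<in> borel_measurable borel" by measurable
  have "disk_int \<mu> (\<lambda>z. poly p (2 * nrm2 z - 1) * nrm2 z ^ j) = (LINT z:disk|lborel. ?G (nrm2 z))"
    unfolding disk_int_def disk_weight_nrm2 by (intro set_lebesgue_lborel) measurable
  also have "\<dots> = pi * (LINT u:{0..1}|lborel. ?G u)"
    by (intro radial_integral(2) m)
  also have "(LINT t:{-1..1}|lborel. ?F t) = 2 * 2 powr (\<mu> - 1/2 + real j) * (LINT u:{0..1}|lborel. ?G u)"
  proof (intro interval_affine(2) m)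
    fix u :: real assume u: "0 < u" "u < 1"
    have "jacobi_weight (\<mu> - 1/2) (real j) (2 * u - 1) = (2 * (1 - u)) powr (\<mu> - 1/2) * (2 * u) powr real j"
      by (simp add: jacobi_weight_def)
    also have "\<dots> = (2 powr (\<mu> - 1/2) * (1 - u) powr (\<mu> - 1/2)) * (2 powr real j * u ^ j)"
      using u powr_mult[of 2 "1 - u" "\<mu> - 1/2"] powr_mult[of 2 u "real j"] by (simp only: powr_realpow)
    also have "\<dots> = 2 powr (\<mu> - 1/2 + real j) * (u ^ j * (1 - u) powr (\<mu> - 1/2))"
      by (simp add: powr_add)
    finally show "?F (2 * u - 1) = 2 powr (\<mu> - 1/2 + real j) * ?G u" by simp
  qed
  hence "(LINT u:{0..1}|lborel. ?G u) = (LINT t:{-1..1}|lborel. ?F t) / 2 powr (\<mu> + 1/2 + real j)"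
  proof -
    have "2 * 2 powr (\<mu> - 1/2 + real j) = 2 powr (\<mu> + 1/2 + real j)"
      using powr_add[of 2 1 "\<mu> - 1/2 + real j"] by (simp add: algebra_simps)
    with \<open>(LINT t:{-1..1}|lborel. ?F t) = _\<close> show ?thesis by simp
  qed
  also have "(LINT t:{-1..1}|lborel. ?F t) = jint (\<mu> - 1/2) (real j) p"
    unfolding jint_def by (rule set_lebesgue_lborel(2)[symmetric]) (use m in auto)
  finally show ?thesis by simp
qed

lemma disk_int_1: "disk_int \<mu> (\<lambda>_. 1) = 1 / a_const \<mu>"
proof -
  have "jint (\<mu> - 1/2) 0 1 = 2 powr (\<mu> + 1/2) * Beta (\<mu> + 1/2) 1"
    using jint_moment(2)[of "\<mu> - 1/2" 0 0 0] mu by (simp add: algebra_simps)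
  moreover have "Beta (\<mu> + 1/2) 1 = 1 / (\<mu> + 1/2)"
  proof -
    have "\<mu> + 1/2 > 0" using mu by simp
    hence "\<mu> + 1/2 \<notin> \<int>\<^sub>\<le>\<^sub>0" "Gamma (\<mu> + 1/2) > 0" by (auto dest: nonpos_Ints_nonpos intro: Gamma_real_pos)
    thus ?thesis using Gamma_plus1[of "\<mu> + 1/2"] by (simp add: Beta_def)
  qed
  ultimately show ?thesis
    using disk_int_radial[of 1 0] by (simp add: a_const_def)
qed

lemma a_const_pos: "a_const \<mu> > 0"
  using mu by (simp add: a_const_def)

text \<open>After \<open>har_mult\<close> only frequency 0 survives integration. It comes from the
  difference j - j' = 0, and from the sum as well if both vanish, whence the separate value for
  \<open>j = 0\<close>.\<close>

lemma disk_int_har_har: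
  "disk_int \<mu> (\<lambda>z. poly p (nrm2 z) * (har a j z * har b j' z))
     = (if j = j' then (if j = 0 then Re a * Re b else Re (a * cnj b) / 2) * disk_int \<mu> (\<lambda>z. poly p (nrm2 z) * nrm2 z ^ j)
        else 0)"
proof -
  have split: "disk_int \<mu> (\<lambda>z. poly p (nrm2 z) * (har a j z * har b j' z))
      = 1/2 * disk_int \<mu> (\<lambda>z. poly (p * monom 1 j') (nrm2 z) * har (a * cnj b) (j - j') z)"
    if "j' \<le> j" "j > 0" for j j' a b
  proof -
    have "disk_int \<mu> (\<lambda>z. poly p (nrm2 z) * (har a j z * har b j' z))
      = disk_int \<mu> (\<lambda>z. 1/2 * (poly p (nrm2 z) * har (a * b) (j + j') z)
          + 1/2 * (poly (p * monom 1 j') (nrm2 z) * har (a * cnj b) (j - j') z))"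
      unfolding har_mult[OF that(1)] by (simp add: poly_monom algebra_simps)
    also have "\<dots> = 1/2 * disk_int \<mu> (\<lambda>z. poly p (nrm2 z) * har (a * b) (j + j') z)
          + 1/2 * disk_int \<mu> (\<lambda>z. poly (p * monom 1 j') (nrm2 z) * har (a * cnj b) (j - j') z)"
      by (subst disk_int_add, intro continuous_intros, intro continuous_intros) (simp only: disk_int_cmult)
    also have "disk_int \<mu> (\<lambda>z. poly p (nrm2 z) * har (a * b) (j + j') z) = 0"
      by (rule disk_int_har) (use that in simp)
    finally show ?thesis by simp
  qed
  have less: "disk_int \<mu> (\<lambda>z. poly p (nrm2 z) * (har a j z * har b j' z)) = 0" if "j' < j" for j j' a b
    using that split[of j' j a b] disk_int_har[of "j - j'" "p * monom 1 j'" "a * cnj b"] by simp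
  consider "j = j'" "j = 0" | "j = j'" "j > 0" | "j' < j" | "j < j'" by linarith
  thus ?thesis
  proof cases
    case 1
    have "disk_int \<mu> (\<lambda>z. poly p (nrm2 z) * (Re a * Re b)) = disk_int \<mu> (\<lambda>z. (Re a * Re b) * poly p (nrm2 z))"
      by (simp only: mult.commute)
    with 1 show ?thesis by (simp add: disk_int_cmult)
  next
    case 2
    have "disk_int \<mu> (\<lambda>z. poly (p * monom 1 j) (nrm2 z) * har (a * cnj b) (j - j) z)
        = disk_int \<mu> (\<lambda>z. Re (a * cnj b) * (poly p (nrm2 z) * nrm2 z ^ j))"
      by (simp only: diff_self_eq_0 har_0 poly_mult poly_monom mult_ac mult_1)
    also have "\<dots> = Re (a * cnj b) * disk_int \<mu> (\<lambda>z. poly p (nrm2 z) * nrm2 z ^ j)"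
      by (rule disk_int_cmult)
    finally show ?thesis using 2 split[of j j a b] by simp
  next
    case 3
    thus ?thesis using less by simp
  next
    case 4
    have "disk_int \<mu> (\<lambda>z. poly p (nrm2 z) * (har a j z * har b j' z))
        = disk_int \<mu> (\<lambda>z. poly p (nrm2 z) * (har b j' z * har a j z))"
      by (simp only: mult.commute)
    thus ?thesis using 4 less by simp
  qed
qed

end

text \<open>\<open>ang j \<epsilon> \<phi>\<close> is the real part of \<open>eps_unit \<epsilon> * cis (j * \<phi>)\<close>.\<close>

definition eps_unit :: "nat \<Rightarrow> complex" where
  "eps_unit \<epsilon> = (if \<epsilon> = 0 then 1 else - \<i>)"

text \<open>The polar form of z^j turns the angular factor into a \<open>har\<close>, at the origin
  too, and \<open>Arg\<close> disappears from all later arguments.\<close>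

lemma basisP_eq:
  "basisP \<mu> k l \<epsilon> z = h_coef \<mu> l k * poly (Jacobi l (\<mu> - 1/2) (real (k - 2 * l))) (2 * nrm2 z - 1)
     * har (eps_unit \<epsilon>) (k - 2 * l) z"
proof -
  have c: "cmod (cpt z) = sqrt (nrm2 z)" by (simp add: cpt_def nrm2_def cmod_def)
  have "cpt z ^ j = rcis (sqrt (nrm2 z) ^ j) (real j * Arg (cpt z))" for j
    using rcis_cmod_Arg[of "cpt z"] DeMoivre2[of "sqrt (nrm2 z)" "Arg (cpt z)" j] c by simp
  hence "har (eps_unit \<epsilon>) j z = sqrt (nrm2 z) ^ j * ang j \<epsilon> (Arg (cpt z))" for j
    by (simp add: har_def eps_unit_def ang_def)
  thus ?thesis
    by (cases z) (simp add: basisP_def Let_def nrm2_def cpt_def)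
qed

lemma half_up_nrm2: "poly half_up (2 * nrm2 z - 1) = nrm2 z"
  by (simp add: field_simps)

lemma adm_cases:
  assumes "(l, \<epsilon>) \<in> adm k"
  shows "2 * l \<le> k" "\<epsilon> = 0 \<or> \<epsilon> = 1 \<and> 2 * l < k"
  using assms by (auto simp: adm_def)

lemma finite_adm [simp]: "finite (adm k)"
  by (rule finite_subset[of _ "{..k} \<times> {..1}"]) (auto simp: adm_def)

text \<open>The mean over the circle of a product of two angular factors: \<open>d_coef\<close> is
  the mean of cos^2 or sin^2, or 1 for the constant. For frequency 0 only \<epsilon> = 0 is
  admissible.\<close>

lemma eps_unit_coef:
  assumes "(l, \<epsilon>) \<in> adm k" "(l, \<epsilon>') \<in> adm k"
  shows "(if k - 2 * l = 0 then Re (eps_unit \<epsilon>) * Re (eps_unit \<epsilon>') else Re (eps_unit \<epsilon> * cnj (eps_unit \<epsilon>')) / 2)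
    = (if \<epsilon> = \<epsilon>' then d_coef l k else 0)"
  using adm_cases[OF assms(1)] adm_cases[OF assms(2)] by (auto simp: eps_unit_def d_coef_def)

context
  fixes \<mu> :: real
  assumes mu: "\<mu> \<ge> 0"
begin

lemma disk_params: "\<mu> - 1/2 > -1" "real j > -1" "\<mu> - 1/2 + real j > -1"
  using mu by auto

lemma disk_int_radial_har:
  "disk_int \<mu> (\<lambda>z. (poly p (2 * nrm2 z - 1) * har a j z) * (poly q (2 * nrm2 z - 1) * har b j' z))
     = (if j = j' then (if j = 0 then Re a * Re b else Re (a * cnj b) / 2)
          * (pi / 2 powr (\<mu> + 1/2 + real j) * jint (\<mu> - 1/2) (real j) (p * q))
        else 0)"
proof -
  have e: "poly (pcompose (p * q) [:-1, 2:]) u = poly p (2 * u - 1) * poly q (2 * u - 1)" for u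
    by (simp add: poly_pcompose mult.commute)
  have "disk_int \<mu> (\<lambda>z. (poly p (2 * nrm2 z - 1) * har a j z) * (poly q (2 * nrm2 z - 1) * har b j' z))
      = disk_int \<mu> (\<lambda>z. poly (pcompose (p * q) [:-1, 2:]) (nrm2 z) * (har a j z * har b j' z))"
    by (simp only: e mult_ac)
  also have "\<dots> = (if j = j' then (if j = 0 then Re a * Re b else Re (a * cnj b) / 2)
      * disk_int \<mu> (\<lambda>z. poly (pcompose (p * q) [:-1, 2:]) (nrm2 z) * nrm2 z ^ j) else 0)"
    by (rule disk_int_har_har[OF mu])
  also have "disk_int \<mu> (\<lambda>z. poly (pcompose (p * q) [:-1, 2:]) (nrm2 z) * nrm2 z ^ j)
      = disk_int \<mu> (\<lambda>z. poly (p * q) (2 * nrm2 z - 1) * nrm2 z ^ j)"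
    by (simp only: e poly_mult)
  finally show ?thesis by (simp only: disk_int_radial[OF mu])
qed

text \<open>\<open>Jacobi\<close> is orthonormal for the weight of total mass 1, so its square
  integrates to the mass of the unnormalized weight.\<close>

lemma jint_Jacobi_square:
  "jint (\<mu> - 1/2) (real j) (Jacobi l (\<mu> - 1/2) (real j) * Jacobi l (\<mu> - 1/2) (real j))
     = 2 powr (\<mu> + 1/2 + real j) * Beta (\<mu> + 1/2) (real j + 1)"
proof -
  have one: "jint (\<mu> - 1/2) (real j) 1 = 2 powr (\<mu> + 1/2 + real j) * Beta (\<mu> + 1/2) (real j + 1)"
    using jint_moment(2)[of "\<mu> - 1/2" "real j" 0 0] disk_params by (simp add: algebra_simps)
  hence "jint (\<mu> - 1/2) (real j) 1 \<ge> 0"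
    using mu by (auto simp: Beta_def intro!: mult_nonneg_nonneg divide_nonneg_nonneg less_imp_le[OF Gamma_real_pos])
  moreover have "jint (\<mu> - 1/2) (real j) (jac l (\<mu> - 1/2) (real j) * jac l (\<mu> - 1/2) (real j)) > 0" (is "?N > 0")
    unfolding jint_jac_square[OF disk_params]
    using disk_params(2,3)[of j] mu by (intro divide_pos_pos mult_pos_pos pochhammer_pos Gamma_real_pos) auto
  ultimately show ?thesis
    unfolding Jacobi_eq_jac[OF disk_params] using one by (simp add: jint_smult mult.assoc[symmetric])
qed

lemma jint_Jacobi_orth:
  assumes "degree q < l"
  shows "jint (\<mu> - 1/2) (real j) (Jacobi l (\<mu> - 1/2) (real j) * q) = 0"
  unfolding Jacobi_eq_jac[OF disk_params] by (simp add: jint_smult jac_orth[OF disk_params assms])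

lemma degree_Jacobi: "degree (Jacobi l (\<mu> - 1/2) (real j)) \<le> l"
  unfolding Jacobi_eq_jac[OF disk_params] by (rule order.trans[OF degree_smult_le degree_jac_le])

lemma coeff_Jacobi_nonzero: "coeff (Jacobi l (\<mu> - 1/2) (real j)) l \<noteq> 0"
proof
  assume "coeff (Jacobi l (\<mu> - 1/2) (real j)) l = 0"
  hence "Jacobi l (\<mu> - 1/2) (real j) = 0"
    unfolding Jacobi_eq_jac[OF disk_params] using coeff_jac_pos[OF disk_params, of l j] by auto
  hence "2 powr (\<mu> + 1/2 + real j) * Beta (\<mu> + 1/2) (real j + 1) = 0"
    using jint_Jacobi_square[of j l] by simp
  moreover have "Beta (\<mu> + 1/2) (real j + 1) > 0"
    unfolding Beta_def using mu by (intro divide_pos_pos mult_pos_pos Gamma_real_pos) auto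
  ultimately show False by simp
qed

lemma h_coef_square:
  "(h_coef \<mu> l k)\<^sup>2 * d_coef l k = Gamma (real (k - 2 * l) + \<mu> + 3/2) / (Gamma (\<mu> + 3/2) * Gamma (real (k - 2 * l) + 1))"
  "h_coef \<mu> l k > 0"
proof -
  have pos: "Gamma (real (k - 2 * l) + \<mu> + 3/2) / (Gamma (\<mu> + 3/2) * Gamma (real (k - 2 * l) + 1)) > 0"
    using mu by (intro divide_pos_pos mult_pos_pos Gamma_real_pos) auto
  have d: "d_coef l k > 0" by (simp add: d_coef_def)
  show "h_coef \<mu> l k > 0" unfolding h_coef_def using pos d by (intro real_sqrt_gt_zero mult_pos_pos) auto
  show "(h_coef \<mu> l k)\<^sup>2 * d_coef l k = Gamma (real (k - 2 * l) + \<mu> + 3/2) / (Gamma (\<mu> + 3/2) * Gamma (real (k - 2 * l) + 1))"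
    unfolding h_coef_def using d by (subst real_sqrt_pow2, intro mult_nonneg_nonneg less_imp_le[OF pos]) auto
qed

text \<open>For fixed \<open>k\<close> distinct \<open>l\<close> have distinct frequencies k - 2 l,
  so orthogonality is purely angular and the Jacobi polynomials enter only through their norm. The
  Gamma quotient in \<open>h_coef\<close> is chosen to cancel the Beta value of that norm.\<close>

lemma basisP_orthonormal:
  assumes b: "(l, \<epsilon>) \<in> adm k" and b': "(l', \<epsilon>') \<in> adm k"
  shows "ip \<mu> (basisP \<mu> k l \<epsilon>) (basisP \<mu> k l' \<epsilon>') = (if (l, \<epsilon>) = (l', \<epsilon>') then 1 else 0)"
proof -
  let ?J = "\<lambda>l. Jacobi l (\<mu> - 1/2) (real (k - 2 * l))"
  have "disk_int \<mu> (\<lambda>z. basisP \<mu> k l \<epsilon> z * basisP \<mu> k l' \<epsilon>' z)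
      = disk_int \<mu> (\<lambda>z. (h_coef \<mu> l k * h_coef \<mu> l' k) * ((poly (?J l) (2 * nrm2 z - 1) * har (eps_unit \<epsilon>) (k - 2 * l) z)
          * (poly (?J l') (2 * nrm2 z - 1) * har (eps_unit \<epsilon>') (k - 2 * l') z)))"
    unfolding basisP_eq by (simp only: mult_ac)
  hence *: "ip \<mu> (basisP \<mu> k l \<epsilon>) (basisP \<mu> k l' \<epsilon>')
      = a_const \<mu> * ((h_coef \<mu> l k * h_coef \<mu> l' k) * (if k - 2 * l = k - 2 * l' then
          (if k - 2 * l = 0 then Re (eps_unit \<epsilon>) * Re (eps_unit \<epsilon>') else Re (eps_unit \<epsilon> * cnj (eps_unit \<epsilon>')) / 2)
          * (pi / 2 powr (\<mu> + 1/2 + real (k - 2 * l)) * jint (\<mu> - 1/2) (real (k - 2 * l)) (?J l * ?J l'))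
        else 0))"
    unfolding ip_disk_int by (simp only: disk_int_cmult disk_int_radial_har)
  show ?thesis
  proof (cases "l = l'")
    case False
    thus ?thesis using * adm_cases(1)[OF b] adm_cases(1)[OF b'] by auto
  next
    case True
    define j where "j = k - 2 * l"
    have "ip \<mu> (basisP \<mu> k l \<epsilon>) (basisP \<mu> k l' \<epsilon>')
        = a_const \<mu> * ((h_coef \<mu> l k * h_coef \<mu> l k) * ((if \<epsilon> = \<epsilon>' then d_coef l k else 0)
          * (pi / 2 powr (\<mu> + 1/2 + real j) * (2 powr (\<mu> + 1/2 + real j) * Beta (\<mu> + 1/2) (real j + 1)))))"
      using * eps_unit_coef[OF b b'[folded True]] jint_Jacobi_square[of "k - 2 * l" l] unfolding True j_def by simp
    also have "\<dots> = (if \<epsilon> = \<epsilon>' then a_const \<mu> * ((h_coef \<mu> l k)\<^sup>2 * d_coef l k) * (pi * Beta (\<mu> + 1/2) (real j + 1)) else 0)"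
      by (simp add: power2_eq_square)
    also have "a_const \<mu> * ((h_coef \<mu> l k)\<^sup>2 * d_coef l k) * (pi * Beta (\<mu> + 1/2) (real j + 1)) = 1"
    proof -
      have "\<mu> + 1/2 > 0" using mu by simp
      hence "\<mu> + 1/2 \<notin> \<int>\<^sub>\<le>\<^sub>0" by (auto dest: nonpos_Ints_nonpos)
      from Gamma_plus1[OF this] have g: "Gamma (\<mu> + 3/2) = (\<mu> + 1/2) * Gamma (\<mu> + 1/2)" by (simp add: add.assoc)
      have nz: "Gamma (\<mu> + 1/2) > 0" "Gamma (real j + 1) > 0" "Gamma (real j + \<mu> + 3/2) > 0"
        using mu by (auto intro!: Gamma_real_pos)
      have b: "Beta (\<mu> + 1/2) (real j + 1) = Gamma (\<mu> + 1/2) * Gamma (real j + 1) / Gamma (real j + \<mu> + 3/2)"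
        by (simp add: Beta_def algebra_simps)
      have "x / pi * (G3 / ((x * G1) * G2)) * (pi * (G1 * G2 / G3)) = 1"
        if "x > 0" "G1 > 0" "G2 > 0" "G3 > 0" for x G1 G2 G3 :: real
        using that by simp
      from this[OF \<open>\<mu> + 1/2 > 0\<close> nz] show ?thesis
        unfolding h_coef_square j_def[symmetric] g b a_const_def .
    qed
    finally show ?thesis using True by simp
  qed
qed

lemma basisP_polys_below:
  assumes "2 * l \<le> k"
  shows "basisP \<mu> k l \<epsilon> \<in> polys_below (Suc k)"
proof -
  define j where "j = k - 2 * l"
  let ?J = "Jacobi l (\<mu> - 1/2) (real j)"
  have "(\<lambda>z. h_coef \<mu> l k * (poly (pcompose ?J [:-1, 2:]) (nrm2 z) * har (eps_unit \<epsilon>) j z)) \<in> polys_below (Suc k)"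
    using assms degree_Jacobi[of l j]
    by (intro polys_below_cmult radial_har_polys_below) (simp add: degree_pcompose j_def)
  moreover have "(\<lambda>z. h_coef \<mu> l k * (poly (pcompose ?J [:-1, 2:]) (nrm2 z) * har (eps_unit \<epsilon>) j z)) = basisP \<mu> k l \<epsilon>"
    by (simp add: fun_eq_iff basisP_eq poly_pcompose mult.commute mult.left_commute j_def)
  ultimately show ?thesis by simp
qed

text \<open>Only a component of the same frequency j = k - 2 l matters, and then 2 i + j < k gives i
  < l, so the radial integral vanishes by Jacobi orthogonality.\<close>

lemma basisP_orth_below:
  assumes "2 * l \<le> k" "Q \<in> polys_below k"
  shows "ip \<mu> (basisP \<mu> k l \<epsilon>) Q = 0"
proof -
  have "Q \<in> polar k \<or> Q = (\<lambda>_. 0)"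
  proof (cases k)
    case 0
    thus ?thesis using assms(2) by (auto simp: polys_below_def split_beta)
  next
    case (Suc n)
    thus ?thesis using assms(2) polys_below_polar by simp
  qed
  \<comment> \<open>Continuity is carried along because additivity of \<open>disk_int\<close> is
    available for continuous functions.\<close>
  moreover have "continuous_on UNIV Q \<and> disk_int \<mu> (\<lambda>z. basisP \<mu> k l \<epsilon> z * Q z) = 0" if "Q \<in> polar k"
    using that
  proof induction
    case (gen i j c)
    let ?J = "Jacobi l (\<mu> - 1/2) (real (k - 2 * l))"
    have "disk_int \<mu> (\<lambda>z. basisP \<mu> k l \<epsilon> z * (nrm2 z ^ i * har c j z))
      = disk_int \<mu> (\<lambda>z. h_coef \<mu> l k * ((poly ?J (2 * nrm2 z - 1) * har (eps_unit \<epsilon>) (k - 2 * l) z)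
          * (poly (half_up ^ i) (2 * nrm2 z - 1) * har c j z)))"
      unfolding basisP_eq poly_power half_up_nrm2 by (simp only: mult_ac)
    also have "\<dots> = 0"
    proof (cases "k - 2 * l = j")
      case True
      hence "degree (half_up ^ i) < l" using gen assms(1) by simp
      thus ?thesis by (simp only: disk_int_cmult disk_int_radial_har jint_Jacobi_orth) simp
    next
      case False
      thus ?thesis by (simp only: disk_int_cmult disk_int_radial_har) simp
    qed
    finally show ?case by (auto intro!: continuous_intros)
  next
    case (add P Q)
    have "continuous_on UNIV (basisP \<mu> k l \<epsilon>)"
      by (rule polys_below_continuous[OF basisP_polys_below[OF assms(1)]])
    hence "disk_int \<mu> (\<lambda>z. basisP \<mu> k l \<epsilon> z * P z + basisP \<mu> k l \<epsilon> z * Q z) = 0"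
      using add.IH by (subst disk_int_add[OF mu]) (auto intro!: continuous_intros)
    thus ?case using add.IH by (auto simp: distrib_left intro!: continuous_intros)
  qed
  ultimately show ?thesis unfolding ip_disk_int by auto
qed

end

subsection \<open>The Radon projection of a polynomial\<close>

text \<open>Scaling \<open>s = sqrt (1 - t\<^sup>2) u\<close>; both sides vanish for \<open>\<bar>t\<bar> = 1\<close> since \<open>0 powr a = 0\<close>.\<close>

lemma chord_moment:
  fixes j :: nat
  assumes "\<mu> \<ge> 0" "T \<ge> 0"
  shows "set_integrable lebesgue {- sqrt T..sqrt T} (\<lambda>s. s ^ j * (T - s\<^sup>2) powr (\<mu> - 1/2))"
    and "(LINT s:{- sqrt T..sqrt T}|lebesgue. s ^ j * (T - s\<^sup>2) powr (\<mu> - 1/2))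
       = T powr \<mu> * sqrt T ^ j * jint (\<mu> - 1/2) (\<mu> - 1/2) (monom 1 j)"
proof -
  let ?F = "\<lambda>s. s ^ j * (T - s\<^sup>2) powr (\<mu> - 1/2)"
  let ?G = "\<lambda>u. u ^ j * jacobi_weight (\<mu> - 1/2) (\<mu> - 1/2) u"
  have [measurable]: "?F \<in> borel_measurable borel" "?G \<in> borel_measurable borel" by measurable
  have G: "set_integrable lborel {-1..1} ?G"
    using jint_integrable[of "\<mu> - 1/2" "\<mu> - 1/2" "monom 1 j"] assms
    by (simp add: poly_monom set_lebesgue_lborel(1))
  have J: "jint (\<mu> - 1/2) (\<mu> - 1/2) (monom 1 j) = (LINT u:{-1..1}|lborel. ?G u)"
    unfolding jint_def by (subst set_lebesgue_lborel) (auto simp: poly_monom)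
  have "set_integrable lborel {- sqrt T..sqrt T} ?F \<and>
      (LINT s:{- sqrt T..sqrt T}|lborel. ?F s) = T powr \<mu> * sqrt T ^ j * (LINT u:{-1..1}|lborel. ?G u)"
  proof (cases "T = 0")
    case True
    have z: "(\<lambda>s. indicator {- sqrt T..sqrt T} s *\<^sub>R ?F s) = (\<lambda>_. 0)"
      using True by (auto simp: fun_eq_iff indicator_def)
    show ?thesis unfolding set_integrable_def set_lebesgue_integral_def z using True by simp
  next
    case False
    hence T: "T > 0" "sqrt T > 0" using assms by auto
    have eq: "indicator {- sqrt T..sqrt T} (0 + sqrt T * u) *\<^sub>R ?F (0 + sqrt T * u)
        = (T powr (\<mu> - 1/2) * sqrt T ^ j) * (indicator {-1..1} u *\<^sub>R ?G u)" for u
    proof (cases "u \<in> {-1..1}")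
      case u: True
      have "T - (sqrt T * u)\<^sup>2 = T * (1 - u\<^sup>2)" using T by (simp add: power_mult_distrib algebra_simps)
      moreover have "1 - u\<^sup>2 \<ge> 0" using u by (simp add: abs_square_le_1 abs_le_iff)
      moreover have "(1 - u\<^sup>2) powr (\<mu> - 1/2) = jacobi_weight (\<mu> - 1/2) (\<mu> - 1/2) u"
        using u by (simp add: jacobi_weight_def powr_mult[symmetric] power2_eq_square algebra_simps)
      ultimately have "(T - (sqrt T * u)\<^sup>2) powr (\<mu> - 1/2) = T powr (\<mu> - 1/2) * jacobi_weight (\<mu> - 1/2) (\<mu> - 1/2) u"
        using T by (simp add: powr_mult)
      moreover have "sqrt T * u \<in> {- sqrt T..sqrt T}"
        using u T mult_left_mono[of "-1" u "sqrt T"] mult_left_mono[of u 1 "sqrt T"] by auto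
      ultimately show ?thesis using u by (simp add: power_mult_distrib)
    next
      case u: False
      have "sqrt T * u \<notin> {- sqrt T..sqrt T}"
      proof
        assume "sqrt T * u \<in> {- sqrt T..sqrt T}"
        hence "sqrt T * (-1) \<le> sqrt T * u" "sqrt T * u \<le> sqrt T * 1" by auto
        with T u show False by (simp only: mult_le_cancel_left_pos) auto
      qed
      with u show ?thesis by simp
    qed
    have i: "set_integrable lborel {- sqrt T..sqrt T} ?F"
    proof -
      have "integrable lborel (\<lambda>u. indicator {- sqrt T..sqrt T} (0 + sqrt T * u) *\<^sub>R ?F (0 + sqrt T * u))"
        unfolding eq using G unfolding set_integrable_def by (intro integrable_mult_right)
      from lborel_integrable_real_affine_iff[of "sqrt T" "\<lambda>s. indicator {- sqrt T..sqrt T} s *\<^sub>R ?F s" 0, THEN iffD1, OF _ this]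
      show ?thesis unfolding set_integrable_def using T by simp
    qed
    have "(LINT s:{- sqrt T..sqrt T}|lborel. ?F s)
        = sqrt T * (LINT u|lborel. indicator {- sqrt T..sqrt T} (0 + sqrt T * u) *\<^sub>R ?F (0 + sqrt T * u))"
      unfolding set_lebesgue_integral_def
      using lborel_integral_real_affine[of "sqrt T" "\<lambda>s. indicator {- sqrt T..sqrt T} s *\<^sub>R ?F s" 0] T by simp
    also have "\<dots> = sqrt T * (T powr (\<mu> - 1/2) * sqrt T ^ j) * (LINT u:{-1..1}|lborel. ?G u)"
      unfolding eq set_lebesgue_integral_def by simp
    also have "sqrt T * (T powr (\<mu> - 1/2) * sqrt T ^ j) = T powr \<mu> * sqrt T ^ j"
      using T powr_add[of T "1/2" "\<mu> - 1/2"] by (simp add: powr_half_sqrt)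
    finally show ?thesis using i by blast
  qed
  thus "set_integrable lebesgue {- sqrt T..sqrt T} ?F"
    "(LINT s:{- sqrt T..sqrt T}|lebesgue. ?F s) = T powr \<mu> * sqrt T ^ j * jint (\<mu> - 1/2) (\<mu> - 1/2) (monom 1 j)"
    unfolding J by (subst set_lebesgue_lborel, auto)+
qed

lemma jint_odd_monom:
  assumes "odd j"
  shows "jint \<alpha> \<alpha> (monom 1 j) = 0"
proof -
  let ?G = "\<lambda>u. u ^ j * jacobi_weight \<alpha> \<alpha> u"
  have [measurable]: "?G \<in> borel_measurable borel" by measurable
  have "jint \<alpha> \<alpha> (monom 1 j) = (LINT u:{-1..1}|lborel. ?G u)"
    unfolding jint_def by (subst set_lebesgue_lborel) (auto simp: poly_monom)
  also have "\<dots> = (LINT u|lborel. indicator {-1..1} (0 + (-1) * u) *\<^sub>R ?G (0 + (-1) * u))"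
    unfolding set_lebesgue_integral_def
    using lborel_integral_real_affine[of "-1" "\<lambda>u. indicator {-1..1} u *\<^sub>R ?G u" 0] by simp
  also have "\<dots> = (LINT u|lborel. - (indicator {-1..1} u *\<^sub>R ?G u))"
  proof (intro Bochner_Integration.integral_cong refl)
    fix u :: real
    have "indicator {-1..1} (- u) = (indicator {-1..1} u :: real)" by (auto simp: indicator_def)
    thus "indicator {-1..1} (0 + (-1) * u) *\<^sub>R ?G (0 + (-1) * u) = - (indicator {-1..1} u *\<^sub>R ?G u)"
      using assms by (simp add: jacobi_weight_def power_minus_odd mult.commute)
  qed
  also have "\<dots> = - (LINT u:{-1..1}|lborel. ?G u)"
    unfolding set_lebesgue_integral_def by simp
  also have "(LINT u:{-1..1}|lborel. ?G u) = jint \<alpha> \<alpha> (monom 1 j)"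
    unfolding jint_def by (subst set_lebesgue_lborel) (auto simp: poly_monom)
  finally show ?thesis by simp
qed

text \<open>\<open>orth_polys\<close> without the demand that the degree be exactly
  \<open>k\<close>, hence visibly a linear space. Both agree, since a polynomial of degree below
  \<open>k\<close> in it is orthogonal to itself.\<close>

definition orth_space :: "real \<Rightarrow> nat \<Rightarrow> (real \<times> real \<Rightarrow> real) set" where
  "orth_space \<mu> k = {P \<in> polys_below (Suc k). \<forall>Q\<in>polys_below k. ip \<mu> P Q = 0}"

definition ridge :: "real \<Rightarrow> nat \<Rightarrow> real \<Rightarrow> real \<times> real \<Rightarrow> real" where
  "ridge \<mu> k \<theta> z = (real k + \<mu> + 1/2) / (\<mu> + 1/2) * poly (Gegenbauer k (\<mu> + 1/2)) (dotdir \<theta> z)"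

lemma ip_commute: "ip \<mu> P Q = ip \<mu> Q P"
  by (simp add: ip_def mult.commute)

context
  fixes \<mu> :: real
  assumes mu: "\<mu> \<ge> 0"
begin

text \<open>Monomial by monomial: odd powers of \<open>s\<close> integrate to 0 over a chord, and an
  even power s^j contributes (1 - t^2)^(j/2), which respects the degree and vanishes at t = 1 unless
  j = 0. Integrability is part of the statement so that the sum case can add integrals.\<close>

lemma chord_integral_poly:
  assumes "P \<in> polys_below (Suc n)"
  shows "\<exists>p. degree p \<le> n \<and> poly p 1 = jint (\<mu> - 1/2) (\<mu> - 1/2) 1 * P (1, 0) \<and>
    (\<forall>t\<in>{-1..1}. set_integrable lebesgue {- sqrt (1 - t\<^sup>2)..sqrt (1 - t\<^sup>2)} (\<lambda>s. P (t, s) * (1 - t\<^sup>2 - s\<^sup>2) powr (\<mu> - 1/2)) \<and>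
      (LINT s:{- sqrt (1 - t\<^sup>2)..sqrt (1 - t\<^sup>2)}|lebesgue. P (t, s) * (1 - t\<^sup>2 - s\<^sup>2) powr (\<mu> - 1/2)) = (1 - t\<^sup>2) powr \<mu> * poly p t)"
  using assms
proof induction
  case zero
  show ?case by (intro exI[of _ 0]) (simp add: set_integrable_def)
next
  case (add P Q)
  then obtain p q where "degree p \<le> n" "poly p 1 = jint (\<mu> - 1/2) (\<mu> - 1/2) 1 * P (1, 0)"
    "\<forall>t\<in>{-1..1}. set_integrable lebesgue {- sqrt (1 - t\<^sup>2)..sqrt (1 - t\<^sup>2)} (\<lambda>s. P (t, s) * (1 - t\<^sup>2 - s\<^sup>2) powr (\<mu> - 1/2)) \<and>
      (LINT s:{- sqrt (1 - t\<^sup>2)..sqrt (1 - t\<^sup>2)}|lebesgue. P (t, s) * (1 - t\<^sup>2 - s\<^sup>2) powr (\<mu> - 1/2)) = (1 - t\<^sup>2) powr \<mu> * poly p t"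
    and "degree q \<le> n" "poly q 1 = jint (\<mu> - 1/2) (\<mu> - 1/2) 1 * Q (1, 0)"
    "\<forall>t\<in>{-1..1}. set_integrable lebesgue {- sqrt (1 - t\<^sup>2)..sqrt (1 - t\<^sup>2)} (\<lambda>s. Q (t, s) * (1 - t\<^sup>2 - s\<^sup>2) powr (\<mu> - 1/2)) \<and>
      (LINT s:{- sqrt (1 - t\<^sup>2)..sqrt (1 - t\<^sup>2)}|lebesgue. Q (t, s) * (1 - t\<^sup>2 - s\<^sup>2) powr (\<mu> - 1/2)) = (1 - t\<^sup>2) powr \<mu> * poly q t"
    by auto
  thus ?case
    by (intro exI[of _ "p + q"]) (auto intro: degree_add_le set_integral_add(1) simp: distrib_left distrib_right set_integral_add(2))
next
  case (monomial c i j)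
  define M where "M = jint (\<mu> - 1/2) (\<mu> - 1/2) (monom 1 j)"
  define p where "p = smult (c * M) (monom 1 i * [:1, 0, -1:] ^ (j div 2))"
  have "degree p \<le> i + 2 * (j div 2)"
    unfolding p_def using degree_mult_le[of "monom 1 i" "[:1, 0, -1:] ^ (j div 2) :: real poly"]
      degree_power_le[of "[:1, 0, -1::real:]" "j div 2"] degree_monom_le[of "1::real" i]
    by (intro order.trans[OF degree_smult_le]) simp
  also have "\<dots> \<le> n" using monomial by linarith
  finally have "degree p \<le> n" .
  moreover have "poly p 1 = jint (\<mu> - 1/2) (\<mu> - 1/2) 1 * (c * fst (1 :: real, 0 :: real) ^ i * snd (1 :: real, 0 :: real) ^ j)"
  proof (cases "j = 0")
    case True
    thus ?thesis by (simp add: p_def M_def poly_monom)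
  next
    case False
    \<comment> \<open>For j = 1 the power \<open>0 ^ (j div 2)\<close> is 1, and the odd moment has
      to vanish instead.\<close>
    hence "j = 1 \<or> j div 2 \<noteq> 0" by linarith
    moreover have "j = 1 \<Longrightarrow> M = 0" unfolding M_def by (rule jint_odd_monom) simp
    ultimately have "M * 0 ^ (j div 2) = 0" by (metis mult_zero_left mult_zero_right power_0_left)
    thus ?thesis using False by (auto simp: p_def poly_monom power_0_left)
  qed
  moreover have "set_integrable lebesgue {- sqrt (1 - t\<^sup>2)..sqrt (1 - t\<^sup>2)} (\<lambda>s. (c * fst (t, s) ^ i * snd (t, s) ^ j) * (1 - t\<^sup>2 - s\<^sup>2) powr (\<mu> - 1/2)) \<and>
      (LINT s:{- sqrt (1 - t\<^sup>2)..sqrt (1 - t\<^sup>2)}|lebesgue. (c * fst (t, s) ^ i * snd (t, s) ^ j) * (1 - t\<^sup>2 - s\<^sup>2) powr (\<mu> - 1/2)) = (1 - t\<^sup>2) powr \<mu> * poly p t"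
    if t: "t \<in> {-1..1}" for t
  proof -
    have T: "1 - t\<^sup>2 \<ge> 0" using t by (simp add: abs_square_le_1 abs_le_iff)
    have e: "(\<lambda>s. (c * fst (t, s) ^ i * snd (t, s) ^ j) * (1 - t\<^sup>2 - s\<^sup>2) powr (\<mu> - 1/2))
        = (\<lambda>s. (c * t ^ i) * (s ^ j * (1 - t\<^sup>2 - s\<^sup>2) powr (\<mu> - 1/2)))" by (simp add: mult_ac)
    have "sqrt (1 - t\<^sup>2) ^ j * M = (1 - t\<^sup>2) ^ (j div 2) * M"
    proof (cases "even j")
      case True
      then obtain m where "j = 2 * m" by (elim evenE)
      thus ?thesis using T by (simp add: power_mult)
    qed (simp add: M_def jint_odd_monom)
    hence m: "(1 - t\<^sup>2) powr \<mu> * sqrt (1 - t\<^sup>2) ^ j * M = (1 - t\<^sup>2) powr \<mu> * (1 - t\<^sup>2) ^ (j div 2) * M"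
      by (simp only: mult.assoc)
    have "poly p t = c * t ^ i * ((1 - t\<^sup>2) ^ (j div 2) * M)"
      by (simp add: p_def poly_monom power2_eq_square algebra_simps)
    hence "(1 - t\<^sup>2) powr \<mu> * poly p t = (c * t ^ i) * ((1 - t\<^sup>2) powr \<mu> * (1 - t\<^sup>2) ^ (j div 2) * M)"
      by (simp only: mult_ac)
    also have "\<dots> = (c * t ^ i) * (LINT s:{- sqrt (1 - t\<^sup>2)..sqrt (1 - t\<^sup>2)}|lebesgue. s ^ j * (1 - t\<^sup>2 - s\<^sup>2) powr (\<mu> - 1/2))"
      unfolding chord_moment(2)[OF mu T] M_def[symmetric] m ..
    finally show ?thesis unfolding e set_integral_mult_right
      using chord_moment(1)[OF mu T, of j] by (intro conjI set_integrable_mult_right) simp_all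
  qed
  ultimately show ?case by blast
qed

lemma Radon_poly:
  assumes "Q \<in> polys_below (Suc n)"
  obtains p where "degree p \<le> n" "poly p 1 = jint (\<mu> - 1/2) (\<mu> - 1/2) 1 * Q (cos \<theta>, sin \<theta>)"
    "\<And>t. t \<in> {-1..1} \<Longrightarrow> Radon \<mu> \<theta> Q t = poly p t * jacobi_weight \<mu> \<mu> t"
proof -
  obtain p where p: "degree p \<le> n" "poly p 1 = jint (\<mu> - 1/2) (\<mu> - 1/2) 1 * Q (rot \<theta> (1, 0))"
    "\<forall>t\<in>{-1..1}. (LINT s:{- sqrt (1 - t\<^sup>2)..sqrt (1 - t\<^sup>2)}|lebesgue. Q (rot \<theta> (t, s)) * (1 - t\<^sup>2 - s\<^sup>2) powr (\<mu> - 1/2)) = (1 - t\<^sup>2) powr \<mu> * poly p t"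
    using chord_integral_poly[OF polys_below_rot[OF assms, of \<theta>]] by blast
  have "Radon \<mu> \<theta> Q t = poly p t * jacobi_weight \<mu> \<mu> t" if t: "t \<in> {-1..1}" for t
  proof -
    have "(1 - t\<^sup>2) powr \<mu> = jacobi_weight \<mu> \<mu> t"
      using t by (simp add: jacobi_weight_def powr_mult[symmetric] power2_eq_square algebra_simps)
    moreover have e: "1 - s\<^sup>2 - t\<^sup>2 = 1 - t\<^sup>2 - s\<^sup>2" for s by simp
    ultimately show ?thesis using p(3) t unfolding Radon_def rot_def e by (simp add: mult.commute)
  qed
  with p show ?thesis by (intro that[of p]) (simp_all add: rot_def)
qed

text \<open>The choice of \<open>p\<close> is independent of \<open>g\<close>, so every inner
  product of \<open>Q\<close> with a ridge function in this direction becomes a one-variable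
  integral against the same polynomial.\<close>

lemma ridge_pairing:
  assumes "Q \<in> polys_below (Suc n)"
  obtains p where "degree p \<le> n" "poly p 1 = jint (\<mu> - 1/2) (\<mu> - 1/2) 1 * Q (cos \<theta>, sin \<theta>)"
    "\<And>g. disk_int \<mu> (\<lambda>z. Q z * poly g (dotdir \<theta> z)) = jint \<mu> \<mu> (p * g)"
proof -
  obtain p where p: "degree p \<le> n" "poly p 1 = jint (\<mu> - 1/2) (\<mu> - 1/2) 1 * Q (cos \<theta>, sin \<theta>)"
    "\<And>t. t \<in> {-1..1} \<Longrightarrow> Radon \<mu> \<theta> Q t = poly p t * jacobi_weight \<mu> \<mu> t"
    using Radon_poly[OF assms, of \<theta>] by blast
  have "disk_int \<mu> (\<lambda>z. Q z * poly g (dotdir \<theta> z)) = jint \<mu> \<mu> (p * g)" for g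
  proof -
    have c: "continuous_on UNIV (\<lambda>z. Q z * poly g (dotdir \<theta> z))"
      using polys_below_continuous[OF assms] polys_below_continuous[OF polys_below_dotdir[OF order.refl]]
      by (intro continuous_on_mult) auto
    have "disk_int \<mu> (\<lambda>z. Q z * poly g (dotdir \<theta> z)) = (LINT t:{-1..1}|lebesgue. Radon \<mu> \<theta> Q t * poly g t)"
      unfolding disk_int_def by (rule Radon_pairing[symmetric]) (use disk_weight_integrable[OF mu c] in simp)
    also have "\<dots> = jint \<mu> \<mu> (p * g)"
      unfolding jint_def by (intro set_lebesgue_integral_cong) (auto simp: p(3) mult_ac)
    finally show ?thesis .
  qed
  with p show ?thesis by (intro that)
qed

lemma gegen_params: "\<mu> > -1" "\<mu> > -1" "\<mu> + \<mu> > -1"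
  using mu by auto

lemma ridge_polys_below: "ridge \<mu> k \<theta> \<in> polys_below (Suc k)"
  unfolding ridge_def[abs_def] Gegenbauer_eq_jac[OF mu]
  by (intro polys_below_cmult polys_below_dotdir order.trans[OF degree_smult_le degree_jac_le])

lemma ip_ridge:
  "ip \<mu> Q (ridge \<mu> k \<theta>) = a_const \<mu> * ((real k + \<mu> + 1/2) / (\<mu> + 1/2)) *
     disk_int \<mu> (\<lambda>z. Q z * poly (Gegenbauer k (\<mu> + 1/2)) (dotdir \<theta> z))"
proof -
  have "disk_int \<mu> (\<lambda>z. Q z * ridge \<mu> k \<theta> z) = disk_int \<mu> (\<lambda>z. ((real k + \<mu> + 1/2) / (\<mu> + 1/2)) *
     (Q z * poly (Gegenbauer k (\<mu> + 1/2)) (dotdir \<theta> z)))"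
    unfolding ridge_def by (simp only: mult_ac)
  thus ?thesis unfolding ip_disk_int disk_int_cmult by simp
qed

text \<open>A \<open>Q\<close> of degree below \<open>k\<close> has a Radon polynomial of degree
  below \<open>k\<close>, to which the Gegenbauer polynomial is orthogonal.\<close>

lemma ridge_orth_space: "ridge \<mu> k \<theta> \<in> orth_space \<mu> k"
proof -
  have "ip \<mu> (ridge \<mu> k \<theta>) Q = 0" if Q: "Q \<in> polys_below k" for Q
  proof (cases k)
    case 0
    hence "Q = (\<lambda>_. 0)" using Q by (auto simp: polys_below_def split_beta)
    thus ?thesis by (simp add: ip_disk_int)
  next
    case (Suc n)
    obtain p where p: "degree p \<le> n"
      "\<And>g. disk_int \<mu> (\<lambda>z. Q z * poly g (dotdir \<theta> z)) = jint \<mu> \<mu> (p * g)"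
      using ridge_pairing[of Q n \<theta>] Q Suc by metis
    have "jint \<mu> \<mu> (jac k \<mu> \<mu> * p) = 0" using p(1) Suc by (intro jac_orth[OF gegen_params]) simp
    thus ?thesis unfolding ip_commute[of \<mu> "ridge \<mu> k \<theta>"] ip_ridge p(2) Gegenbauer_eq_jac[OF mu]
      by (simp add: jint_smult mult.commute)
  qed
  thus ?thesis using ridge_polys_below by (simp add: orth_space_def)
qed

text \<open>The origin of the factor (k + \<mu> + 1/2) / (\<mu> + 1/2) in the kernel: with it, the
  Gegenbauer polynomial paired with \<open>jac\<close> gives the total mass of the weight for every
  \<open>k\<close>.\<close>

lemma jint_jac_square_ratio:
  "pochhammer (2 * \<mu> + 1) k / fact k * jint \<mu> \<mu> (jac k \<mu> \<mu> * jac k \<mu> \<mu>) * ((real k + \<mu> + 1/2) / (\<mu> + 1/2)) = jint \<mu> \<mu> 1"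
proof -
  define c where "c = 2 * \<mu> + 1"
  have c: "c > 0" using mu by (simp add: c_def)
  have nz: "Gamma (c + real k) > 0" "Gamma c > 0" "Gamma (\<mu> + 1) > 0" "Gamma (\<mu> + 1 + real k) > 0" 
    using mu c by (auto intro!: Gamma_real_pos)
  have p: "pochhammer c k = Gamma (c + real k) / Gamma c" 
    "pochhammer (\<mu> + 1) k = Gamma (\<mu> + 1 + real k) / Gamma (\<mu> + 1)"
    using c mu by (auto intro!: pochhammer_Gamma dest: nonpos_Ints_nonpos)
  have j: "jint \<mu> \<mu> (jac l \<mu> \<mu> * jac l \<mu> \<mu>) = 2 powr c * Gamma (\<mu> + 1) * Gamma (\<mu> + 1 + real l) * fact l
     / (Gamma (c + real l) * pochhammer (\<mu> + 1) l * (c + 2 * real l))" for l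
  proof -
    have e: "\<mu> + \<mu> + 1 = c" "real l + \<mu> + \<mu> + 1 = c + real l" "2 * real l + \<mu> + \<mu> + 1 = c + 2 * real l"
      by (simp_all add: c_def)
    show ?thesis using jint_jac_square[OF gegen_params, of l] unfolding e .
  qed
  have "jac 0 \<mu> \<mu> = 1" by (simp add: jac_def)
  with j[of 0] have j0: "jint \<mu> \<mu> 1 = 2 powr c * Gamma (\<mu> + 1) * Gamma (\<mu> + 1) / (Gamma c * c)" by simp
  have r: "(real k + \<mu> + 1/2) / (\<mu> + 1/2) = (c + 2 * real k) / c"
    using mu by (simp add: c_def divide_simps) (simp add: algebra_simps)
  have "(G / H) / F * (w * A * B * F / (G * (B / A) * d)) * (d / c) = w * A * A / (H * c)"
    if "G > 0" "H > 0" "A > 0" "B > 0" "F > 0" "d > 0" for G H A B F d w :: real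
    using that c by (simp add: divide_simps)
  from this[OF nz(1-4) fact_gt_zero, of "c + 2 * real k" k "2 powr c"] c show ?thesis
    unfolding r j0 j c_def[symmetric] p by simp
qed

text \<open>At a boundary point the reproducing kernel of the orthogonal
  space is a ridge polynomial.\<close>

lemma ip_ridge_reproducing:
  assumes "Q \<in> orth_space \<mu> k"
  shows "ip \<mu> Q (ridge \<mu> k \<theta>) = Q (cos \<theta>, sin \<theta>)"
proof -
  let ?M = "jint (\<mu> - 1/2) (\<mu> - 1/2) 1"
  have Q: "Q \<in> polys_below (Suc k)" "\<And>P. P \<in> polys_below k \<Longrightarrow> ip \<mu> Q P = 0"
    using assms by (auto simp: orth_space_def)
  obtain p where p: "degree p \<le> k" "poly p 1 = ?M * Q (cos \<theta>, sin \<theta>)"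
    "\<And>g. disk_int \<mu> (\<lambda>z. Q z * poly g (dotdir \<theta> z)) = jint \<mu> \<mu> (p * g)"
    using ridge_pairing[OF Q(1), of \<theta>] by blast
  have "jint \<mu> \<mu> (p * q) = 0" if "degree q < k" for q
  proof -
    have "(\<lambda>z. poly q (dotdir \<theta> z)) \<in> polys_below k"
      using polys_below_dotdir[of q "k - 1" \<theta>] that by simp
    from Q(2)[OF this] show ?thesis using a_const_pos[OF mu] by (simp add: ip_disk_int p(3))
  qed
  from orth_poly_unique[OF gegen_params p(1) this]
  have "p = smult (coeff p k / coeff (jac k \<mu> \<mu>) k) (jac k \<mu> \<mu>)" .
  \<comment> \<open>Evaluation at 1, where \<open>jac\<close> is 1.\<close>
  moreover from this have "coeff p k / coeff (jac k \<mu> \<mu>) k = poly p 1"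
    by (metis mult.right_neutral poly_jac_1 poly_smult)
  ultimately have pj: "p = smult (?M * Q (cos \<theta>, sin \<theta>)) (jac k \<mu> \<mu>)" by (simp add: p(2))
  \<comment> \<open>The remaining constant depends neither on \<open>Q\<close> nor on
    \<open>k\<close>; the constant polynomial 1 determines it, because \<open>a_const\<close>
    normalizes its integral.\<close>
  have M: "a_const \<mu> * ?M * jint \<mu> \<mu> 1 = 1"
  proof -
    have "(\<lambda>_. 1) \<in> polys_below (Suc 0)" using polys_below_monomial[of 0 0 1 1] by simp
    from ridge_pairing[of "\<lambda>_. 1" 0 0] this obtain r where r: "degree r \<le> 0" "poly r 1 = ?M * 1"
      "\<And>g. disk_int \<mu> (\<lambda>z. 1 * poly g (dotdir 0 z)) = jint \<mu> \<mu> (r * g)"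
      by blast
    then obtain a where "r = [:a:]" by (auto elim: degree_eq_zeroE)
    with r have "r = [:?M:]" by simp
    hence "disk_int \<mu> (\<lambda>_. 1) = ?M * jint \<mu> \<mu> 1"
      using r(3)[of 1] jint_smult[of \<mu> \<mu> ?M 1] by simp
    thus ?thesis using disk_int_1[OF mu] a_const_pos[OF mu] by (simp add: field_simps)
  qed
  have "ip \<mu> Q (ridge \<mu> k \<theta>) = (a_const \<mu> * ?M * (pochhammer (2 * \<mu> + 1) k / fact k * jint \<mu> \<mu> (jac k \<mu> \<mu> * jac k \<mu> \<mu>) * ((real k + \<mu> + 1/2) / (\<mu> + 1/2))))
     * Q (cos \<theta>, sin \<theta>)"
    unfolding ip_ridge p(3) pj Gegenbauer_eq_jac[OF mu]
    by (simp only: mult_smult_left mult_smult_right jint_smult mult_ac)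
  thus ?thesis unfolding jint_jac_square_ratio M by simp
qed

end

subsection \<open>Projections onto the orthogonal space\<close>

lemma ip_sum_right:
  assumes "finite B" "\<And>b. b \<in> B \<Longrightarrow> set_integrable lebesgue disk (\<lambda>z. f z * E b z * disk_weight \<mu> z)"
  shows "ip \<mu> f (\<lambda>z. \<Sum>b\<in>B. c b * E b z) = (\<Sum>b\<in>B. c b * ip \<mu> f (E b))"
proof -
  have "set_integrable lebesgue disk (\<lambda>z. f z * (\<Sum>b\<in>B. c b * E b z) * disk_weight \<mu> z) \<and>
      (LINT z:disk|lebesgue. f z * (\<Sum>b\<in>B. c b * E b z) * disk_weight \<mu> z)
        = (\<Sum>b\<in>B. c b * (LINT z:disk|lebesgue. f z * E b z * disk_weight \<mu> z))"
    using assms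
  proof (induction B)
    case (insert b B)
    have e: "(\<lambda>z. f z * (\<Sum>b\<in>insert b B. c b * E b z) * disk_weight \<mu> z)
        = (\<lambda>z. c b * (f z * E b z * disk_weight \<mu> z) + f z * (\<Sum>b\<in>B. c b * E b z) * disk_weight \<mu> z)"
      using insert.hyps by (simp add: fun_eq_iff algebra_simps)
    have i: "set_integrable lebesgue disk (\<lambda>z. c b * (f z * E b z * disk_weight \<mu> z))"
      "set_integrable lebesgue disk (\<lambda>z. f z * (\<Sum>b\<in>B. c b * E b z) * disk_weight \<mu> z)"
      using insert by (auto intro: set_integrable_mult_right)
    show ?case unfolding e using set_integral_add[OF i] insert by simp
  qed (simp add: set_integrable_def)
  thus ?thesis by (simp add: ip_def sum_distrib_left mult_ac)
qed

abbreviation basisPair :: "real \<Rightarrow> nat \<Rightarrow> nat \<times> nat \<Rightarrow> real \<times> real \<Rightarrow> real" where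
  "basisPair \<mu> k b \<equiv> basisP \<mu> k (fst b) (snd b)"

text \<open>Spanning modulo lower degree, which the leading terms of the basis give directly;
  orthogonality removes the remainder in \<open>V_expansion\<close>.\<close>

definition spanned :: "real \<Rightarrow> nat \<Rightarrow> (real \<times> real \<Rightarrow> real) \<Rightarrow> bool" where
  "spanned \<mu> k P \<longleftrightarrow> (\<exists>a. \<exists>R\<in>polys_below k. P = (\<lambda>z. (\<Sum>b\<in>adm k. a b * basisPair \<mu> k b z) + R z))"

context
  fixes \<mu> :: real
  assumes mu: "\<mu> \<ge> 0"
begin

lemma ip_continuous_integrable:
  assumes "continuous_on UNIV P" "continuous_on UNIV Q"
  shows "set_integrable lebesgue disk (\<lambda>z. P z * Q z * disk_weight \<mu> z)"
  by (rule disk_weight_integrable[OF mu]) (intro continuous_intros assms)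

lemma ip_diff_left:
  assumes "set_integrable lebesgue disk (\<lambda>z. f z * Q z * disk_weight \<mu> z)"
    "set_integrable lebesgue disk (\<lambda>z. g z * Q z * disk_weight \<mu> z)"
  shows "ip \<mu> (\<lambda>z. f z - g z) Q = ip \<mu> f Q - ip \<mu> g Q"
  unfolding ip_def using set_integral_diff(2)[OF assms] by (simp only: left_diff_distrib right_diff_distrib)

lemma ip_self_eq_0:
  assumes "P \<in> polys_below n" "ip \<mu> P P = 0"
  shows "P = (\<lambda>_. 0)"
proof (rule polys_below_zero_ball[OF assms(1)])
  fix z :: "real \<times> real" assume "z \<in> ball 0 1"
  moreover have "(LINT z:disk|lebesgue. P z * P z * disk_weight \<mu> z) = 0"
    using assms(2) a_const_pos[OF mu] by (simp add: ip_def)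
  ultimately show "P z = 0"
    using disk_square_integral_0[OF mu polys_below_continuous[OF assms(1)]] by blast
qed

lemma orth_polys_eq: "orth_polys k \<mu> = orth_space \<mu> k"
proof (intro equalityI subsetI)
  fix P assume "P \<in> orth_space \<mu> k"
  thus "P \<in> orth_polys k \<mu>"
    using ip_self_eq_0[of P k] by (cases "P \<in> polys_below k") (auto simp: orth_polys_def orth_space_def)
next
  fix P assume "P \<in> orth_polys k \<mu>"
  thus "P \<in> orth_space \<mu> k" by (auto simp: orth_polys_def orth_space_def ip_def)
qed

lemma V_continuous: "P \<in> orth_space \<mu> k \<Longrightarrow> continuous_on S P"
  by (auto simp: orth_space_def intro: polys_below_continuous)

lemma V_sum:
  assumes "finite B" "\<And>b. b \<in> B \<Longrightarrow> E b \<in> orth_space \<mu> k"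
  shows "(\<lambda>z. \<Sum>b\<in>B. c b * E b z) \<in> orth_space \<mu> k"
proof -
  have "ip \<mu> (\<lambda>z. \<Sum>b\<in>B. c b * E b z) Q = 0" if Q: "Q \<in> polys_below k" for Q
  proof -
    have "ip \<mu> Q (\<lambda>z. \<Sum>b\<in>B. c b * E b z) = (\<Sum>b\<in>B. c b * ip \<mu> Q (E b))"
      using assms V_continuous polys_below_continuous[OF Q]
      by (intro ip_sum_right ip_continuous_integrable) auto
    also have "\<dots> = 0"
      using assms(2) Q by (intro sum.neutral ballI) (simp add: orth_space_def ip_commute[of _ Q])
    finally show ?thesis by (simp add: ip_commute)
  qed
  moreover have "(\<lambda>z. \<Sum>b\<in>B. c b * E b z) \<in> polys_below (Suc k)"
    using assms(2) by (intro polys_below_sum polys_below_cmult) (auto simp: orth_space_def)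
  ultimately show ?thesis by (simp add: orth_space_def)
qed

lemma V_diff:
  assumes "P \<in> orth_space \<mu> k" "Q \<in> orth_space \<mu> k"
  shows "(\<lambda>z. P z - Q z) \<in> orth_space \<mu> k"
  using assms V_continuous[OF assms(1)] V_continuous[OF assms(2)]
  by (auto simp: orth_space_def polys_below_diff ip_diff_left ip_continuous_integrable polys_below_continuous)

lemma basisP_V: "b \<in> adm k \<Longrightarrow> basisPair \<mu> k b \<in> orth_space \<mu> k"
  using basisP_polys_below[OF mu] basisP_orth_below[OF mu]
  by (cases b) (auto simp: orth_space_def dest: adm_cases)

lemma basisP_orthonormal': "b \<in> adm k \<Longrightarrow> b' \<in> adm k \<Longrightarrow> ip \<mu> (basisPair \<mu> k b) (basisPair \<mu> k b') = (if b = b' then 1 else 0)"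
  using basisP_orthonormal[OF mu] by (cases b; cases b') simp

subsection \<open>The basis spans\<close>

lemma spanned_lower: "R \<in> polys_below k \<Longrightarrow> spanned \<mu> k R"
  unfolding spanned_def by (intro exI[of _ "\<lambda>_. 0"] bexI[of _ R]) auto

lemma spanned_basis:
  assumes "b \<in> adm k"
  shows "spanned \<mu> k (basisPair \<mu> k b)"
proof -
  have "(\<Sum>b'\<in>adm k. (if b' = b then 1 else 0) * basisPair \<mu> k b' z) = (\<Sum>b'\<in>adm k. if b' = b then basisPair \<mu> k b' z else 0)" for z
    by (intro sum.cong) auto
  hence "(\<Sum>b'\<in>adm k. (if b' = b then 1 else 0) * basisPair \<mu> k b' z) = basisPair \<mu> k b z" for z
    using assms finite_adm by (simp add: sum.delta)
  thus ?thesis unfolding spanned_def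
    by (intro exI[of _ "\<lambda>b'. if b' = b then 1 else 0"] bexI[of _ "\<lambda>_. 0"]) auto
qed

lemma spanned_lincomb:
  assumes "spanned \<mu> k P" "spanned \<mu> k Q"
  shows "spanned \<mu> k (\<lambda>z. x * P z + y * Q z)"
proof -
  obtain a R where P: "R \<in> polys_below k" "P = (\<lambda>z. (\<Sum>b\<in>adm k. a b * basisPair \<mu> k b z) + R z)"
    using assms(1) unfolding spanned_def by auto
  obtain b S where Q: "S \<in> polys_below k" "Q = (\<lambda>z. (\<Sum>i\<in>adm k. b i * basisPair \<mu> k i z) + S z)"
    using assms(2) unfolding spanned_def by auto
  have "(\<lambda>z. x * P z + y * Q z) = (\<lambda>z. (\<Sum>i\<in>adm k. (x * a i + y * b i) * basisPair \<mu> k i z) + (x * R z + y * S z))"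
    unfolding P(2) Q(2) by (simp add: fun_eq_iff algebra_simps sum.distrib sum_distrib_left)
  moreover have "(\<lambda>z. x * R z + y * S z) \<in> polys_below k"
    using P Q by (intro polys_below_add polys_below_cmult)
  ultimately show ?thesis unfolding spanned_def
    by (intro exI[of _ "\<lambda>i. x * a i + y * b i"] bexI[of _ "\<lambda>z. x * R z + y * S z"])
qed

text \<open>The leading part of the basis element is \<kappa> times this function, and \<kappa> is
  nonzero, so one can solve for it modulo lower degree.\<close>

lemma spanned_leading:
  assumes b: "(i, \<epsilon>) \<in> adm k"
  shows "spanned \<mu> k (\<lambda>z. nrm2 z ^ i * har (eps_unit \<epsilon>) (k - 2 * i) z)"
proof -
  define j where "j = k - 2 * i"
  have k: "k = 2 * i + j" using adm_cases(1)[OF b] by (simp add: j_def)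
  define J where "J = Jacobi i (\<mu> - 1/2) (real j)"
  \<comment> \<open>The substitution of 2 r^2 - 1 multiplies the leading coefficient by 2^i.\<close>
  define c where "c = coeff J i * 2 ^ i"
  define r where "r = pcompose J [:-1, 2:] - smult c (monom 1 i)"
  define \<kappa> where "\<kappa> = h_coef \<mu> i k * c"
  have \<kappa>: "\<kappa> \<noteq> 0"
    using coeff_Jacobi_nonzero[OF mu, of i j] h_coef_square(2)[OF mu, of i k]
    by (simp add: \<kappa>_def c_def J_def)
  have dJ: "degree J \<le> i" unfolding J_def by (rule degree_Jacobi[OF mu])
  have cJ: "coeff (pcompose J [:-1, 2:]) i = c"
  proof (cases "degree J = i")
    case True
    hence "degree (pcompose J [:-1, 2:]) = i" by (simp add: degree_pcompose)
    with lead_coeff_comp[of "[:-1, 2:]" J] True show ?thesis by (simp add: c_def)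
  next
    case False
    thus ?thesis using \<kappa> dJ by (simp add: \<kappa>_def c_def coeff_eq_0)
  qed
  have r: "(\<lambda>z. poly r (nrm2 z) * har (eps_unit \<epsilon>) j z) \<in> polys_below k"
  proof (cases "i = 0")
    case True
    then obtain x where "J = [:x:]" using dJ by (auto elim: degree_eq_zeroE)
    hence "r = 0" using True by (simp add: r_def c_def monom_0)
    thus ?thesis by simp
  next
    case False
    have "degree r < i" unfolding r_def
      using False dJ cJ by (intro degree_diff_less_of_coeff)
        (auto simp: degree_pcompose intro: order.trans[OF degree_smult_le] degree_monom_le)
    thus ?thesis using k by (intro radial_har_polys_below) simp
  qed
  have "basisPair \<mu> k (i, \<epsilon>) z = \<kappa> * (nrm2 z ^ i * har (eps_unit \<epsilon>) j z)
      + h_coef \<mu> i k * (poly r (nrm2 z) * har (eps_unit \<epsilon>) j z)" for z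
  proof -
    have "poly J (2 * nrm2 z - 1) = poly (pcompose J [:-1, 2:]) (nrm2 z)"
      by (simp add: poly_pcompose mult.commute)
    also have "\<dots> = c * nrm2 z ^ i + poly r (nrm2 z)"
      by (simp add: r_def poly_monom)
    finally have J: "poly J (2 * nrm2 z - 1) = c * nrm2 z ^ i + poly r (nrm2 z)" .
    have "basisPair \<mu> k (i, \<epsilon>) z = h_coef \<mu> i k * poly J (2 * nrm2 z - 1) * har (eps_unit \<epsilon>) j z"
      by (simp add: basisP_eq j_def J_def)
    thus ?thesis unfolding J by (simp add: \<kappa>_def algebra_simps)
  qed
  hence "nrm2 z ^ i * har (eps_unit \<epsilon>) j z
      = 1 / \<kappa> * basisPair \<mu> k (i, \<epsilon>) z + (- h_coef \<mu> i k / \<kappa>) * (poly r (nrm2 z) * har (eps_unit \<epsilon>) j z)" for z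
    using \<kappa> by (simp add: field_simps)
  moreover have "spanned \<mu> k (\<lambda>z. 1 / \<kappa> * basisPair \<mu> k (i, \<epsilon>) z + (- h_coef \<mu> i k / \<kappa>) * (poly r (nrm2 z) * har (eps_unit \<epsilon>) j z))"
    by (intro spanned_lincomb spanned_basis b spanned_lower r)
  ultimately show ?thesis by (simp add: j_def)
qed

lemma spanned_polys_below:
  assumes "P \<in> polys_below (Suc k)"
  shows "spanned \<mu> k P"
proof -
  have "P \<in> polar (Suc k)" using assms by (rule polys_below_polar)
  thus ?thesis
  proof induction
    case (gen i j c)
    show ?case
    proof (cases "2 * i + j < k")
      case True
      thus ?thesis by (intro spanned_lower nrm2_power_har_polys_below)
    next
      case False
      hence j: "j = k - 2 * i" "2 * i \<le> k" using gen by auto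
      have 0: "spanned \<mu> k (\<lambda>z. nrm2 z ^ i * har (eps_unit 0) j z)"
        unfolding j using j by (intro spanned_leading) (simp add: adm_def)
      have 1: "spanned \<mu> k (\<lambda>z. nrm2 z ^ i * har (eps_unit 1) j z)"
      \<comment> \<open>For \<open>j = 0\<close> there is no sine element in the basis, and
        \<open>har (eps_unit 1) 0\<close> is 0.\<close>
      proof (cases "j = 0")
        case True
        thus ?thesis using spanned_lower[of "\<lambda>_. 0" k] by (simp add: eps_unit_def)
      next
        case False
        thus ?thesis unfolding j using j by (intro spanned_leading) (simp add: adm_def)
      qed
      have "(\<lambda>z. nrm2 z ^ i * har c j z)
          = (\<lambda>z. Re c * (nrm2 z ^ i * har (eps_unit 0) j z) + (- Im c) * (nrm2 z ^ i * har (eps_unit 1) j z))"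
        by (simp add: fun_eq_iff har_def eps_unit_def algebra_simps)
      with spanned_lincomb[OF 0 1, of "Re c" "- Im c"] show ?thesis by (simp only:)
    qed
  next
    case (add P Q)
    from spanned_lincomb[OF add.IH, of 1 1] show ?case by simp
  qed
qed

text \<open>The remainder of degree below \<open>k\<close> is a difference of elements of the
  orthogonal space, hence orthogonal to itself and zero.\<close>

lemma V_expansion:
  assumes "Q \<in> orth_space \<mu> k"
  shows "Q z = (\<Sum>b\<in>adm k. ip \<mu> Q (basisPair \<mu> k b) * basisPair \<mu> k b z)"
proof -
  obtain a R where R: "R \<in> polys_below k" "Q = (\<lambda>z. (\<Sum>b\<in>adm k. a b * basisPair \<mu> k b z) + R z)"
    using spanned_polys_below[of Q k] assms unfolding orth_space_def spanned_def by blast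
  have S: "(\<lambda>z. \<Sum>b\<in>adm k. a b * basisPair \<mu> k b z) \<in> orth_space \<mu> k"
    by (intro V_sum finite_adm basisP_V)
  have "R = (\<lambda>z. Q z - (\<Sum>b\<in>adm k. a b * basisPair \<mu> k b z))" by (simp add: R(2) fun_eq_iff)
  hence "R \<in> orth_space \<mu> k" using V_diff[OF assms S] by simp
  hence "ip \<mu> R R = 0" using R(1) by (simp add: orth_space_def)
  hence "R = (\<lambda>_. 0)" by (rule ip_self_eq_0[OF R(1)])
  hence Q: "Q = (\<lambda>z. \<Sum>b\<in>adm k. a b * basisPair \<mu> k b z)" using R(2) by simp
  have "ip \<mu> Q (basisPair \<mu> k b) = a b" if b: "b \<in> adm k" for b
  proof -
    have "ip \<mu> (basisPair \<mu> k b) Q = (\<Sum>b'\<in>adm k. a b' * ip \<mu> (basisPair \<mu> k b) (basisPair \<mu> k b'))"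
      unfolding Q using b
      by (intro ip_sum_right finite_adm ip_continuous_integrable V_continuous[OF basisP_V]) auto
    also have "\<dots> = (\<Sum>b'\<in>adm k. if b' = b then a b' else 0)"
      using b by (intro sum.cong) (auto simp: basisP_orthonormal')
    finally show ?thesis using b finite_adm by (simp add: ip_commute[of _ Q] sum.delta)
  qed
  thus ?thesis by (subst Q) simp
qed

lemma ridge_expansion: "ridge \<mu> k \<theta> z = (\<Sum>b\<in>adm k. basisPair \<mu> k b (cos \<theta>, sin \<theta>) * basisPair \<mu> k b z)"
  using V_expansion[OF ridge_orth_space[OF mu, of k \<theta>], of z] ip_ridge_reproducing[OF mu basisP_V, of _ k \<theta>]
  by (simp add: ip_commute[of _ "ridge \<mu> k \<theta>"])

text \<open>The candidate has the same inner products with the orthogonal space as \<open>f\<close>,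
  and two such elements differ by one that is orthogonal to itself.\<close>

lemma proj_eq:
  assumes f: "f \<in> L2_disk \<mu>"
  shows "proj k \<mu> f z = (\<Sum>b\<in>adm k. ip \<mu> f (basisPair \<mu> k b) * basisPair \<mu> k b z)"
proof -
  let ?P = "\<lambda>z. \<Sum>b\<in>adm k. ip \<mu> f (basisPair \<mu> k b) * basisPair \<mu> k b z"
  have P: "?P \<in> orth_space \<mu> k" by (intro V_sum finite_adm basisP_V)
  have fi: "set_integrable lebesgue disk (\<lambda>z. f z * Q z * disk_weight \<mu> z)" if "Q \<in> orth_space \<mu> k" for Q
    using L2_disk_integrable[OF mu f V_continuous[OF that]] .
  have diff: "ip \<mu> (\<lambda>z. f z - P z) Q = ip \<mu> f Q - ip \<mu> P Q" if "P \<in> orth_space \<mu> k" "Q \<in> orth_space \<mu> k" for P Q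
    using that by (intro ip_diff_left fi ip_continuous_integrable V_continuous)
  have fQ: "ip \<mu> f Q = ip \<mu> ?P Q" if Q: "Q \<in> orth_space \<mu> k" for Q
  proof -
    have "ip \<mu> f Q = ip \<mu> f (\<lambda>z. \<Sum>b\<in>adm k. ip \<mu> Q (basisPair \<mu> k b) * basisPair \<mu> k b z)"
      by (rule arg_cong[where f = "ip \<mu> f"]) (simp add: V_expansion[OF Q] fun_eq_iff)
    also have "\<dots> = (\<Sum>b\<in>adm k. ip \<mu> Q (basisPair \<mu> k b) * ip \<mu> f (basisPair \<mu> k b))"
      by (intro ip_sum_right finite_adm fi basisP_V)
    also have "\<dots> = (\<Sum>b\<in>adm k. ip \<mu> f (basisPair \<mu> k b) * ip \<mu> Q (basisPair \<mu> k b))" by (simp only: mult.commute)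
    also have "\<dots> = ip \<mu> Q ?P"
      using Q by (intro ip_sum_right[symmetric] finite_adm ip_continuous_integrable V_continuous[OF basisP_V] V_continuous[OF Q])
    finally show ?thesis by (simp only: ip_commute)
  qed
  have "proj k \<mu> f = ?P"
    unfolding proj_def orth_polys_eq
  proof (rule the_equality, intro conjI ballI P)
    show "ip \<mu> (\<lambda>z. f z - ?P z) Q = 0" if "Q \<in> orth_space \<mu> k" for Q
      using diff[OF P that] fQ[OF that] by simp
  next
    fix P' assume P': "P' \<in> orth_space \<mu> k \<and> (\<forall>Q\<in>orth_space \<mu> k. ip \<mu> (\<lambda>z. f z - P' z) Q = 0)"
    define R where "R = (\<lambda>z. ?P z - P' z)"
    have R: "R \<in> orth_space \<mu> k" unfolding R_def using P P' by (intro V_diff) auto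
    have "ip \<mu> R R = ip \<mu> ?P R - ip \<mu> P' R"
      using R P P' unfolding R_def[of] by (subst ip_diff_left) (auto intro!: ip_continuous_integrable V_continuous simp: R_def[symmetric])
    also have "\<dots> = 0" using diff[of P' R] fQ[OF R] P' R by simp
    finally have "R = (\<lambda>_. 0)" using R by (intro ip_self_eq_0[of R "Suc k"]) (auto simp: orth_space_def)
    thus "P' = ?P" by (simp add: R_def fun_eq_iff)
  qed
  thus ?thesis by simp
qed

end

subsection \<open>Equally spaced nodes\<close>

definition node :: "nat \<Rightarrow> nat \<Rightarrow> real" where
  "node m \<nu> = 2 * real \<nu> * pi / (2 * real m + 1)"

lemma cpt_circle: "cpt (cos \<theta>, sin \<theta>) = cis \<theta>"
  by (simp add: cpt_def complex_eq_iff)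

lemma nrm2_circle [simp]: "nrm2 (cos \<theta>, sin \<theta>) = 1"
  by (simp add: nrm2_def)

text \<open>A geometric sum of powers of a root of unity of order dividing 2 m + 1, which differs
  from 1 by the divisibility assumption; n = 0 is excluded because every number divides 0.\<close>

lemma sum_cis_node:
  assumes "\<not> (2 * m + 1) dvd n"
  shows "(\<Sum>\<nu>=0..2 * m. cis (node m \<nu>) ^ n) = 0"
proof -
  define w where "w = cis (2 * pi * real n / real (2 * m + 1))"
  have w: "cis (node m \<nu>) ^ n = w ^ \<nu>" for \<nu>
    by (simp add: w_def node_def Complex.DeMoivre mult_ac add_ac)
  have "w \<noteq> 1"
  proof
    assume "w = 1"
    hence "cos (2 * pi * real n / real (2 * m + 1)) = 1"
      by (simp add: w_def complex_eq_iff)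
    then obtain i :: int where "2 * pi * real n / real (2 * m + 1) = of_int i * 2 * pi"
      using cos_one_2pi_int by auto
    hence "pi * (2 * real n) = pi * (2 * (of_int i * real (2 * m + 1)))" by (simp add: field_simps)
    hence "real n = of_int i * real (2 * m + 1)" by (simp only: mult_cancel_left) simp
    hence "int n = i * int (2 * m + 1)" by (metis of_int_eq_iff of_int_mult of_int_of_nat_eq)
    hence "int (2 * m + 1) dvd int n" by simp
    with assms show False by (simp only: of_nat_dvd_iff)
  qed
  have "w ^ (2 * m + 1) = 1"
  proof -
    have "w ^ (2 * m + 1) = cis (real (2 * m + 1) * (2 * pi * real n / real (2 * m + 1)))"
      unfolding w_def by (rule Complex.DeMoivre)
    also have "real (2 * m + 1) * (2 * pi * real n / real (2 * m + 1)) = 2 * pi * real n" by simp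
    finally show ?thesis by (simp add: complex_eq_iff)
  qed
  hence "(\<Sum>\<nu><2 * m + 1. w ^ \<nu>) = 0"
    using \<open>w \<noteq> 1\<close> geometric_sum[of w "2 * m + 1"] by simp
  moreover have "{0..2 * m} = {..<2 * m + 1}" by auto
  ultimately show ?thesis by (simp only: w)
qed

lemma sum_har_node:
  assumes "\<not> (2 * m + 1) dvd n"
  shows "(\<Sum>\<nu>=0..2 * m. har c n (cos (node m \<nu>), sin (node m \<nu>))) = 0"
proof -
  have "(\<Sum>\<nu>=0..2 * m. har c n (cos (node m \<nu>), sin (node m \<nu>))) = Re (c * (\<Sum>\<nu>=0..2 * m. cis (node m \<nu>) ^ n))"
    by (simp add: har_def cpt_circle sum_distrib_left)
  thus ?thesis by (simp add: sum_cis_node[OF assms])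
qed

text \<open>The frequencies \<open>j + j'\<close> are even and at most \<open>4 m\<close>,
  so they are no nonzero multiple of the odd number \<open>2 m + 1\<close>.\<close>

lemma sum_har_har_node:
  assumes "j \<le> 2 * m" "j' \<le> 2 * m" "even (j + j')"
  shows "(\<Sum>\<nu>=0..2 * m. har a j (cos (node m \<nu>), sin (node m \<nu>)) * har b j' (cos (node m \<nu>), sin (node m \<nu>)))
     = (if j = j' then (2 * real m + 1) * (if j = 0 then Re a * Re b else Re (a * cnj b) / 2) else 0)"
proof -
  let ?S = "\<lambda>c n. \<Sum>\<nu>=0..2 * m. har c n (cos (node m \<nu>), sin (node m \<nu>))"
  have nd: "\<not> (2 * m + 1) dvd (j + j')"
    if "j + j' > 0" and le: "j \<le> 2 * m" "j' \<le> 2 * m" "even (j + j')" for j j' :: nat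
  proof
    assume "(2 * m + 1) dvd (j + j')"
    moreover have "coprime (2 * m + 1) 2" by simp
    \<comment> \<open>An even multiple of an odd number is a multiple of 4 m + 2, which exceeds j +
      j' \<le> 4 m.\<close>
    ultimately have "(2 * m + 1) * 2 dvd (j + j')"
      using le(3) by (intro divides_mult) auto
    from dvd_imp_le[OF this \<open>j + j' > 0\<close>] le show False by simp
  qed
  have split: "(\<Sum>\<nu>=0..2 * m. har a j (cos (node m \<nu>), sin (node m \<nu>)) * har b j' (cos (node m \<nu>), sin (node m \<nu>)))
      = 1/2 * ?S (a * b) (j + j') + 1/2 * ?S (a * cnj b) (j - j')" if "j' \<le> j" for a b j j'
    unfolding har_mult[OF that] nrm2_circle power_one mult_1 sum.distrib sum_distrib_left ..
  have less: "(\<Sum>\<nu>=0..2 * m. har a j (cos (node m \<nu>), sin (node m \<nu>)) * har b j' (cos (node m \<nu>), sin (node m \<nu>))) = 0"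
    if "j' < j" "j \<le> 2 * m" "even (j + j')" for a b j j'
  proof -
    have "\<not> (2 * m + 1) dvd (j - j')" using that by (auto dest: dvd_imp_le)
    thus ?thesis using split[of j' j a b] sum_har_node nd[of j j'] that by simp
  qed
  consider "j = j'" "j = 0" | "j = j'" "j > 0" | "j' < j" | "j < j'" by linarith
  thus ?thesis
  proof cases
    case 1
    thus ?thesis by simp
  next
    case 2
    have "?S (a * b) (j + j) = 0" by (rule sum_har_node) (use nd[of j j] 2 assms in simp)
    moreover have "?S (a * cnj b) (j - j) = (2 * real m + 1) * Re (a * cnj b)"
      by (simp only: diff_self_eq_0 har_0 sum_constant) simp
    ultimately show ?thesis using split[of j j a b] 2 by simp
  next
    case 3
    thus ?thesis using less[OF 3] assms by simp
  next
    case 4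
    hence "(\<Sum>\<nu>=0..2 * m. har b j' (cos (node m \<nu>), sin (node m \<nu>)) * har a j (cos (node m \<nu>), sin (node m \<nu>))) = 0"
      using assms by (intro less) (auto simp: add.commute)
    thus ?thesis using 4 by (simp add: mult.commute)
  qed
qed

section \<open>Values of the basis on the circle and the quadrature formula\<close>

context
  fixes \<mu> :: real
  assumes mu: "\<mu> \<ge> 0"
begin

text \<open>Since \<open>jac\<close> is 1 at 1, the value is the scaling factor between
  \<open>Jacobi\<close> and \<open>jac\<close>; its square is the quotient of their square
  integrals, both known.\<close>

lemma Jacobi_at_1_square:
  "(poly (Jacobi l (\<mu> - 1/2) (real j)) 1)\<^sup>2
     = Gamma (real j + 1) * Gamma (real l + real j + \<mu> + 1/2) * pochhammer (\<mu> + 1/2) l * (2 * real l + real j + \<mu> + 1/2)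
       / (Gamma (real j + \<mu> + 3/2) * Gamma (real l + real j + 1) * fact l)"
proof -
  let ?N = "jint (\<mu> - 1/2) (real j) (jac l (\<mu> - 1/2) (real j) * jac l (\<mu> - 1/2) (real j))"
  let ?s = "poly (Jacobi l (\<mu> - 1/2) (real j)) 1"
  have s: "Jacobi l (\<mu> - 1/2) (real j) = smult ?s (jac l (\<mu> - 1/2) (real j))"
    unfolding Jacobi_eq_jac[OF disk_params[OF mu]] by simp
  have "jint (\<mu> - 1/2) (real j) (smult ?s (jac l (\<mu> - 1/2) (real j)) * smult ?s (jac l (\<mu> - 1/2) (real j))) = ?s\<^sup>2 * ?N"
    by (simp add: jint_smult power2_eq_square)
  hence "?s\<^sup>2 * ?N = jint (\<mu> - 1/2) (real j) (Jacobi l (\<mu> - 1/2) (real j) * Jacobi l (\<mu> - 1/2) (real j))"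
    unfolding s[symmetric] ..
  hence N: "?s\<^sup>2 * ?N = 2 powr (\<mu> + 1/2 + real j) * Beta (\<mu> + 1/2) (real j + 1)"
    by (simp only: jint_Jacobi_square[OF mu])
  have e: "\<mu> - 1/2 + real j + 1 = \<mu> + 1/2 + real j" "\<mu> - 1/2 + 1 = \<mu> + 1/2" "real j + 1 + real l = real l + real j + 1"
    "real l + (\<mu> - 1/2) + real j + 1 = real l + real j + \<mu> + 1/2"
    "2 * real l + (\<mu> - 1/2) + real j + 1 = 2 * real l + real j + \<mu> + 1/2"
    by simp_all
  have NN: "?N = 2 powr (\<mu> + 1/2 + real j) * Gamma (\<mu> + 1/2) * Gamma (real l + real j + 1) * fact l
      / (Gamma (real l + real j + \<mu> + 1/2) * pochhammer (\<mu> + 1/2) l * (2 * real l + real j + \<mu> + 1/2))"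
    using jint_jac_square[OF disk_params[OF mu], of j l] unfolding e .
  have b: "Beta (\<mu> + 1/2) (real j + 1) = Gamma (\<mu> + 1/2) * Gamma (real j + 1) / Gamma (real j + \<mu> + 3/2)"
    by (simp add: Beta_def algebra_simps)
  have pos: "Gamma (\<mu> + 1/2) > 0" "Gamma (real l + real j + 1) > 0"
    using mu by (auto intro!: Gamma_real_pos)
  have c: "Gamma (real l + real j + \<mu> + 1/2) > 0" "pochhammer (\<mu> + 1/2) l > 0" "2 * real l + real j + \<mu> + 1/2 > 0"
    "Gamma (real j + \<mu> + 3/2) > 0"
    using mu by (auto intro!: Gamma_real_pos pochhammer_pos add_nonneg_pos)
  have gen: "x = Gj * Gc * p * d / (G3 * Glj * F)"
    if "x * (w * G * Glj * F / (Gc * p * d)) = w * (G * Gj / G3)"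
      and "w > 0" "G > 0" "Glj > 0" "F > 0" "Gc > 0" "p > 0" "d > 0" "G3 > 0"
    for x w G Glj F Gc p d Gj G3 :: real
  proof -
    have "x * (Glj * F / (Gc * p * d)) * (w * G) = Gj / G3 * (w * G)"
      using that(1) by (simp add: mult_ac)
    hence "x * (Glj * F / (Gc * p * d)) = Gj / G3"
      using that(2,3) by (simp only: mult_cancel_right) auto
    thus ?thesis using that(4-) by (simp add: field_simps)
  qed
  show ?thesis by (rule gen[OF N[unfolded NN b]]) (use pos c in auto)
qed

text \<open>The factors after \<open>lam\<close> form the mean square of the basis element on the
  unit circle: there the radial argument 2 r^2 - 1 is 1, and the angular factor has mean square
  \<open>d_coef\<close>.\<close>

lemma lam_h_coef:
  assumes "2 * l \<le> k"
  shows "lam \<mu> l k * ((h_coef \<mu> l k)\<^sup>2 * d_coef l k * (poly (Jacobi l (\<mu> - 1/2) (real (k - 2 * l))) 1)\<^sup>2) = 1"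
proof -
  define j where "j = k - 2 * l"
  have k: "k = 2 * l + j" "k - l = l + j" using assms by (simp_all add: j_def)
  \<comment> \<open>\<open>c\<close> is k - l + \<mu> + 1/2 and c + l is k + \<mu> + 1/2, the two
    linear factors of \<open>lam\<close>.\<close>
  define c where "c = real l + real j + \<mu> + 1/2"
  have c: "c > 0" using mu by (simp add: c_def)
  hence "c \<notin> \<int>\<^sub>\<le>\<^sub>0" by (auto dest: nonpos_Ints_nonpos)
  from Gamma_plus1[OF this] have gc: "Gamma (c + 1) = c * Gamma c" .
  have "\<mu> + 3/2 \<notin> \<int>\<^sub>\<le>\<^sub>0" using mu by (auto dest: nonpos_Ints_nonpos)
  from pochhammer_Gamma[OF this, of "l + j"]
  have p: "pochhammer (\<mu> + 3/2) (l + j) = c * Gamma c / Gamma (\<mu> + 3/2)"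
  proof -
    have "\<mu> + 3/2 + real (l + j) = c + 1" by (simp add: c_def)
    with \<open>pochhammer (\<mu> + 3/2) (l + j) = _\<close> show ?thesis by (simp only: gc)
  qed
  have f: "Gamma (real l + real j + 1) = fact (l + j)" "Gamma (real j + 1) = fact j"
    using Gamma_fact[of "l + j", where 'a = real] Gamma_fact[of j, where 'a = real] by (simp_all add: add_ac)
  have J: "(poly (Jacobi l (\<mu> - 1/2) (real j)) 1)\<^sup>2
     = fact j * Gamma c * pochhammer (\<mu> + 1/2) l * (c + real l) / (Gamma (real j + \<mu> + 3/2) * fact (l + j) * fact l)"
    using Jacobi_at_1_square[of l j] unfolding f c_def by (simp add: algebra_simps)
  have h: "(h_coef \<mu> l k)\<^sup>2 * d_coef l k = Gamma (real j + \<mu> + 3/2) / (Gamma (\<mu> + 3/2) * fact j)"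
    using h_coef_square(1)[OF mu, of l k] unfolding j_def[symmetric] f .
  have L: "lam \<mu> l k = fact l * fact (l + j) * c / (pochhammer (\<mu> + 1/2) l * (c * Gamma c / Gamma (\<mu> + 3/2)) * (c + real l))"
  proof -
    have "real (k - l) + \<mu> + 1/2 = c" "real k + \<mu> + 1/2 = c + real l" by (simp_all add: k c_def)
    thus ?thesis unfolding lam_def k(2) p by simp
  qed
  have pos: "Gamma (real j + \<mu> + 3/2) > 0" "Gamma (\<mu> + 3/2) > 0" "Gamma c > 0" "pochhammer (\<mu> + 1/2) l > 0" "c + real l > 0"
    using mu c by (auto intro!: Gamma_real_pos pochhammer_pos)
  have gen: "F * H * c / (P * (c * G / A) * d) * (B / (A * I) * (I * G * P * d / (B * H * F))) = 1"
    if "F > 0" "H > 0" "I > 0" "B > 0" "A > 0" "G > 0" "P > 0" "d > 0" for F H I B A G P d :: real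
    using that c by simp
  show ?thesis unfolding j_def[symmetric] h J L
    by (rule gen) (use pos in auto)
qed

text \<open>All frequencies k - 2 l have the parity of \<open>k\<close>, so their sums are even as
  \<open>sum_har_har_node\<close> demands, and distinct \<open>l\<close> have distinct
  frequencies.\<close>

lemma sum_basisP_node:
  assumes b: "b \<in> adm k" "b' \<in> adm k" and km: "k \<le> 2 * m"
  shows "lam \<mu> (fst b') k * (\<Sum>\<nu>=0..2 * m. basisPair \<mu> k b (cos (node m \<nu>), sin (node m \<nu>)) * basisPair \<mu> k b' (cos (node m \<nu>), sin (node m \<nu>)))
     = (if b = b' then 2 * real m + 1 else 0)"
proof -
  obtain l \<epsilon> l' \<epsilon>' where e: "b = (l, \<epsilon>)" "b' = (l', \<epsilon>')" by fastforce
  let ?J = "\<lambda>l. poly (Jacobi l (\<mu> - 1/2) (real (k - 2 * l))) 1"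
  let ?H = "\<lambda>l \<epsilon> \<nu>. har (eps_unit \<epsilon>) (k - 2 * l) (cos (node m \<nu>), sin (node m \<nu>))"
  have l: "2 * l \<le> k" "2 * l' \<le> k" using b adm_cases(1) by (auto simp: e)
  have "(\<Sum>\<nu>=0..2 * m. basisPair \<mu> k b (cos (node m \<nu>), sin (node m \<nu>)) * basisPair \<mu> k b' (cos (node m \<nu>), sin (node m \<nu>)))
      = h_coef \<mu> l k * ?J l * (h_coef \<mu> l' k * ?J l') * (\<Sum>\<nu>=0..2 * m. ?H l \<epsilon> \<nu> * ?H l' \<epsilon>' \<nu>)"
    by (simp add: e basisP_eq sum_distrib_left mult_ac)
  also have "(\<Sum>\<nu>=0..2 * m. ?H l \<epsilon> \<nu> * ?H l' \<epsilon>' \<nu>)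
      = (if k - 2 * l = k - 2 * l' then (2 * real m + 1) *
          (if k - 2 * l = 0 then Re (eps_unit \<epsilon>) * Re (eps_unit \<epsilon>') else Re (eps_unit \<epsilon> * cnj (eps_unit \<epsilon>')) / 2) else 0)"
    using km l by (intro sum_har_har_node) auto
  also have "\<dots> = (if b = b' then (2 * real m + 1) * d_coef l k else 0)"
  proof (cases "l = l'")
    case True
    thus ?thesis using eps_unit_coef[of l \<epsilon> k \<epsilon>'] b by (simp add: e)
  next
    case False
    thus ?thesis using l by (auto simp: e)
  qed
  finally have *: "lam \<mu> (fst b') k * (\<Sum>\<nu>=0..2 * m. basisPair \<mu> k b (cos (node m \<nu>), sin (node m \<nu>)) * basisPair \<mu> k b' (cos (node m \<nu>), sin (node m \<nu>)))
      = lam \<mu> l' k * (h_coef \<mu> l k * ?J l * (h_coef \<mu> l' k * ?J l') * (if b = b' then (2 * real m + 1) * d_coef l k else 0))"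
    by (simp add: e)
  show ?thesis
  proof (cases "b = b'")
    case True
    have "lam \<mu> l k * (h_coef \<mu> l k * ?J l * (h_coef \<mu> l k * ?J l) * ((2 * real m + 1) * d_coef l k))
        = (lam \<mu> l k * ((h_coef \<mu> l k)\<^sup>2 * d_coef l k * (?J l)\<^sup>2)) * (2 * real m + 1)"
      by (simp add: power2_eq_square mult_ac)
    hence "lam \<mu> l k * (h_coef \<mu> l k * ?J l * (h_coef \<mu> l k * ?J l) * ((2 * real m + 1) * d_coef l k)) = 2 * real m + 1"
      unfolding lam_h_coef[OF l(1)] by simp
    moreover have "l' = l" using True by (simp add: e)
    ultimately show ?thesis unfolding * by (simp only: if_P[OF True])
  next
    case False
    thus ?thesis using * by simp
  qed
qed

text \<open>The kernel splits into the ridge profile in \<open>t\<close> and the factor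
  \<open>D_ang\<close>, which does not depend on \<open>t\<close>; the profile is moved to the disk
  by \<open>Radon_pairing\<close>.\<close>

lemma Radon_kernel:
  assumes f: "f \<in> L2_disk \<mu>"
  shows "a_const \<mu> * (LINT t:{-1..1}|lebesgue. Radon \<mu> \<theta> f t * D_ker \<mu> k \<theta> t z) = ip \<mu> f (ridge \<mu> k \<theta>) * D_ang \<mu> k \<theta> z"
proof -
  let ?g = "\<lambda>t. (real k + \<mu> + 1/2) / (\<mu> + 1/2) * poly (Gegenbauer k (\<mu> + 1/2)) t"
  have "continuous_on UNIV (ridge \<mu> k \<theta>)"
    by (rule polys_below_continuous[OF ridge_polys_below[OF mu]])
  from L2_disk_integrable[OF mu f this]
  have i: "set_integrable lebesgue disk (\<lambda>z. f z * ?g (dotdir \<theta> z) * disk_weight \<mu> z)"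
    by (simp only: ridge_def)
  have "(LINT t:{-1..1}|lebesgue. Radon \<mu> \<theta> f t * D_ker \<mu> k \<theta> t z)
      = (LINT t:{-1..1}|lebesgue. D_ang \<mu> k \<theta> z * (Radon \<mu> \<theta> f t * ?g t))"
    unfolding D_ker_def by (simp only: mult_ac)
  also have "\<dots> = D_ang \<mu> k \<theta> z * (LINT t:{-1..1}|lebesgue. Radon \<mu> \<theta> f t * ?g t)"
    by (rule set_integral_mult_right)
  also have "(LINT t:{-1..1}|lebesgue. Radon \<mu> \<theta> f t * ?g t) = (LINT z:disk|lebesgue. f z * ridge \<mu> k \<theta> z * disk_weight \<mu> z)"
    unfolding Radon_pairing[OF i] ridge_def ..
  finally show ?thesis by (simp add: ip_def mult_ac)
qed

lemma proj_quadrature: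
  assumes f: "f \<in> L2_disk \<mu>" and km: "k \<le> 2 * m"
  shows "(2 * real m + 1) * proj k \<mu> f z
    = (\<Sum>\<nu>=0..2 * m. a_const \<mu> * (LINT t:{-1..1}|lebesgue. Radon \<mu> (node m \<nu>) f t * D_ker \<mu> k (node m \<nu>) t z))"
proof -
  let ?\<xi> = "\<lambda>\<nu>. (cos (node m \<nu>), sin (node m \<nu>))"
  have ridge: "ip \<mu> f (ridge \<mu> k \<theta>) = (\<Sum>b\<in>adm k. basisPair \<mu> k b (cos \<theta>, sin \<theta>) * ip \<mu> f (basisPair \<mu> k b))" for \<theta>
  proof -
    have "ip \<mu> f (ridge \<mu> k \<theta>) = ip \<mu> f (\<lambda>z. \<Sum>b\<in>adm k. basisPair \<mu> k b (cos \<theta>, sin \<theta>) * basisPair \<mu> k b z)"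
      by (rule arg_cong[where f = "ip \<mu> f"]) (simp add: fun_eq_iff ridge_expansion[OF mu])
    also have "\<dots> = (\<Sum>b\<in>adm k. basisPair \<mu> k b (cos \<theta>, sin \<theta>) * ip \<mu> f (basisPair \<mu> k b))"
      by (intro ip_sum_right finite_adm L2_disk_integrable[OF mu f] V_continuous[OF mu basisP_V[OF mu]])
    finally show ?thesis .
  qed
  have ang: "D_ang \<mu> k \<theta> z = (\<Sum>b'\<in>adm k. lam \<mu> (fst b') k * basisPair \<mu> k b' (cos \<theta>, sin \<theta>) * basisPair \<mu> k b' z)" for \<theta>
    by (simp add: D_ang_def split_beta)
  have "(\<Sum>\<nu>=0..2 * m. a_const \<mu> * (LINT t:{-1..1}|lebesgue. Radon \<mu> (node m \<nu>) f t * D_ker \<mu> k (node m \<nu>) t z))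
      = (\<Sum>\<nu>=0..2 * m. \<Sum>b\<in>adm k. \<Sum>b'\<in>adm k. (ip \<mu> f (basisPair \<mu> k b) * basisPair \<mu> k b' z)
          * (lam \<mu> (fst b') k * (basisPair \<mu> k b (?\<xi> \<nu>) * basisPair \<mu> k b' (?\<xi> \<nu>))))"
    unfolding Radon_kernel[OF f] ridge ang sum_product by (simp only: mult_ac)
  also have "\<dots> = (\<Sum>b\<in>adm k. \<Sum>b'\<in>adm k. \<Sum>\<nu>=0..2 * m. (ip \<mu> f (basisPair \<mu> k b) * basisPair \<mu> k b' z)
          * (lam \<mu> (fst b') k * (basisPair \<mu> k b (?\<xi> \<nu>) * basisPair \<mu> k b' (?\<xi> \<nu>))))"
    by (subst sum.swap) (intro sum.cong refl sum.swap)
  also have "\<dots> = (\<Sum>b\<in>adm k. \<Sum>b'\<in>adm k. (ip \<mu> f (basisPair \<mu> k b) * basisPair \<mu> k b' z) * (if b = b' then 2 * real m + 1 else 0))"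
    by (intro sum.cong refl) (simp only: sum_distrib_left[symmetric] sum_basisP_node[OF _ _ km])
  also have "\<dots> = (\<Sum>b\<in>adm k. \<Sum>b'\<in>adm k. if b = b' then (2 * real m + 1) * (ip \<mu> f (basisPair \<mu> k b) * basisPair \<mu> k b z) else 0)"
    by (intro sum.cong refl) auto
  also have "\<dots> = (\<Sum>b\<in>adm k. (2 * real m + 1) * (ip \<mu> f (basisPair \<mu> k b) * basisPair \<mu> k b z))"
    by (intro sum.cong refl) (simp add: sum.delta')
  also have "\<dots> = (2 * real m + 1) * proj k \<mu> f z"
    by (simp add: proj_eq[OF mu f] sum_distrib_left)
  finally show ?thesis ..
qed

end

theorem theorem2p9:
  fixes \<mu> :: real and m k :: nat and \<phi> :: "nat \<Rightarrow> real"
    and f :: "real \<times> real \<Rightarrow> real" and x y :: real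
  assumes "\<mu> \<ge> 0"
    and "k \<le> 2 * m"
    and "\<And>\<nu>. \<nu> \<le> 2 * m \<Longrightarrow> \<phi> \<nu> = 2 * real \<nu> * pi / (2 * real m + 1)"
    and "f \<in> L2_disk \<mu>"
    and "(x, y) \<in> disk"
  shows "proj k \<mu> f (x, y) =
    1 / (2 * real m + 1) *
      (\<Sum>\<nu>=0..2 * m. a_const \<mu> *
        (LINT t:{-1..1}|lebesgue. Radon \<mu> (\<phi> \<nu>) f t * D_ker \<mu> k (\<phi> \<nu>) t (x, y)))"
proof -
  have "(\<Sum>\<nu>=0..2 * m. a_const \<mu> * (LINT t:{-1..1}|lebesgue. Radon \<mu> (\<phi> \<nu>) f t * D_ker \<mu> k (\<phi> \<nu>) t (x, y)))
      = (2 * real m + 1) * proj k \<mu> f (x, y)"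
    unfolding proj_quadrature[OF assms(1,4,2)] using assms(3) by (intro sum.cong refl) (simp add: node_def)
  thus ?thesis by (simp add: add_nonneg_eq_0_iff)
qed

end
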